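(* Let $R$ be a ring, $M$ an $R$-module, $S\subseteq S'$ two saturated multiplicatively closed subsets of $R$, and $T=S^{-1}S'=\{s'/s : s'\in S', s\in S\}\subseteq R_S$. Suppose that $S$ splits $M$ and $S\cap Z(M)=S\cap Z(R)=\emptyset$. For $\mathcal{P}\in\{$having unique factorization, having finite factorization, being half factorial, having bounded factorization$\}$, the following are equivalent. (1) $M$ has $\mathcal{P}$ with respect to $S'$. (2) $M$ has $\mathcal{P}$ with respect to $S$ and the $R_S$-module $M_S$ has $\mathcal{P}$ with respect to $T$. (3) $R$ has $\mathcal{P}$ in $S\setminus\mathrm{Ann}(M)$ and $M_S$ has $\mathcal{P}$ with respect to $T$. If we further assume that $S'\setminus\mathrm{Ann}(M)$ (a subset of the $R$-module $R$) is compactly $S$-atomic, then conditions (1), (2), (3) are also equivalent for $\mathcal{P}=$ being présimplifiable and for $\mathcal{P}=$ being atomic.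
   Context: All rings are commutative with identity and all modules are unitary and nonzero. $U(R)$ is the set of units of $R$. For $N\subseteq M$, $Z(N)=\{r\in R : \exists\, 0\neq m\in N,\ rm=0\}$ and $\mathrm{Ann}(N)=\{r\in R: rN=0\}$. A multiplicatively closed subset $S$ of $R$ (containing $1$) is saturated if $xy\in S$ implies $x,y\in S$; $S$ may contain $0$, which means $S=R$. $R_S$, $M_S$ denote localizations at $S$; $T$ is a saturated multiplicatively closed subset of $R_S$. The following notions are defined for any ring $R$, $R$-module $M$ and saturated multiplicatively closed $S\subseteq R$ (and applied also to $(R,M,S')$, $(R_S,M_S,T)$ and $(R,R,R)$). For $m,n\in M$, $m\sim^S n$ means there are $s,s'\in S$ with $m=sn$, $n=s'm$; for $S=R$ write $\sim$. An element $m\in M$ is $S$-primitive if $m=sn$ with $s\in S$, $n\in M$ implies $n\sim^S m$. A nonunit $a\in R$ is irreducible if $a=bc$ with $b,c\in R$ implies $a\sim b$ or $a\sim c$ (in the $R$-module $R$). An $S$-factorization of $m\in M$ of length $k\ge 0$ is an equation $m=s_1\cdots s_kn$ with $s_i$ nonunits in $S$ and $n\in M$; it is an $S$-atomic factorization if every $s_i$ is irreducible and $n$ is $S$-primitive. $M$ is atomic with respect to $S$ ($S$-atomic) if every nonzero element of $M$ has an $S$-atomic factorization. Two $S$-atomic factorizations $m=s_1\cdots s_kn=t_1\cdots t_ln'$ are isomorphic if $k=l$, $n\sim^S n'$, and for some permutation $\sigma$ of $\{1,\dots,k\}$, $s_i\sim t_{\sigma(i)}$ for all $i$. $M$ has unique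 (resp. finite) factorization with respect to $S$ if $M$ is $S$-atomic and every nonzero element of $M$ has exactly one (resp. finitely many) $S$-atomic factorization(s) up to isomorphism. $M$ is half factorial with respect to $S$ if $M$ is $S$-atomic and for each $0\neq m\in M$ all $S$-atomic factorizations of $m$ have the same length. $M$ has bounded factorization with respect to $S$ if for every $0\neq m\in M$ there is $N_m\in\mathbb{N}$ such that every $S$-factorization of $m$ has length at most $N_m$. $M$ is présimplifiable with respect to $S$ if $sm=m$ with $s\in S$, $m\in M$ implies $s\in U(R)$ or $m=0$. For $E\subseteq R$, "$R$ has $\mathcal{P}$ in $E$" means that the condition defining $\mathcal{P}$ for the $R$-module $R$ with respect to $R$ itself holds for every nonzero nonunit element of $E$ (e.g. $R$ is atomic in $E$ if every nonzero nonunit of $E$ has an $R$-atomic factorization; $R$ has unique factorization in $E$ if each nonzero nonunit of $E$ has exactly one $R$-atomic factorization up to isomorphism); $R$ is présimplifiable in $E$ if $rx=x$ with $r\in R$, $x\in E$ implies $r\in U(R)$ or $x=0$. A compact $S$-atomic factorization of $m\in M$ is an equation $m=sn$ with $s\in S$ and $n\in M$ $S$-primitive. A subset $E\subseteq M$ is compactly $S$-atomic if every nonzero element of $E$ has a compact $S$-atomic factorization; $E$ is semi-$S$-factorable if moreover for every $0\neq m\in E$ and compact $S$-atomic factorizations $m=sn=s'n'$ one has $s\sim s'$. $S$ splits $E$ if (i) $E$ is semi-$S$-factorable, and (ii) for every $S$-primitive $r\in R$ (in the $R$-module $R$) and every $S$-primitive $m\in M$ with $0\neq rm\in E$, the element $rm$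 is $S$-primitive. *)

theory Defs
  imports "HOL-Algebra.Algebra"
begin

section \<open>Modules and multiplicatively closed subsets\<close>

definition regular_module :: "('a, 'c) ring_scheme \<Rightarrow> ('a, 'a) module" where
  "regular_module R =
     \<lparr>carrier = carrier R, monoid.mult = (\<otimes>\<^bsub>R\<^esub>), one = \<one>\<^bsub>R\<^esub>,
      ring.zero = \<zero>\<^bsub>R\<^esub>, add = (\<oplus>\<^bsub>R\<^esub>), smult = (\<otimes>\<^bsub>R\<^esub>)\<rparr>"

definition zero_divisors_on ::
    "('a, 'c) ring_scheme \<Rightarrow> ('a, 'b, 'd) module_scheme \<Rightarrow> 'a set" where
  "zero_divisors_on R M =
     {r \<in> carrier R. \<exists>m \<in> carrier M. m \<noteq> \<zero>\<^bsub>M\<^esub> \<and> r \<odot>\<^bsub>M\<^esub> m = \<zero>\<^bsub>M\<^esub>}"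

definition annihilator ::
    "('a, 'c) ring_scheme \<Rightarrow> ('a, 'b, 'd) module_scheme \<Rightarrow> 'a set" where
  "annihilator R M = {r \<in> carrier R. \<forall>m \<in> carrier M. r \<odot>\<^bsub>M\<^esub> m = \<zero>\<^bsub>M\<^esub>}"

definition saturated_submonoid :: "('a, 'c) ring_scheme \<Rightarrow> 'a set \<Rightarrow> bool" where
  "saturated_submonoid R S \<longleftrightarrow> submonoid S R \<and>
     (\<forall>x \<in> carrier R. \<forall>y \<in> carrier R. x \<otimes>\<^bsub>R\<^esub> y \<in> S \<longrightarrow> x \<in> S \<and> y \<in> S)"


section \<open>Localization\<close>

definition loc_rel ::
    "('a, 'c) ring_scheme \<Rightarrow> ('a, 'b, 'd) module_scheme \<Rightarrow> 'a set \<Rightarrow> (('b \<times> 'a) \<times> ('b \<times> 'a)) set" where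
  "loc_rel R M S =
     {((m, s), (n, t)). m \<in> carrier M \<and> n \<in> carrier M \<and> s \<in> S \<and> t \<in> S \<and>
        (\<exists>u \<in> S. u \<odot>\<^bsub>M\<^esub> (t \<odot>\<^bsub>M\<^esub> m) = u \<odot>\<^bsub>M\<^esub> (s \<odot>\<^bsub>M\<^esub> n))}"

text \<open>\<open>loc_frac R M S m s\<close> is the fraction \<open>m / s\<close>, the class of \<open>(m, s)\<close>.\<close>

definition loc_frac ::
    "('a, 'c) ring_scheme \<Rightarrow> ('a, 'b, 'd) module_scheme \<Rightarrow> 'a set \<Rightarrow> 'b \<Rightarrow> 'a \<Rightarrow> ('b \<times> 'a) set" where
  "loc_frac R M S m s = loc_rel R M S `` {(m, s)}"

definition loc_add ::
    "('a, 'c) ring_scheme \<Rightarrow> ('a, 'b, 'd) module_scheme \<Rightarrow> 'a set \<Rightarrow>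
       ('b \<times> 'a) set \<Rightarrow> ('b \<times> 'a) set \<Rightarrow> ('b \<times> 'a) set" where
  "loc_add R M S p q = (\<Union>(m, s) \<in> p. \<Union>(n, t) \<in> q.
     loc_frac R M S (t \<odot>\<^bsub>M\<^esub> m \<oplus>\<^bsub>M\<^esub> s \<odot>\<^bsub>M\<^esub> n) (s \<otimes>\<^bsub>R\<^esub> t))"

definition loc_smult ::
    "('a, 'c) ring_scheme \<Rightarrow> ('a, 'b, 'd) module_scheme \<Rightarrow> 'a set \<Rightarrow>
       ('a \<times> 'a) set \<Rightarrow> ('b \<times> 'a) set \<Rightarrow> ('b \<times> 'a) set" where
  "loc_smult R M S p q = (\<Union>(a, s) \<in> p. \<Union>(m, t) \<in> q.
     loc_frac R M S (a \<odot>\<^bsub>M\<^esub> m) (s \<otimes>\<^bsub>R\<^esub> t))"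

definition loc_ring :: "('a, 'c) ring_scheme \<Rightarrow> 'a set \<Rightarrow> ('a \<times> 'a) set ring" where
  "loc_ring R S =
     \<lparr>carrier = (carrier R \<times> S) // loc_rel R (regular_module R) S,
      monoid.mult = loc_smult R (regular_module R) S,
      one = loc_frac R (regular_module R) S \<one>\<^bsub>R\<^esub> \<one>\<^bsub>R\<^esub>,
      ring.zero = loc_frac R (regular_module R) S \<zero>\<^bsub>R\<^esub> \<one>\<^bsub>R\<^esub>,
      add = loc_add R (regular_module R) S\<rparr>"

text \<open>The fields \<open>mult\<close> and \<open>one\<close> of a module record carry no meaning for a module.\<close>

definition loc_module ::
    "('a, 'c) ring_scheme \<Rightarrow> ('a, 'b, 'd) module_scheme \<Rightarrow> 'a set \<Rightarrow>
       (('a \<times> 'a) set, ('b \<times> 'a) set) module" where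
  "loc_module R M S =
     \<lparr>carrier = (carrier M \<times> S) // loc_rel R M S,
      monoid.mult = undefined,
      one = undefined,
      ring.zero = loc_frac R M S \<zero>\<^bsub>M\<^esub> \<one>\<^bsub>R\<^esub>,
      add = loc_add R M S,
      smult = loc_smult R M S\<rparr>"

definition loc_set :: "('a, 'c) ring_scheme \<Rightarrow> 'a set \<Rightarrow> 'a set \<Rightarrow> ('a \<times> 'a) set set" where
  "loc_set R S S' = {loc_frac R (regular_module R) S s' s | s' s. s' \<in> S' \<and> s \<in> S}"


section \<open>Factorizations in modules\<close>

definition msim ::
    "('a, 'c) ring_scheme \<Rightarrow> ('a, 'b, 'd) module_scheme \<Rightarrow> 'a set \<Rightarrow> 'b \<Rightarrow> 'b \<Rightarrow> bool" where
  "msim R M S m n \<longleftrightarrow> (\<exists>s \<in> S. \<exists>s' \<in> S. m = s \<odot>\<^bsub>M\<^esub> n \<and> n = s' \<odot>\<^bsub>M\<^esub> m)"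

definition rsim :: "('a, 'c) ring_scheme \<Rightarrow> 'a \<Rightarrow> 'a \<Rightarrow> bool" where
  "rsim R = msim R (regular_module R) (carrier R)"

definition mprimitive ::
    "('a, 'c) ring_scheme \<Rightarrow> ('a, 'b, 'd) module_scheme \<Rightarrow> 'a set \<Rightarrow> 'b \<Rightarrow> bool" where
  "mprimitive R M S m \<longleftrightarrow> m \<in> carrier M \<and>
     (\<forall>s \<in> S. \<forall>n \<in> carrier M. m = s \<odot>\<^bsub>M\<^esub> n \<longrightarrow> msim R M S n m)"

text \<open>
  Irreducibility in the sense of rings with zero divisors; this is not the library constant
  \<open>irreducible\<close>, and it admits \<open>\<zero>\<close> as an irreducible of a domain.
\<close>

definition rirreducible :: "('a, 'c) ring_scheme \<Rightarrow> 'a \<Rightarrow> bool" where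
  "rirreducible R a \<longleftrightarrow> a \<in> carrier R - Units R \<and>
     (\<forall>b \<in> carrier R. \<forall>c \<in> carrier R. a = b \<otimes>\<^bsub>R\<^esub> c \<longrightarrow> rsim R a b \<or> rsim R a c)"

text \<open>
  The pair \<open>([s\<^sub>1, \<dots>, s\<^sub>k], n)\<close> encodes the factorization \<open>m = s\<^sub>1 \<cdots> s\<^sub>k n\<close> of length \<open>k\<close>.
\<close>

definition factorizations ::
    "('a, 'c) ring_scheme \<Rightarrow> ('a, 'b, 'd) module_scheme \<Rightarrow> 'a set \<Rightarrow> 'b \<Rightarrow> ('a list \<times> 'b) set" where
  "factorizations R M S m =
     {(ss, n). set ss \<subseteq> S - Units R \<and> n \<in> carrier M \<and> m = foldr (\<otimes>\<^bsub>R\<^esub>) ss \<one>\<^bsub>R\<^esub> \<odot>\<^bsub>M\<^esub> n}"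

definition atomic_factorizations ::
    "('a, 'c) ring_scheme \<Rightarrow> ('a, 'b, 'd) module_scheme \<Rightarrow> 'a set \<Rightarrow> 'b \<Rightarrow> ('a list \<times> 'b) set" where
  "atomic_factorizations R M S m =
     {(ss, n) \<in> factorizations R M S m. (\<forall>s \<in> set ss. rirreducible R s) \<and> mprimitive R M S n}"

definition fact_iso ::
    "('a, 'c) ring_scheme \<Rightarrow> ('a, 'b, 'd) module_scheme \<Rightarrow> 'a set \<Rightarrow>
       (('a list \<times> 'b) \<times> ('a list \<times> 'b)) set" where
  "fact_iso R M S =
     {((ss, n), (ts, n')). length ss = length ts \<and> msim R M S n n' \<and>
        (\<exists>\<sigma>. \<sigma> permutes {..<length ss} \<and> (\<forall>i < length ss. rsim R (ss ! i) (ts ! \<sigma> i)))}"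

text \<open>
  The predicates below impose the defining condition of each property on the elements of a
  set \<open>E\<close>.
\<close>

definition atomic_on ::
    "('a, 'c) ring_scheme \<Rightarrow> ('a, 'b, 'd) module_scheme \<Rightarrow> 'a set \<Rightarrow> 'b set \<Rightarrow> bool" where
  "atomic_on R M S E \<longleftrightarrow> (\<forall>m \<in> E. atomic_factorizations R M S m \<noteq> {})"

definition unique_fact_on ::
    "('a, 'c) ring_scheme \<Rightarrow> ('a, 'b, 'd) module_scheme \<Rightarrow> 'a set \<Rightarrow> 'b set \<Rightarrow> bool" where
  "unique_fact_on R M S E \<longleftrightarrow> atomic_on R M S E \<and>
     (\<forall>m \<in> E. \<forall>f \<in> atomic_factorizations R M S m. \<forall>g \<in> atomic_factorizations R M S m.
        (f, g) \<in> fact_iso R M S)"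

definition finite_fact_on ::
    "('a, 'c) ring_scheme \<Rightarrow> ('a, 'b, 'd) module_scheme \<Rightarrow> 'a set \<Rightarrow> 'b set \<Rightarrow> bool" where
  "finite_fact_on R M S E \<longleftrightarrow> atomic_on R M S E \<and>
     (\<forall>m \<in> E. finite (atomic_factorizations R M S m //
        Restr (fact_iso R M S) (atomic_factorizations R M S m)))"

definition half_factorial_on ::
    "('a, 'c) ring_scheme \<Rightarrow> ('a, 'b, 'd) module_scheme \<Rightarrow> 'a set \<Rightarrow> 'b set \<Rightarrow> bool" where
  "half_factorial_on R M S E \<longleftrightarrow> atomic_on R M S E \<and>
     (\<forall>m \<in> E. \<forall>(ss, n) \<in> atomic_factorizations R M S m.
        \<forall>(ts, n') \<in> atomic_factorizations R M S m. length ss = length ts)"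

definition bounded_fact_on ::
    "('a, 'c) ring_scheme \<Rightarrow> ('a, 'b, 'd) module_scheme \<Rightarrow> 'a set \<Rightarrow> 'b set \<Rightarrow> bool" where
  "bounded_fact_on R M S E \<longleftrightarrow>
     (\<forall>m \<in> E. \<exists>N :: nat. \<forall>(ss, n) \<in> factorizations R M S m. length ss \<le> N)"

definition presimplifiable_on ::
    "('a, 'c) ring_scheme \<Rightarrow> ('a, 'b, 'd) module_scheme \<Rightarrow> 'a set \<Rightarrow> 'b set \<Rightarrow> bool" where
  "presimplifiable_on R M S E \<longleftrightarrow>
     (\<forall>s \<in> S. \<forall>m \<in> E. s \<odot>\<^bsub>M\<^esub> m = m \<longrightarrow> s \<in> Units R \<or> m = \<zero>\<^bsub>M\<^esub>)"

datatype fact_property =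
  Unique_Fact | Finite_Fact | Half_Factorial | Bounded_Fact | Presimplifiable | Atomic

fun property_on ::
    "fact_property \<Rightarrow> ('a, 'c) ring_scheme \<Rightarrow> ('a, 'b, 'd) module_scheme \<Rightarrow> 'a set \<Rightarrow> 'b set \<Rightarrow> bool"
  where
    "property_on Unique_Fact = unique_fact_on"
  | "property_on Finite_Fact = finite_fact_on"
  | "property_on Half_Factorial = half_factorial_on"
  | "property_on Bounded_Fact = bounded_fact_on"
  | "property_on Presimplifiable = presimplifiable_on"
  | "property_on Atomic = atomic_on"

text \<open>
  \<open>has_property P R M S\<close>: the \<open>R\<close>-module \<open>M\<close> has \<open>P\<close> with respect to \<open>S\<close>.
  \<open>ring_has_property_in P R E\<close>: the ring \<open>R\<close> has \<open>P\<close> in \<open>E\<close>, where the condition is imposed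
  on the nonzero nonunits of \<open>E\<close>, except that presimplifiability is imposed on all of \<open>E\<close>.
\<close>

definition has_property ::
    "fact_property \<Rightarrow> ('a, 'c) ring_scheme \<Rightarrow> ('a, 'b, 'd) module_scheme \<Rightarrow> 'a set \<Rightarrow> bool" where
  "has_property P R M S \<longleftrightarrow> property_on P R M S (carrier M - {\<zero>\<^bsub>M\<^esub>})"

definition ring_has_property_in ::
    "fact_property \<Rightarrow> ('a, 'c) ring_scheme \<Rightarrow> 'a set \<Rightarrow> bool" where
  "ring_has_property_in P R E \<longleftrightarrow>
     property_on P R (regular_module R) (carrier R)
       (if P = Presimplifiable then E else E - {\<zero>\<^bsub>R\<^esub>} - Units R)"


section \<open>Splitting\<close>

definition compact_factorizations ::
    "('a, 'c) ring_scheme \<Rightarrow> ('a, 'b, 'd) module_scheme \<Rightarrow> 'a set \<Rightarrow> 'b \<Rightarrow> ('a \<times> 'b) set" where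
  "compact_factorizations R M S m = {(s, n). s \<in> S \<and> mprimitive R M S n \<and> m = s \<odot>\<^bsub>M\<^esub> n}"

definition compactly_atomic ::
    "('a, 'c) ring_scheme \<Rightarrow> ('a, 'b, 'd) module_scheme \<Rightarrow> 'a set \<Rightarrow> 'b set \<Rightarrow> bool" where
  "compactly_atomic R M S E \<longleftrightarrow>
     (\<forall>m \<in> E - {\<zero>\<^bsub>M\<^esub>}. compact_factorizations R M S m \<noteq> {})"

definition semi_factorable ::
    "('a, 'c) ring_scheme \<Rightarrow> ('a, 'b, 'd) module_scheme \<Rightarrow> 'a set \<Rightarrow> 'b set \<Rightarrow> bool" where
  "semi_factorable R M S E \<longleftrightarrow> compactly_atomic R M S E \<and>
     (\<forall>m \<in> E - {\<zero>\<^bsub>M\<^esub>}. \<forall>(s, n) \<in> compact_factorizations R M S m.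
        \<forall>(s', n') \<in> compact_factorizations R M S m. rsim R s s')"

definition splits ::
    "('a, 'c) ring_scheme \<Rightarrow> ('a, 'b, 'd) module_scheme \<Rightarrow> 'a set \<Rightarrow> 'b set \<Rightarrow> bool" where
  "splits R M S E \<longleftrightarrow> semi_factorable R M S E \<and>
     (\<forall>r m. mprimitive R (regular_module R) S r \<longrightarrow> mprimitive R M S m \<longrightarrow>
        r \<odot>\<^bsub>M\<^esub> m \<in> E - {\<zero>\<^bsub>M\<^esub>} \<longrightarrow> mprimitive R M S (r \<odot>\<^bsub>M\<^esub> m))"

end

theory Submission
  imports Defs
begin

text \<open>
  Since \<open>S\<close> splits \<open>M\<close>, every nonzero element of \<open>M\<close> is a product \<open>s x\<close> with \<open>s \<in> S\<close> and \<open>x\<close>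
  \<open>S\<close>-primitive, unique up to units. In an \<open>S'\<close>-atomic factorization of \<open>s x\<close> the irreducible
  factors in \<open>S\<close> multiply to \<open>s\<close> up to a unit, and the remaining ones are \<open>S\<close>-primitive, so that
  together with the last entry they factor \<open>x\<close>. Hence \<open>M\<close> has \<open>P\<close> with respect to \<open>S'\<close> iff \<open>R\<close> has
  \<open>P\<close> in \<open>S\<close> and the \<open>S'\<close>-factorizations of \<open>S\<close>-primitive elements have \<open>P\<close>. The latter correspond,
  after clearing denominators, to the \<open>T\<close>-factorizations in \<open>M\<^sub>S\<close>. Taking \<open>S' = S\<close> shows that \<open>M\<close>
  has \<open>P\<close> with respect to \<open>S\<close> iff \<open>R\<close> has \<open>P\<close> in \<open>S\<close>. Clearing denominators needs \<open>S' - Ann(M)\<close> to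
  be compactly \<open>S\<close>-atomic; for the first four properties this follows from bounded factorization in
  \<open>S\<close>, by splitting off a maximal number of nonunits of \<open>S\<close>.
\<close>

section \<open>Factorizations under a monoid action\<close>

text \<open>Two obstacles shape the proof. \<open>R\<close> may have zero divisors, so associates
  \<open>a ~ b\<close> need not differ by a unit and equations can rarely be cancelled; and the
  splitting hypothesis concerns \<open>M\<close> only, so it says nothing about ring elements that
  kill \<open>M\<close>. Both are met by letting ring elements act on primitive elements of
  \<open>M\<close>: there \<open>Unit_of_act_eq\<close> makes a factor from \<open>S\<close> a unit
  as soon as it can be undone. The condition \<open>acts\<close> records that a ring element does
  not annihilate \<open>M\<close>.

  The argument is multiplicative. It is therefore carried out for a commutative monoid acting on a
  set, which serves \<open>R\<close> on \<open>M\<close>, \<open>R\<close> on itself and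
  \<open>RS\<close> on \<open>MS\<close> alike; the additions of the localizations never have to be
  studied. Isomorphism classes of atomic factorizations are encoded as keys, so that combining a
  factorization in \<open>S\<close> with one of a primitive element becomes addition of multisets.
  Bounded factorization is about arbitrary factorizations, whose single factors may have a part in
  \<open>S\<close> and a part outside; it takes a separate argument.\<close>

locale monoid_action = comm_monoid R for R :: "('a, 'c) ring_scheme" (structure) +
  fixes M :: "('a, 'b, 'd) module_scheme"
  assumes act_closed [simp, intro]:
      "a \<in> carrier R \<Longrightarrow> m \<in> carrier M \<Longrightarrow> a \<odot>\<^bsub>M\<^esub> m \<in> carrier M"
    and act_mult: "a \<in> carrier R \<Longrightarrow> b \<in> carrier R \<Longrightarrow> m \<in> carrier M \<Longrightarrow>
      (a \<otimes> b) \<odot>\<^bsub>M\<^esub> m = a \<odot>\<^bsub>M\<^esub> (b \<odot>\<^bsub>M\<^esub> m)"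
    and act_one [simp]: "m \<in> carrier M \<Longrightarrow> \<one> \<odot>\<^bsub>M\<^esub> m = m"

locale factor_action = monoid_action R M
  for R :: "('a, 'c) ring_scheme" (structure) and M :: "('a, 'b, 'd) module_scheme" +
  fixes S :: "'a set"
  assumes submonoid_S: "submonoid S R"
    and Units_subset: "Units R \<subseteq> S"

lemma regular_module_simps [simp]:
  "carrier (regular_module R) = carrier R"
  "x \<odot>\<^bsub>regular_module R\<^esub> y = x \<otimes>\<^bsub>R\<^esub> y"
  "\<zero>\<^bsub>regular_module R\<^esub> = \<zero>\<^bsub>R\<^esub>"
  by (simp_all add: regular_module_def)

abbreviation list_prod :: "('a, 'c) ring_scheme \<Rightarrow> 'a list \<Rightarrow> 'a" where
  "list_prod R ss \<equiv> foldr (\<otimes>\<^bsub>R\<^esub>) ss \<one>\<^bsub>R\<^esub>"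

definition rclass :: "('a, 'c) ring_scheme \<Rightarrow> 'a \<Rightarrow> 'a set" where
  "rclass R a = {b \<in> carrier R. rsim R a b}"

definition mclass ::
    "('a, 'c) ring_scheme \<Rightarrow> ('a, 'b, 'd) module_scheme \<Rightarrow> 'a set \<Rightarrow> 'b \<Rightarrow> 'b set" where
  "mclass R M S m = {n \<in> carrier M. msim R M S m n}"

text \<open>A complete invariant of the isomorphism class of an atomic factorization.\<close>

definition fact_key ::
    "('a, 'c) ring_scheme \<Rightarrow> ('a, 'b, 'd) module_scheme \<Rightarrow> 'a set \<Rightarrow>
       'a list \<times> 'b \<Rightarrow> 'a set multiset \<times> 'b set" where
  "fact_key R M S f = (mset (map (rclass R) (fst f)), mclass R M S (snd f))"

definition fact_keys ::
    "('a, 'c) ring_scheme \<Rightarrow> ('a, 'b, 'd) module_scheme \<Rightarrow> 'a set \<Rightarrow> 'b \<Rightarrow>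
       ('a set multiset \<times> 'b set) set" where
  "fact_keys R M S m = fact_key R M S ` atomic_factorizations R M S m"

text \<open>Bounded factorization and presimplifiability cannot be read off the keys; the default
  \<open>True\<close> lets comparisons of key sets hold for every \<open>P\<close>. In the other
  four cases nonemptiness of the key set is atomicity.\<close>

fun keys_property :: "fact_property \<Rightarrow> ('x multiset \<times> 'y) set \<Rightarrow> bool" where
  "keys_property Unique_Fact K \<longleftrightarrow> (\<exists>k. K = {k})"
| "keys_property Finite_Fact K \<longleftrightarrow> K \<noteq> {} \<and> finite K"
| "keys_property Half_Factorial K \<longleftrightarrow>
     K \<noteq> {} \<and> (\<forall>k \<in> K. \<forall>l \<in> K. size (fst k) = size (fst l))"
| "keys_property Atomic K \<longleftrightarrow> K \<noteq> {}"
| "keys_property _ K \<longleftrightarrow> True"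

abbreviation "keyed_properties \<equiv> {Unique_Fact, Finite_Fact, Half_Factorial, Atomic}"

section \<open>Multisets, kernels of maps and sets of keys\<close>

lemma mset_map_eq_iff_permutes:
  "mset (map f xs) = mset (map g ys) \<longleftrightarrow> length xs = length ys \<and>
     (\<exists>\<sigma>. \<sigma> permutes {..<length xs} \<and> (\<forall>i < length xs. f (xs ! i) = g (ys ! \<sigma> i)))"
proof
  assume eq: "mset (map f xs) = mset (map g ys)"
  then have len: "length xs = length ys"
    by (metis length_map size_mset)
  from mset_eq_permutation[OF eq] obtain p where
    p: "p permutes {..<length (map g ys)}" "permute_list p (map g ys) = map f xs" .
  have "f (xs ! i) = g (ys ! p i)" if "i < length xs" for i
  proof -
    have "p i < length ys"
      using p(1) that len permutes_in_image by fastforce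
    then show ?thesis
      using p permute_list_nth[OF p(1), of i] that len by simp
  qed
  then show "length xs = length ys \<and>
     (\<exists>\<sigma>. \<sigma> permutes {..<length xs} \<and> (\<forall>i < length xs. f (xs ! i) = g (ys ! \<sigma> i)))"
    using len p(1) by auto
next
  assume "length xs = length ys \<and>
     (\<exists>\<sigma>. \<sigma> permutes {..<length xs} \<and> (\<forall>i < length xs. f (xs ! i) = g (ys ! \<sigma> i)))"
  then obtain \<sigma> where len: "length xs = length ys" and s: "\<sigma> permutes {..<length xs}"
    and eq: "\<forall>i < length xs. f (xs ! i) = g (ys ! \<sigma> i)" by blast
  have s': "\<sigma> permutes {..<length (map g ys)}"
    using s len by simp
  have "map f xs = permute_list \<sigma> (map g ys)"
  proof (rule nth_equalityI)
    fix i assume i: "i < length (map f xs)"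
    then have "\<sigma> i < length ys"
      using s len permutes_in_image by fastforce
    then show "map f xs ! i = permute_list \<sigma> (map g ys) ! i"
      using i eq len permute_list_nth[OF s', of i] by simp
  qed (use len in simp)
  then show "mset (map f xs) = mset (map g ys)"
    using mset_permute_list[OF s'] by simp
qed

text \<open>If \<open>f\<close> and \<open>g\<close> identify the same pairs, each factors through
  the other on \<open>D\<close>. This serves to compare associate classes in \<open>R\<close> with
  those in the localization, which have different types.\<close>

lemma image_mset_eq_iff_of_kernel_eq:
  assumes "\<And>x y. x \<in> D \<Longrightarrow> y \<in> D \<Longrightarrow> f x = f y \<longleftrightarrow> g x = g y"
    and "set_mset A \<subseteq> D" "set_mset B \<subseteq> D"
  shows "image_mset f A = image_mset f B \<longleftrightarrow> image_mset g A = image_mset g B"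
proof -
  have *: "image_mset q A = image_mset q B"
    if eq: "image_mset p A = image_mset p B"
      and k: "\<And>x y. x \<in> D \<Longrightarrow> y \<in> D \<Longrightarrow> p x = p y \<Longrightarrow> q x = q y" for p :: "_ \<Rightarrow> 'x" and q :: "_ \<Rightarrow> 'y"
  proof -
    \<comment> \<open>\<open>h\<close> is \<open>q\<close> after a chosen section of
      \<open>p\<close> on \<open>D\<close>.\<close>
    define h where "h z = q (SOME x. x \<in> D \<and> p x = z)" for z
    have h: "h (p x) = q x" if "x \<in> D" for x
    proof -
      have "(SOME y. y \<in> D \<and> p y = p x) \<in> D \<and> p (SOME y. y \<in> D \<and> p y = p x) = p x"
        by (rule someI[of _ x]) (use that in simp)
      then show ?thesis
        unfolding h_def using k that by blast
    qed
    have "image_mset h (image_mset p C) = image_mset q C" if "set_mset C \<subseteq> D" for C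
      unfolding multiset.map_comp using that h by (intro image_mset_cong) auto
    then show ?thesis
      using eq assms(2,3) by metis
  qed
  show ?thesis
    using *[of f g] *[of g f] assms(1) by blast
qed

text \<open>The classes are the fibres of \<open>k\<close> in \<open>A\<close>, and distinct values
  of \<open>k\<close> have distinct fibres.\<close>

lemma finite_quotient_Restr_iff:
  assumes "\<And>f g. f \<in> A \<Longrightarrow> g \<in> A \<Longrightarrow> (f, g) \<in> r \<longleftrightarrow> k f = k g"
  shows "finite (A // Restr r A) \<longleftrightarrow> finite (k ` A)"
proof -
  define h where "h v = {g \<in> A. v = k g}" for v
  have "A // Restr r A = h ` k ` A"
    unfolding quotient_def h_def using assms by (auto simp: image_def Image_def)
  moreover have "inj_on h (k ` A)"
    unfolding h_def inj_on_def by blast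
  ultimately show ?thesis
    by (simp add: finite_image_iff)
qed

lemma ex_image_eq_singleton_iff:
  "(\<exists>v. p ` A = {v}) \<longleftrightarrow> A \<noteq> {} \<and> (\<forall>x \<in> A. \<forall>y \<in> A. p x = p y)"
  (is "?L \<longleftrightarrow> ?R")
proof
  assume ?L
  then obtain v where v: "p ` A = {v}" by blast
  then have "p x = v" if "x \<in> A" for x
    using that by blast
  then show ?R
    using v by blast
next
  assume ?R
  then obtain a where "a \<in> A" "\<forall>x \<in> A. p x = p a" by blast
  then have "p ` A = {p a}" by blast
  then show ?L ..
qed

text \<open>Each property depends only on how the keys partition \<open>A\<close> and on the
  lengths. It can therefore be carried over between key maps with values in different types.\<close>

lemma keys_property_image_cong:
  assumes eq: "\<And>x y. x \<in> A \<Longrightarrow> y \<in> A \<Longrightarrow> k x = k y \<longleftrightarrow> l x = l y"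
    and size: "\<And>x. x \<in> A \<Longrightarrow> size (fst (k x)) = size (fst (l x))"
  shows "keys_property P (k ` A) \<longleftrightarrow> keys_property P (l ` A)"
proof -
  have fin: "finite (q ` A)" if "finite (p ` A)" "\<And>x y. x \<in> A \<Longrightarrow> y \<in> A \<Longrightarrow> p x = p y \<Longrightarrow> q x = q y"
    for p :: "_ \<Rightarrow> 'x" and q :: "_ \<Rightarrow> 'y"
  proof -
    \<comment> \<open>\<open>q\<close> factors through \<open>p\<close> on \<open>A\<close>, by
      choosing a preimage of each value.\<close>
    have "q ` A \<subseteq> (\<lambda>v. q (SOME x. x \<in> A \<and> p x = v)) ` p ` A"
    proof
      fix z assume "z \<in> q ` A"
      then obtain x where x: "x \<in> A" "z = q x" by blast
      have "(SOME y. y \<in> A \<and> p y = p x) \<in> A \<and> p (SOME y. y \<in> A \<and> p y = p x) = p x"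
        by (rule someI[of _ x]) (use x in simp)
      then have "z = q (SOME y. y \<in> A \<and> p y = p x)"
        using x that(2) by metis
      then show "z \<in> (\<lambda>v. q (SOME x. x \<in> A \<and> p x = v)) ` p ` A"
        using x by blast
    qed
    then show ?thesis
      using that(1) finite_surj by blast
  qed
  show ?thesis
  proof (cases P)
    case Unique_Fact
    then show ?thesis using eq by (simp add: ex_image_eq_singleton_iff del: split_paired_Ex)
  next
    case Finite_Fact
    have "finite (k ` A) \<longleftrightarrow> finite (l ` A)"
      using fin[of k l] fin[of l k] eq by blast
    then show ?thesis using Finite_Fact by simp
  next
    case Half_Factorial
    then show ?thesis by (simp add: size)
  qed auto
qed

text \<open>
  The keys of a product of an element of \<open>S\<close> and an element without \<open>S\<close>-part are the sums of
  the keys of the two factors; \<open>Q\<close> tells the two kinds of classes apart.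
\<close>

lemma keys_property_join:
  fixes K1 :: "('x multiset \<times> 'z) set" and K2 :: "('x multiset \<times> 'y) set"
  assumes K1: "\<And>A c. (A, c) \<in> K1 \<Longrightarrow> c = c0 \<and> (\<forall>D \<in># A. Q D)"
    and K2: "\<And>B d. (B, d) \<in> K2 \<Longrightarrow> \<forall>D \<in># B. \<not> Q D"
    and K: "K = {(A + B, d) | A B c d. (A, c) \<in> K1 \<and> (B, d) \<in> K2}"
    and P: "P \<in> keyed_properties"
  shows "keys_property P K \<longleftrightarrow> keys_property P K1 \<and> keys_property P K2"
proof -
  \<comment> \<open>\<open>j'\<close> inverts the sum of keys: filtering by \<open>Q\<close>
    recovers the two multisets, and the class component of the first key is the constant
    \<open>c0\<close>.\<close>
  define j' where "j' k = ((filter_mset Q (fst k), c0), (filter_mset (\<lambda>D. \<not> Q D) (fst k), snd k))"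
    for k :: "'x multiset \<times> 'y"
  have Kj: "K = (\<lambda>(k, l). (fst k + fst l, snd l)) ` (K1 \<times> K2)"
    unfolding K by (force simp: image_def)
  have sep: "filter_mset Q (A + B) = A" "filter_mset (\<lambda>D. \<not> Q D) (A + B) = B"
    if "(A, c) \<in> K1" "(B, d) \<in> K2" for A B c d
  proof -
    have "filter_mset Q A = A" "filter_mset Q B = {#}"
      "filter_mset (\<lambda>D. \<not> Q D) A = {#}" "filter_mset (\<lambda>D. \<not> Q D) B = B"
      using K1[OF that(1)] K2[OF that(2)]
      by (auto simp: filter_mset_eq_conv intro!: multiset_eqI)
    then show "filter_mset Q (A + B) = A" "filter_mset (\<lambda>D. \<not> Q D) (A + B) = B"
      by simp_all
  qed
  have jj: "j' ((\<lambda>(k, l). (fst k + fst l, snd l)) kl) = kl" if "kl \<in> K1 \<times> K2" for kl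
    using that sep K1 by (fastforce simp: j'_def)
  then have inj: "inj_on (\<lambda>(k, l). (fst k + fst l, snd l)) (K1 \<times> K2)"
    by (metis (no_types, lifting) inj_onI)
  have emp: "K = {} \<longleftrightarrow> K1 = {} \<or> K2 = {}"
    unfolding Kj by auto
  show ?thesis
  proof (cases P)
    case Unique_Fact
    \<comment> \<open>A singleton is a set of cardinality one; cardinality is preserved by the
      injective sum and multiplicative on \<open>K1 \<times> K2\<close>.\<close>
    have "(\<exists>k. K = {k}) \<longleftrightarrow> is_singleton (K1 \<times> K2)"
      unfolding Kj is_singleton_def[symmetric] is_singleton_altdef
      using card_image[OF inj] by simp
    also have "\<dots> \<longleftrightarrow> is_singleton K1 \<and> is_singleton K2"
      by (simp add: is_singleton_altdef card_cartesian_product)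
    finally show ?thesis
      using Unique_Fact by (simp add: is_singleton_def)
  next
    case Finite_Fact
    then show ?thesis
      using emp finite_image_iff[OF inj] by (auto simp: Kj finite_cartesian_product_iff)
  next
    case Half_Factorial
    have "(\<forall>k \<in> K. \<forall>l \<in> K. size (fst k) = size (fst l)) \<longleftrightarrow>
        (\<forall>k \<in> K1. \<forall>l \<in> K1. size (fst k) = size (fst l)) \<and>
        (\<forall>k \<in> K2. \<forall>l \<in> K2. size (fst k) = size (fst l))" if ne: "K1 \<noteq> {}" "K2 \<noteq> {}"
    proof -
      \<comment> \<open>With one summand held fixed, its size cancels and the sizes in the other
        factor are compared.\<close>
      obtain k0 l0 where k0: "k0 \<in> K1" and l0: "l0 \<in> K2" using ne by fast
      have *: "(\<forall>k \<in> K. \<forall>l \<in> K. size (fst k) = size (fst l)) \<longleftrightarrow>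
        (\<forall>k \<in> K1. \<forall>l \<in> K2. \<forall>k' \<in> K1. \<forall>l' \<in> K2.
           size (fst k) + size (fst l) = size (fst k') + size (fst l'))"
        unfolding Kj by (simp add: split_beta del: split_paired_All)
      show ?thesis
      proof
        assume "\<forall>k \<in> K. \<forall>l \<in> K. size (fst k) = size (fst l)"
        then have eq: "size (fst k) + size (fst l) = size (fst k') + size (fst l')"
          if "k \<in> K1" "l \<in> K2" "k' \<in> K1" "l' \<in> K2" for k l k' l'
          using * that by blast
        show "(\<forall>k \<in> K1. \<forall>l \<in> K1. size (fst k) = size (fst l)) \<and>
            (\<forall>k \<in> K2. \<forall>l \<in> K2. size (fst k) = size (fst l))"
        proof (intro conjI ballI)
          show "size (fst k) = size (fst l)" if "k \<in> K1" "l \<in> K1" for k l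
            using eq[OF that(1) l0 that(2) l0] by linarith
          show "size (fst k) = size (fst l)" if "k \<in> K2" "l \<in> K2" for k l
            using eq[OF k0 that(1) k0 that(2)] by linarith
        qed
      next
        assume eq: "(\<forall>k \<in> K1. \<forall>l \<in> K1. size (fst k) = size (fst l)) \<and>
            (\<forall>k \<in> K2. \<forall>l \<in> K2. size (fst k) = size (fst l))"
        have "size (fst k) + size (fst l) = size (fst k') + size (fst l')"
          if "k \<in> K1" "l \<in> K2" "k' \<in> K1" "l' \<in> K2" for k l k' l'
          using eq that by metis
        then show "\<forall>k \<in> K. \<forall>l \<in> K. size (fst k) = size (fst l)"
          using * by blast
      qed
    qed
    then show ?thesis
      unfolding Half_Factorial keys_property.simps using emp by blast
  qed (use P emp in simp_all)
qed

section \<open>Products of lists and their action\<close>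

context monoid_action
begin

lemma list_prod_closed [simp, intro]: "set ss \<subseteq> carrier R \<Longrightarrow> list_prod R ss \<in> carrier R"
  by (induction ss) auto

lemma list_prod_append:
  "set ss \<subseteq> carrier R \<Longrightarrow> set ts \<subseteq> carrier R \<Longrightarrow>
     list_prod R (ss @ ts) = list_prod R ss \<otimes> list_prod R ts"
  by (induction ss) (auto simp: m_assoc)

lemma list_prod_filter:
  "set ss \<subseteq> carrier R \<Longrightarrow>
     list_prod R ss = list_prod R (filter P ss) \<otimes> list_prod R (filter (\<lambda>s. \<not> P s) ss)"
proof (induction ss)
  case (Cons a ss)
  have "set (filter P ss) \<subseteq> carrier R" "set (filter (\<lambda>s. \<not> P s) ss) \<subseteq> carrier R"
    using Cons.prems by auto
  then have "list_prod R (filter P ss) \<in> carrier R" "list_prod R (filter (\<lambda>s. \<not> P s) ss) \<in> carrier R"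
    by (auto intro!: list_prod_closed)
  then show ?case
    using Cons by (auto simp: m_assoc m_lcomm)
qed simp

lemma list_prod_mem_factor:
  assumes "set ss \<subseteq> carrier R" "s \<in> set ss"
  obtains q where "q \<in> carrier R" "list_prod R ss = s \<otimes> q"
proof -
  have "\<exists>q \<in> carrier R. list_prod R ss = s \<otimes> q"
    using assms
  proof (induction ss)
    case (Cons a ss)
    show ?case
    proof (cases "s = a")
      case False
      then obtain q where "q \<in> carrier R" "list_prod R ss = s \<otimes> q"
        using Cons by auto
      then show ?thesis
        using Cons.prems by (intro bexI[of _ "a \<otimes> q"]) (auto simp: m_lcomm)
    qed (use Cons.prems in auto)
  qed simp
  then show ?thesis
    using that by blast
qed

lemma act_left_commute:
  "a \<in> carrier R \<Longrightarrow> b \<in> carrier R \<Longrightarrow> m \<in> carrier M \<Longrightarrow>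
     a \<odot>\<^bsub>M\<^esub> (b \<odot>\<^bsub>M\<^esub> m) = b \<odot>\<^bsub>M\<^esub> (a \<odot>\<^bsub>M\<^esub> m)"
  by (metis act_mult m_comm)

lemma act_inv_cancel [simp]:
  assumes "u \<in> Units R" "m \<in> carrier M"
  shows "inv u \<odot>\<^bsub>M\<^esub> (u \<odot>\<^bsub>M\<^esub> m) = m" "u \<odot>\<^bsub>M\<^esub> (inv u \<odot>\<^bsub>M\<^esub> m) = m"
  using assms by (simp_all add: act_mult[symmetric] Units_closed)

text \<open>Makes every lemma about \<open>msim\<close> and \<open>M\<close> available for
  \<open>rsim\<close> and for factorizations in the ring itself.\<close>

lemma regular_factor_action: "factor_action R (regular_module R) (carrier R)"
  by unfold_locales (auto simp: m_assoc m_lcomm m_comm Units_closed)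

lemma rsim_unit:
  assumes "u \<in> Units R" "a \<in> carrier R"
  shows "rsim R a (u \<otimes> a)"
  unfolding rsim_def msim_def using assms
  by (intro bexI[of _ "inv u"] bexI[of _ u]) (auto simp: m_assoc[symmetric] Units_closed)

end

section \<open>Associates, keys of factorizations and the effect of units\<close>

context factor_action
begin

lemma S_carrier [simp, intro]: "s \<in> S \<Longrightarrow> s \<in> carrier R"
  using submonoid_S submonoid.subset by blast

lemma S_one [simp]: "\<one> \<in> S"
  by (rule submonoid.one_closed[OF submonoid_S])

lemma S_mult [simp]: "s \<in> S \<Longrightarrow> t \<in> S \<Longrightarrow> s \<otimes> t \<in> S"
  by (rule submonoid.m_closed[OF submonoid_S])

lemma S_Units [simp]: "u \<in> Units R \<Longrightarrow> u \<in> S"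
  using Units_subset by blast

lemma list_prod_S: "set ss \<subseteq> S \<Longrightarrow> list_prod R ss \<in> S"
  by (induction ss) auto

lemma msim_refl: "m \<in> carrier M \<Longrightarrow> msim R M S m m"
  unfolding msim_def by (intro bexI[of _ \<one>]) auto

lemma msim_sym: "msim R M S m n \<Longrightarrow> msim R M S n m"
  unfolding msim_def by blast

lemma msim_trans:
  assumes "msim R M S m n" "msim R M S n k" "m \<in> carrier M" "k \<in> carrier M"
  shows "msim R M S m k"
proof -
  obtain s s' t t' where "s \<in> S" "s' \<in> S" "t \<in> S" "t' \<in> S"
    "m = s \<odot>\<^bsub>M\<^esub> n" "n = s' \<odot>\<^bsub>M\<^esub> m" "n = t \<odot>\<^bsub>M\<^esub> k" "k = t' \<odot>\<^bsub>M\<^esub> n"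
    using assms unfolding msim_def by blast
  moreover from this have "m = (s \<otimes> t) \<odot>\<^bsub>M\<^esub> k" "k = (t' \<otimes> s') \<odot>\<^bsub>M\<^esub> m"
    using assms(3,4) by (metis act_mult S_carrier)+
  ultimately show ?thesis
    unfolding msim_def by (meson S_mult)
qed

lemma msim_unit: "u \<in> Units R \<Longrightarrow> m \<in> carrier M \<Longrightarrow> msim R M S (u \<odot>\<^bsub>M\<^esub> m) m"
  unfolding msim_def by (intro bexI[of _ u] bexI[of _ "inv u"]) auto

lemma mclass_eq_iff:
  assumes "m \<in> carrier M" "n \<in> carrier M"
  shows "mclass R M S m = mclass R M S n \<longleftrightarrow> msim R M S m n"
proof
  assume "mclass R M S m = mclass R M S n"
  moreover have "n \<in> mclass R M S n"
    using assms msim_refl by (simp add: mclass_def)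
  ultimately show "msim R M S m n"
    by (auto simp: mclass_def)
next
  assume "msim R M S m n"
  then show "mclass R M S m = mclass R M S n"
    unfolding mclass_def using assms msim_trans msim_sym by blast
qed

lemma rsim_refl: "a \<in> carrier R \<Longrightarrow> rsim R a a"
  and rsim_sym: "rsim R a b \<Longrightarrow> rsim R b a"
  and rsim_trans: "rsim R a b \<Longrightarrow> rsim R b c \<Longrightarrow> a \<in> carrier R \<Longrightarrow> c \<in> carrier R \<Longrightarrow> rsim R a c"
  using factor_action.msim_refl[OF regular_factor_action]
    factor_action.msim_sym[OF regular_factor_action]
    factor_action.msim_trans[OF regular_factor_action]
  unfolding rsim_def regular_module_simps by blast+

lemma rclass_eq_iff:
  assumes "a \<in> carrier R" "b \<in> carrier R"
  shows "rclass R a = rclass R b \<longleftrightarrow> rsim R a b"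
  using factor_action.mclass_eq_iff[OF regular_factor_action] assms
  unfolding rclass_def mclass_def rsim_def by simp

lemma fact_iso_iff_key:
  assumes "set ss \<subseteq> carrier R" "set ts \<subseteq> carrier R" "n \<in> carrier M" "n' \<in> carrier M"
  shows "((ss, n), (ts, n')) \<in> fact_iso R M S \<longleftrightarrow>
    fact_key R M S (ss, n) = fact_key R M S (ts, n')"
proof -
  have "rclass R (ss ! i) = rclass R (ts ! \<sigma> i) \<longleftrightarrow> rsim R (ss ! i) (ts ! \<sigma> i)"
    if "length ss = length ts" "\<sigma> permutes {..<length ss}" "i < length ss" for \<sigma> i
  proof (rule rclass_eq_iff)
    have "\<sigma> i < length ts"
      using that permutes_in_image by fastforce
    then show "ts ! \<sigma> i \<in> carrier R" "ss ! i \<in> carrier R"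
      using assms that(3) nth_mem by blast+
  qed
  then show ?thesis
    unfolding fact_iso_def fact_key_def fst_conv snd_conv prod.inject mset_map_eq_iff_permutes
      mclass_eq_iff[OF assms(3,4)]
    by (auto cong: conj_cong)
qed

lemma factorizationsD:
  assumes "(ss, n) \<in> factorizations R M S m"
  shows "set ss \<subseteq> S" "set ss \<subseteq> carrier R" "set ss \<inter> Units R = {}" "n \<in> carrier M"
    "m = list_prod R ss \<odot>\<^bsub>M\<^esub> n"
  using assms unfolding factorizations_def by auto

lemma atomic_factorizationsD:
  assumes "(ss, n) \<in> atomic_factorizations R M S m"
  shows "(ss, n) \<in> factorizations R M S m" "\<And>s. s \<in> set ss \<Longrightarrow> rirreducible R s"
    "mprimitive R M S n"
  using assms unfolding atomic_factorizations_def by auto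

text \<open>After this, permutations and quotients no longer occur: the four keyed properties are
  conditions on a set of keys.\<close>

lemma property_on_iff_keys:
  assumes "P \<in> keyed_properties"
  shows "property_on P R M S E \<longleftrightarrow> (\<forall>m \<in> E. keys_property P (fact_keys R M S m))"
proof -
  have iso: "(f, g) \<in> fact_iso R M S \<longleftrightarrow> fact_key R M S f = fact_key R M S g"
    if "f \<in> atomic_factorizations R M S m" "g \<in> atomic_factorizations R M S m" for f g m
  proof -
    obtain ss n ts n' where fg: "f = (ss, n)" "g = (ts, n')"
      by fastforce
    have "(ss, n) \<in> factorizations R M S m" "(ts, n') \<in> factorizations R M S m"
      using that unfolding fg by (blast dest: atomic_factorizationsD(1))+
    then show ?thesis
      unfolding fg using fact_iso_iff_key factorizationsD(2,4) by blast
  qed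
  have size: "size (fst (fact_key R M S f)) = length (fst f)" for f
    by (simp add: fact_key_def)
  consider (u) "P = Unique_Fact" | (f) "P = Finite_Fact" | (h) "P = Half_Factorial" | (a) "P = Atomic"
    using assms by blast
  then show ?thesis
  proof cases
    case u
    have "(\<forall>f \<in> atomic_factorizations R M S m. \<forall>g \<in> atomic_factorizations R M S m.
            (f, g) \<in> fact_iso R M S) \<longleftrightarrow>
          (\<forall>f \<in> atomic_factorizations R M S m. \<forall>g \<in> atomic_factorizations R M S m.
            fact_key R M S f = fact_key R M S g)" for m
      using iso by blast
    then show ?thesis
      unfolding u property_on.simps keys_property.simps unique_fact_on_def
        atomic_on_def fact_keys_def ex_image_eq_singleton_iff by blast
  next
    case f
    have "finite (atomic_factorizations R M S m //
        Restr (fact_iso R M S) (atomic_factorizations R M S m)) \<longleftrightarrow>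
      finite (fact_key R M S ` atomic_factorizations R M S m)" for m
      using iso by (rule finite_quotient_Restr_iff)
    then show ?thesis
      unfolding f property_on.simps keys_property.simps finite_fact_on_def
        atomic_on_def fact_keys_def by auto
  next
    case h
    then show ?thesis
      unfolding h property_on.simps keys_property.simps half_factorial_on_def
        atomic_on_def fact_keys_def ball_simps size image_is_empty split_beta by blast
  next
    case a
    then show ?thesis
      unfolding a property_on.simps keys_property.simps atomic_on_def fact_keys_def by simp
  qed
qed

lemma mprimitive_closed: "mprimitive R M S m \<Longrightarrow> m \<in> carrier M"
  by (simp add: mprimitive_def)

lemma mprimitive_unit:
  assumes "u \<in> Units R" "mprimitive R M S m"
  shows "mprimitive R M S (u \<odot>\<^bsub>M\<^esub> m)"
  unfolding mprimitive_def
proof (intro conjI ballI impI)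
  have m: "m \<in> carrier M" "u \<in> carrier R" "inv u \<in> Units R"
    using assms by (auto simp: mprimitive_def)
  then show "u \<odot>\<^bsub>M\<^esub> m \<in> carrier M" by simp
  fix s n assume s: "s \<in> S" "n \<in> carrier M" and eq: "u \<odot>\<^bsub>M\<^esub> m = s \<odot>\<^bsub>M\<^esub> n"
  have "m = inv u \<odot>\<^bsub>M\<^esub> (u \<odot>\<^bsub>M\<^esub> m)"
    using assms(1) m(1) by simp
  also have "\<dots> = s \<odot>\<^bsub>M\<^esub> (inv u \<odot>\<^bsub>M\<^esub> n)"
    using s m unfolding eq by (simp add: act_left_commute Units_closed)
  finally have "msim R M S (inv u \<odot>\<^bsub>M\<^esub> n) m"
    using assms(2) s m Units_closed unfolding mprimitive_def by blast
  moreover have "msim R M S n (inv u \<odot>\<^bsub>M\<^esub> n)"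
    using msim_unit[OF m(3) s(2)] by (rule msim_sym)
  moreover have "msim R M S m (u \<odot>\<^bsub>M\<^esub> m)"
    using msim_unit[OF assms(1) m(1)] by (rule msim_sym)
  ultimately show "msim R M S n (u \<odot>\<^bsub>M\<^esub> m)"
    using m s by (meson msim_trans act_closed)
qed

lemma rirreducible_unit:
  assumes u: "u \<in> Units R" and a: "rirreducible R a"
  shows "rirreducible R (u \<otimes> a)"
  unfolding rirreducible_def
proof (intro conjI ballI impI)
  have ac: "a \<in> carrier R" "a \<notin> Units R" and uc: "u \<in> carrier R" "inv u \<in> carrier R"
    using a u by (auto simp: rirreducible_def Units_closed)
  have cancel: "inv u \<otimes> (u \<otimes> x) = x" if "x \<in> carrier R" for x
    using that u uc by (simp add: m_assoc[symmetric])
  have "u \<otimes> a \<notin> Units R"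
  proof
    assume "u \<otimes> a \<in> Units R"
    then have "inv u \<otimes> (u \<otimes> a) \<in> Units R"
      using u by blast
    then show False
      using ac cancel by simp
  qed
  then show "u \<otimes> a \<in> carrier R - Units R"
    using ac uc by simp
  fix b c assume b: "b \<in> carrier R" "c \<in> carrier R" and eq: "u \<otimes> a = b \<otimes> c"
  have "a = (inv u \<otimes> b) \<otimes> c"
    using b uc ac eq cancel[of a] by (simp add: m_assoc)
  then have "rsim R a (inv u \<otimes> b) \<or> rsim R a c"
    using a b uc unfolding rirreducible_def by blast
  moreover have "rsim R (inv u \<otimes> b) b"
    using rsim_unit[of "inv u" b] u b rsim_sym by simp
  moreover have "rsim R (u \<otimes> a) a"
    using rsim_unit[OF u ac(1)] rsim_sym by simp
  ultimately show "rsim R (u \<otimes> a) b \<or> rsim R (u \<otimes> a) c"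
    using b ac uc by (meson rsim_trans m_closed)
qed

lemma factorizations_unit:
  assumes "u \<in> Units R" "(ss, n) \<in> factorizations R M S m"
  shows "(ss, u \<odot>\<^bsub>M\<^esub> n) \<in> factorizations R M S (u \<odot>\<^bsub>M\<^esub> m)"
proof -
  have "u \<in> carrier R"
    using assms(1) by (rule Units_closed)
  moreover note f = factorizationsD[OF assms(2)]
  ultimately have "u \<odot>\<^bsub>M\<^esub> m = list_prod R ss \<odot>\<^bsub>M\<^esub> (u \<odot>\<^bsub>M\<^esub> n)"
    by (metis act_left_commute list_prod_closed)
  then show ?thesis
    using f \<open>u \<in> carrier R\<close> unfolding factorizations_def by blast
qed

lemma atomic_factorizations_unit:
  assumes "u \<in> Units R" "(ss, n) \<in> atomic_factorizations R M S m"
  shows "(ss, u \<odot>\<^bsub>M\<^esub> n) \<in> atomic_factorizations R M S (u \<odot>\<^bsub>M\<^esub> m)"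
  using assms factorizations_unit mprimitive_unit unfolding atomic_factorizations_def by blast

lemma mclass_unit:
  "u \<in> Units R \<Longrightarrow> n \<in> carrier M \<Longrightarrow> mclass R M S (u \<odot>\<^bsub>M\<^esub> n) = mclass R M S n"
  by (simp add: mclass_eq_iff msim_unit Units_closed)

text \<open>A unit is absorbed by the last entry, whose class it leaves unchanged. The inclusion for
  \<open>inv u\<close> gives the converse of that for \<open>u\<close>.\<close>

lemma fact_keys_unit:
  assumes u: "u \<in> Units R" and m: "m \<in> carrier M"
  shows "fact_keys R M S (u \<odot>\<^bsub>M\<^esub> m) = fact_keys R M S m"
proof -
  have *: "fact_keys R M S m \<subseteq> fact_keys R M S (u \<odot>\<^bsub>M\<^esub> m)" if u: "u \<in> Units R" for u m
  proof
    fix k assume "k \<in> fact_keys R M S m"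
    then obtain ss n where f: "(ss, n) \<in> atomic_factorizations R M S m"
      and k: "k = fact_key R M S (ss, n)"
      unfolding fact_keys_def by (metis imageE prod.collapse)
    have "k = fact_key R M S (ss, u \<odot>\<^bsub>M\<^esub> n)"
      using k mclass_unit[OF u] f atomic_factorizationsD(3) mprimitive_closed
      unfolding fact_key_def by simp
    then show "k \<in> fact_keys R M S (u \<odot>\<^bsub>M\<^esub> m)"
      using atomic_factorizations_unit[OF u f] unfolding fact_keys_def by blast
  qed
  have "fact_keys R M S (u \<odot>\<^bsub>M\<^esub> m) \<subseteq> fact_keys R M S (inv u \<odot>\<^bsub>M\<^esub> (u \<odot>\<^bsub>M\<^esub> m))"
    using u by (intro *) simp
  then show ?thesis
    using *[OF u, of m] u m by simp
qed

end

section \<open>Localization\<close>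

text \<open>Without subtraction, the absence of zero divisors in \<open>S\<close> has to be stated
  as cancellation. It removes the auxiliary multiplier \<open>u\<close> from \<open>loc_rel\<close>,
  so that fractions are compared by cross multiplication.\<close>

locale localization = factor_action R M S
  for R :: "('a, 'c) ring_scheme" (structure) and M :: "('a, 'b, 'd) module_scheme" and S +
  assumes cancel_M: "s \<in> S \<Longrightarrow> m \<in> carrier M \<Longrightarrow> n \<in> carrier M \<Longrightarrow>
      s \<odot>\<^bsub>M\<^esub> m = s \<odot>\<^bsub>M\<^esub> n \<Longrightarrow> m = n"
    and cancel_R: "s \<in> S \<Longrightarrow> a \<in> carrier R \<Longrightarrow> b \<in> carrier R \<Longrightarrow> s \<otimes> a = s \<otimes> b \<Longrightarrow> a = b"
    and saturated: "a \<in> carrier R \<Longrightarrow> b \<in> carrier R \<Longrightarrow> a \<otimes> b \<in> S \<Longrightarrow> a \<in> S"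
begin

abbreviation "mfrac \<equiv> loc_frac R M S"
abbreviation "rfrac \<equiv> loc_frac R (regular_module R) S"
abbreviation "RS \<equiv> loc_ring R S"
abbreviation "MS \<equiv> loc_module R M S"

lemma cancel_M_iff:
  "s \<in> S \<Longrightarrow> m \<in> carrier M \<Longrightarrow> n \<in> carrier M \<Longrightarrow> s \<odot>\<^bsub>M\<^esub> m = s \<odot>\<^bsub>M\<^esub> n \<longleftrightarrow> m = n"
  using cancel_M by blast

lemma regular_localization: "localization R (regular_module R) S"
proof -
  interpret reg: factor_action R "regular_module R" "carrier R"
    by (rule regular_factor_action)
  show ?thesis
    by unfold_locales (auto simp: submonoid_S intro: cancel_R saturated)
qed

lemma loc_rel_iff:
  "((m, s), (n, t)) \<in> loc_rel R M S \<longleftrightarrow>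
     m \<in> carrier M \<and> n \<in> carrier M \<and> s \<in> S \<and> t \<in> S \<and> t \<odot>\<^bsub>M\<^esub> m = s \<odot>\<^bsub>M\<^esub> n"
  unfolding loc_rel_def using cancel_M_iff by (auto intro!: bexI[of _ \<one>])

lemma equiv_loc_rel: "equiv (carrier M \<times> S) (loc_rel R M S)"
proof (rule equivI)
  show "loc_rel R M S \<subseteq> (carrier M \<times> S) \<times> (carrier M \<times> S)"
    by (auto simp: loc_rel_iff)
  show "refl_on (carrier M \<times> S) (loc_rel R M S)"
    by (auto simp: refl_on_def loc_rel_iff)
  show "sym (loc_rel R M S)"
    by (auto simp: sym_def loc_rel_iff)
  show "trans (loc_rel R M S)"
  proof (rule transI)
    fix x y z assume xy: "(x, y) \<in> loc_rel R M S" and yz: "(y, z) \<in> loc_rel R M S"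
    obtain m s n t k r where [simp]: "x = (m, s)" "y = (n, t)" "z = (k, r)"
      by (metis prod.exhaust)
    have c: "m \<in> carrier M" "n \<in> carrier M" "k \<in> carrier M" "s \<in> S" "t \<in> S" "r \<in> S"
      and eq: "t \<odot>\<^bsub>M\<^esub> m = s \<odot>\<^bsub>M\<^esub> n" "r \<odot>\<^bsub>M\<^esub> n = t \<odot>\<^bsub>M\<^esub> k"
      using xy yz by (simp_all add: loc_rel_iff)
    \<comment> \<open>The middle denominator \<open>t\<close> is the factor to be cancelled.\<close>
    have "t \<odot>\<^bsub>M\<^esub> (r \<odot>\<^bsub>M\<^esub> m) = t \<odot>\<^bsub>M\<^esub> (s \<odot>\<^bsub>M\<^esub> k)"
      using c eq by (metis act_left_commute S_carrier)
    then have "r \<odot>\<^bsub>M\<^esub> m = s \<odot>\<^bsub>M\<^esub> k"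
      using c cancel_M[of t] by (metis act_closed S_carrier)
    then show "(x, z) \<in> loc_rel R M S"
      using c by (simp add: loc_rel_iff)
  qed
qed

lemma mfrac_eq_iff:
  assumes "m \<in> carrier M" "n \<in> carrier M" "s \<in> S" "t \<in> S"
  shows "mfrac m s = mfrac n t \<longleftrightarrow> t \<odot>\<^bsub>M\<^esub> m = s \<odot>\<^bsub>M\<^esub> n"
  using eq_equiv_class_iff[OF equiv_loc_rel, of "(m, s)" "(n, t)"] assms
  by (simp add: loc_frac_def loc_rel_iff)

lemma mfrac_mem_iff:
  "x \<in> mfrac m s \<longleftrightarrow> m \<in> carrier M \<and> s \<in> S \<and> fst x \<in> carrier M \<and> snd x \<in> S \<and>
     snd x \<odot>\<^bsub>M\<^esub> m = s \<odot>\<^bsub>M\<^esub> fst x"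
  by (cases x) (auto simp: loc_frac_def loc_rel_iff)

lemma mem_MS_iff: "x \<in> carrier MS \<longleftrightarrow> (\<exists>m \<in> carrier M. \<exists>s \<in> S. x = mfrac m s)"
  by (auto simp: loc_module_def quotient_def loc_frac_def)

text \<open>The product is a union over all representatives; since each pair of representatives
  yields the same class, the union collapses to that class.\<close>

lemma loc_smult_frac:
  assumes "a \<in> carrier R" "s \<in> S" "m \<in> carrier M" "t \<in> S"
  shows "loc_smult R M S (rfrac a s) (mfrac m t) = mfrac (a \<odot>\<^bsub>M\<^esub> m) (s \<otimes> t)"
proof -
  have *: "mfrac (a' \<odot>\<^bsub>M\<^esub> m') (s' \<otimes> t') = mfrac (a \<odot>\<^bsub>M\<^esub> m) (s \<otimes> t)"
    if x: "(a', s') \<in> rfrac a s" and y: "(m', t') \<in> mfrac m t" for a' s' m' t'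
  proof -
    have c: "a' \<in> carrier R" "s' \<in> S" "m' \<in> carrier M" "t' \<in> S"
      and eq: "s' \<otimes> a = s \<otimes> a'" "t' \<odot>\<^bsub>M\<^esub> m = t \<odot>\<^bsub>M\<^esub> m'"
      using x y localization.mfrac_mem_iff[OF regular_localization] mfrac_mem_iff by auto
    have "(s \<otimes> t) \<odot>\<^bsub>M\<^esub> (a' \<odot>\<^bsub>M\<^esub> m') = (s \<otimes> a') \<odot>\<^bsub>M\<^esub> (t \<odot>\<^bsub>M\<^esub> m')"
      using c assms by (simp add: act_mult act_left_commute)
    also have "\<dots> = (s' \<otimes> a) \<odot>\<^bsub>M\<^esub> (t' \<odot>\<^bsub>M\<^esub> m)"
      by (simp only: eq)
    also have "\<dots> = (s' \<otimes> t') \<odot>\<^bsub>M\<^esub> (a \<odot>\<^bsub>M\<^esub> m)"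
      using c assms by (simp add: act_mult act_left_commute)
    finally show ?thesis
      using c assms by (simp add: mfrac_eq_iff)
  qed
  have "(a, s) \<in> rfrac a s" "(m, t) \<in> mfrac m t"
    using assms localization.mfrac_mem_iff[OF regular_localization] mfrac_mem_iff by auto
  then show ?thesis
    unfolding loc_smult_def using * by blast
qed

lemma MS_act_frac [simp]:
  "a \<in> carrier R \<Longrightarrow> s \<in> S \<Longrightarrow> m \<in> carrier M \<Longrightarrow> t \<in> S \<Longrightarrow>
     rfrac a s \<odot>\<^bsub>MS\<^esub> mfrac m t = mfrac (a \<odot>\<^bsub>M\<^esub> m) (s \<otimes> t)"
  using loc_smult_frac by (simp add: loc_module_def)

lemma RS_mult_frac [simp]:
  "a \<in> carrier R \<Longrightarrow> s \<in> S \<Longrightarrow> b \<in> carrier R \<Longrightarrow> t \<in> S \<Longrightarrow>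
     rfrac a s \<otimes>\<^bsub>RS\<^esub> rfrac b t = rfrac (a \<otimes> b) (s \<otimes> t)"
  using localization.loc_smult_frac[OF regular_localization] by (simp add: loc_ring_def)

lemma RS_one: "\<one>\<^bsub>RS\<^esub> = rfrac \<one> \<one>"
  by (simp add: loc_ring_def)

lemma mem_RS_iff: "x \<in> carrier RS \<longleftrightarrow> (\<exists>a \<in> carrier R. \<exists>s \<in> S. x = rfrac a s)"
  by (auto simp: loc_ring_def quotient_def loc_frac_def)

lemma rfrac_eq_iff:
  assumes "a \<in> carrier R" "b \<in> carrier R" "s \<in> S" "t \<in> S"
  shows "rfrac a s = rfrac b t \<longleftrightarrow> t \<otimes> a = s \<otimes> b"
  using localization.mfrac_eq_iff[OF regular_localization, of a b s t] assms by simp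

lemma rfrac_closed [simp, intro]: "a \<in> carrier R \<Longrightarrow> s \<in> S \<Longrightarrow> rfrac a s \<in> carrier RS"
  unfolding mem_RS_iff by blast

lemma mfrac_closed [simp, intro]: "m \<in> carrier M \<Longrightarrow> s \<in> S \<Longrightarrow> mfrac m s \<in> carrier MS"
  unfolding mem_MS_iff by blast

lemma RS_cases:
  assumes "x \<in> carrier RS"
  obtains a s where "a \<in> carrier R" "s \<in> S" "x = rfrac a s"
  using assms unfolding mem_RS_iff by blast

lemma MS_cases:
  assumes "x \<in> carrier MS"
  obtains m s where "m \<in> carrier M" "s \<in> S" "x = mfrac m s"
  using assms unfolding mem_MS_iff by blast

text \<open>The multiplicative structure of the localization is all that factorizations see.\<close>

lemma RS_action: "monoid_action RS MS"
proof -
  have mult: "x \<otimes>\<^bsub>RS\<^esub> y \<in> carrier RS" "x \<otimes>\<^bsub>RS\<^esub> y = y \<otimes>\<^bsub>RS\<^esub> x"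
    if xy: "x \<in> carrier RS" "y \<in> carrier RS" for x y
  proof -
    obtain a s where "a \<in> carrier R" "s \<in> S" "x = rfrac a s"
      using xy(1) by (rule RS_cases)
    moreover obtain b t where "b \<in> carrier R" "t \<in> S" "y = rfrac b t"
      using xy(2) by (rule RS_cases)
    ultimately show "x \<otimes>\<^bsub>RS\<^esub> y \<in> carrier RS" "x \<otimes>\<^bsub>RS\<^esub> y = y \<otimes>\<^bsub>RS\<^esub> x"
      by (simp_all add: m_comm)
  qed
  have assoc: "x \<otimes>\<^bsub>RS\<^esub> y \<otimes>\<^bsub>RS\<^esub> z = x \<otimes>\<^bsub>RS\<^esub> (y \<otimes>\<^bsub>RS\<^esub> z)"
    if "x \<in> carrier RS" "y \<in> carrier RS" "z \<in> carrier RS" for x y z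
    using that unfolding mem_RS_iff by (auto simp: m_assoc)
  have one: "\<one>\<^bsub>RS\<^esub> \<otimes>\<^bsub>RS\<^esub> x = x" if "x \<in> carrier RS" for x
    using that unfolding mem_RS_iff RS_one by auto
  have one': "\<one>\<^bsub>RS\<^esub> \<in> carrier RS"
    unfolding RS_one by simp
  have "comm_monoid RS"
    by (rule comm_monoidI) (use mult assoc one one' in auto)
  moreover have "monoid_action_axioms RS MS"
  proof
    fix x y m assume c: "x \<in> carrier RS" "y \<in> carrier RS" "m \<in> carrier MS"
    then show "x \<otimes>\<^bsub>RS\<^esub> y \<odot>\<^bsub>MS\<^esub> m = x \<odot>\<^bsub>MS\<^esub> (y \<odot>\<^bsub>MS\<^esub> m)"
      unfolding mem_RS_iff mem_MS_iff by (auto simp: act_mult m_assoc)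
  next
    fix x m assume c: "x \<in> carrier RS" "m \<in> carrier MS"
    obtain a s where "a \<in> carrier R" "s \<in> S" "x = rfrac a s"
      using c(1) by (rule RS_cases)
    moreover obtain n t where "n \<in> carrier M" "t \<in> S" "m = mfrac n t"
      using c(2) by (rule MS_cases)
    ultimately show "x \<odot>\<^bsub>MS\<^esub> m \<in> carrier MS"
      by simp
  next
    fix m assume "m \<in> carrier MS"
    then show "\<one>\<^bsub>RS\<^esub> \<odot>\<^bsub>MS\<^esub> m = m"
      unfolding mem_MS_iff RS_one by auto
  qed
  ultimately show ?thesis
    by (rule monoid_action.intro)
qed

lemma saturated': "a \<in> carrier R \<Longrightarrow> b \<in> carrier R \<Longrightarrow> a \<otimes> b \<in> S \<Longrightarrow> b \<in> S"
  using saturated m_comm by metis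

text \<open>An inverse of \<open>a / s\<close> yields a product \<open>a b\<close> in
  \<open>S\<close>, and saturation puts \<open>a\<close> itself into \<open>S\<close>.\<close>

lemma rfrac_Units_iff:
  assumes "a \<in> carrier R" "s \<in> S"
  shows "rfrac a s \<in> Units RS \<longleftrightarrow> a \<in> S"
proof
  assume "rfrac a s \<in> Units RS"
  then obtain y where y: "y \<in> carrier RS" "rfrac a s \<otimes>\<^bsub>RS\<^esub> y = \<one>\<^bsub>RS\<^esub>"
    unfolding Units_def by blast
  from y(1) obtain b t where b: "b \<in> carrier R" "t \<in> S" "y = rfrac b t"
    by (rule RS_cases)
  with y(2) have "rfrac (a \<otimes> b) (s \<otimes> t) = rfrac \<one> \<one>"
    using assms by (simp add: RS_one)
  then have "a \<otimes> b = s \<otimes> t"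
    using assms b by (simp add: rfrac_eq_iff)
  then show "a \<in> S"
    using saturated[of a b] assms b by simp
next
  assume a: "a \<in> S"
  have "rfrac a s \<otimes>\<^bsub>RS\<^esub> rfrac s a = \<one>\<^bsub>RS\<^esub>" "rfrac s a \<otimes>\<^bsub>RS\<^esub> rfrac a s = \<one>\<^bsub>RS\<^esub>"
    using a assms by (simp_all add: RS_one rfrac_eq_iff m_comm)
  then show "rfrac a s \<in> Units RS"
    unfolding Units_def using a assms by blast
qed

lemma RS_factor_action:
  assumes S': "submonoid S' R" "S \<subseteq> S'"
  shows "factor_action RS MS (loc_set R S S')"
proof -
  have S'c: "a \<in> carrier R" if "a \<in> S'" for a
    using that submonoid.subset[OF S'(1)] by blast
  have mult: "a \<otimes> b \<in> S'" if "a \<in> S'" "b \<in> S'" for a b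
    using that by (rule submonoid.m_closed[OF S'(1)])
  have "submonoid (loc_set R S S') RS"
  proof
    show "loc_set R S S' \<subseteq> carrier RS"
      unfolding loc_set_def using S'c by auto
    show "\<one>\<^bsub>RS\<^esub> \<in> loc_set R S S'"
      unfolding loc_set_def RS_one using S'(2) S_one by blast
    fix x y assume "x \<in> loc_set R S S'" "y \<in> loc_set R S S'"
    then obtain a s b t where "a \<in> S'" "s \<in> S" "b \<in> S'" "t \<in> S" "x = rfrac a s" "y = rfrac b t"
      unfolding loc_set_def by blast
    moreover from this have "x \<otimes>\<^bsub>RS\<^esub> y = rfrac (a \<otimes> b) (s \<otimes> t)"
      using S'c by simp
    ultimately show "x \<otimes>\<^bsub>RS\<^esub> y \<in> loc_set R S S'"
      unfolding loc_set_def using mult S_mult by blast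
  qed
  moreover have "Units RS \<subseteq> loc_set R S S'"
  proof
    fix x assume x: "x \<in> Units RS"
    then have "x \<in> carrier RS"
      unfolding Units_def by blast
    then obtain a s where "a \<in> carrier R" "s \<in> S" "x = rfrac a s"
      by (rule RS_cases)
    then show "x \<in> loc_set R S S'"
      using x rfrac_Units_iff S'(2) unfolding loc_set_def by blast
  qed
  ultimately show ?thesis
    using RS_action by (simp add: factor_action_def factor_action_axioms_def)
qed

end

section \<open>Splitting submonoids\<close>

locale splitting = localization R M S
  for R :: "('a, 'c) ring_scheme" (structure) and M :: "('a, 'b, 'd) module_scheme" and S +
  assumes zero_closed [simp]: "\<zero>\<^bsub>M\<^esub> \<in> carrier M"
    and act_zero [simp]: "a \<in> carrier R \<Longrightarrow> a \<odot>\<^bsub>M\<^esub> \<zero>\<^bsub>M\<^esub> = \<zero>\<^bsub>M\<^esub>"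
    and zero_act: "m \<in> carrier M \<Longrightarrow> \<zero> \<odot>\<^bsub>M\<^esub> m = \<zero>\<^bsub>M\<^esub>"
    and nontrivial: "carrier M \<noteq> {\<zero>\<^bsub>M\<^esub>}"
    and splits: "splits R M S (carrier M)"
begin

sublocale ring: factor_action R "regular_module R" "carrier R"
  by (rule regular_factor_action)

text \<open>Zero is always \<open>S\<close>-primitive here, so it has to be excluded.\<close>

abbreviation "Prim \<equiv> {x. mprimitive R M S x \<and> x \<noteq> \<zero>\<^bsub>M\<^esub>}"

text \<open>\<open>S\<close>-primitivity in \<open>R\<close> asks for associates, this asks for
  units. The two agree on elements that act nontrivially on \<open>M\<close>, and the form with
  units passes to factors.\<close>

definition S_free :: "'a \<Rightarrow> bool" where
  "S_free r \<longleftrightarrow> r \<in> carrier R \<and> (\<forall>s \<in> S. \<forall>q \<in> carrier R. r = s \<otimes> q \<longrightarrow> s \<in> Units R)"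

text \<open>For ring elements this is the complement of the annihilator: only there can statements
  about \<open>R\<close> be deduced from the splitting of \<open>M\<close>.\<close>

definition acts :: "'a \<Rightarrow> bool" where
  "acts r \<longleftrightarrow> (\<exists>m \<in> carrier M. r \<odot>\<^bsub>M\<^esub> m \<noteq> \<zero>\<^bsub>M\<^esub>)"

lemma Prim_closed: "x \<in> Prim \<Longrightarrow> x \<in> carrier M"
  using mprimitive_closed by simp

lemma S_act_nonzero:
  assumes "s \<in> S" "m \<in> carrier M" "m \<noteq> \<zero>\<^bsub>M\<^esub>"
  shows "s \<odot>\<^bsub>M\<^esub> m \<noteq> \<zero>\<^bsub>M\<^esub>"
  using cancel_M[of s m "\<zero>\<^bsub>M\<^esub>"] assms by auto

lemma Prim_decomposition:
  assumes "m \<in> carrier M" "m \<noteq> \<zero>\<^bsub>M\<^esub>"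
  obtains s x where "s \<in> S" "x \<in> Prim" "m = s \<odot>\<^bsub>M\<^esub> x"
proof -
  have "compact_factorizations R M S m \<noteq> {}"
    using splits assms unfolding splits_def semi_factorable_def compactly_atomic_def by blast
  then obtain s x where "s \<in> S" "mprimitive R M S x" "m = s \<odot>\<^bsub>M\<^esub> x"
    unfolding compact_factorizations_def by blast
  moreover from this have "x \<noteq> \<zero>\<^bsub>M\<^esub>"
    using assms(2) by auto
  ultimately show ?thesis
    using that by blast
qed

lemma Prim_nonempty: "Prim \<noteq> {}"
proof -
  obtain m where "m \<in> carrier M" "m \<noteq> \<zero>\<^bsub>M\<^esub>"
    using nontrivial zero_closed by blast
  then show ?thesis
    using Prim_decomposition by blast
qed

lemma Unit_of_mult_one:
  assumes "a \<in> carrier R" "b \<in> carrier R" "b \<otimes> a = \<one>"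
  shows "a \<in> Units R"
proof -
  have "a \<otimes> b = \<one>"
    using assms m_comm[of a b] by simp
  then show ?thesis
    using assms unfolding Units_def by blast
qed

text \<open>Semi-factorability gives \<open>s ~ t\<close> only. As elements of \<open>S\<close>
  cancel in \<open>R\<close>, the two multipliers are mutually inverse, so \<open>s\<close> and
  \<open>t\<close> differ by a unit; cancelling \<open>t\<close> on \<open>M\<close> then compares
  \<open>x\<close> and \<open>y\<close>.\<close>

lemma Prim_unique:
  assumes "s \<in> S" "t \<in> S" "x \<in> Prim" "y \<in> Prim" "s \<odot>\<^bsub>M\<^esub> x = t \<odot>\<^bsub>M\<^esub> y"
  obtains u where "u \<in> Units R" "s = u \<otimes> t" "y = u \<odot>\<^bsub>M\<^esub> x"
proof -
  have c: "x \<in> carrier M" "y \<in> carrier M" "s \<in> carrier R" "t \<in> carrier R"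
    using assms Prim_closed by auto
  have "s \<odot>\<^bsub>M\<^esub> x \<in> carrier M - {\<zero>\<^bsub>M\<^esub>}"
    using S_act_nonzero assms c by auto
  moreover have "(s, x) \<in> compact_factorizations R M S (s \<odot>\<^bsub>M\<^esub> x)"
    "(t, y) \<in> compact_factorizations R M S (s \<odot>\<^bsub>M\<^esub> x)"
    using assms unfolding compact_factorizations_def by auto
  ultimately have "rsim R s t"
    using splits unfolding splits_def semi_factorable_def by blast
  then obtain a b where ab: "a \<in> carrier R" "b \<in> carrier R" "s = a \<otimes> t" "t = b \<otimes> s"
    unfolding rsim_def msim_def by auto
  have "t \<otimes> (b \<otimes> a) = b \<otimes> (a \<otimes> t)"
    using ab(1,2) c by (simp add: m_ac)
  also have "\<dots> = t \<otimes> \<one>"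
    unfolding ab(3)[symmetric] ab(4)[symmetric] using c by simp
  finally have "t \<otimes> (b \<otimes> a) = t \<otimes> \<one>" .
  then have "b \<otimes> a = \<one>"
    using cancel_R[of t "b \<otimes> a" \<one>] assms(2) ab(1,2) by simp
  then have a: "a \<in> Units R"
    using ab Unit_of_mult_one by blast
  have "t \<odot>\<^bsub>M\<^esub> y = t \<odot>\<^bsub>M\<^esub> (a \<odot>\<^bsub>M\<^esub> x)"
  proof -
    have "t \<odot>\<^bsub>M\<^esub> y = (a \<otimes> t) \<odot>\<^bsub>M\<^esub> x"
      using assms(5)[symmetric] unfolding ab(3) .
    also have "\<dots> = t \<odot>\<^bsub>M\<^esub> (a \<odot>\<^bsub>M\<^esub> x)"
      using ab(1) c by (simp add: act_mult act_left_commute)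
    finally show ?thesis .
  qed
  then have "y = a \<odot>\<^bsub>M\<^esub> x"
    using cancel_M[of t y "a \<odot>\<^bsub>M\<^esub> x"] assms(2) ab(1) c by simp
  then show ?thesis
    using that a ab by blast
qed

text \<open>Splitting off the \<open>S\<close>-parts of \<open>y = t x\<close> and of
  \<open>c x = t' x'\<close> gives \<open>t x = (t s t') x'\<close>, so by uniqueness
  \<open>t\<close> and \<open>t s t'\<close> differ by a unit. The cofactor \<open>c\<close> ranges
  over all of \<open>R\<close>, so that the lemma also covers associates with respect to
  \<open>S'\<close> or in \<open>R\<close>.\<close>

lemma Unit_of_act_eq:
  assumes "s \<in> S" "c \<in> carrier R" "y \<in> carrier M" "y \<noteq> \<zero>\<^bsub>M\<^esub>" "y = s \<odot>\<^bsub>M\<^esub> (c \<odot>\<^bsub>M\<^esub> y)"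
  shows "s \<in> Units R"
proof -
  obtain t x where t: "t \<in> S" "x \<in> Prim" "y = t \<odot>\<^bsub>M\<^esub> x"
    using Prim_decomposition assms by blast
  have x: "x \<in> carrier M" using t Prim_closed by blast
  have "c \<odot>\<^bsub>M\<^esub> x \<noteq> \<zero>\<^bsub>M\<^esub>"
  proof
    assume "c \<odot>\<^bsub>M\<^esub> x = \<zero>\<^bsub>M\<^esub>"
    then have "c \<odot>\<^bsub>M\<^esub> y = \<zero>\<^bsub>M\<^esub>"
      using t x assms(2) by (metis act_left_commute act_zero S_carrier)
    then show False
      using assms(1,4,5) by (metis act_zero S_carrier)
  qed
  then obtain t' x' where t': "t' \<in> S" "x' \<in> Prim" "c \<odot>\<^bsub>M\<^esub> x = t' \<odot>\<^bsub>M\<^esub> x'"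
    using Prim_decomposition assms(2) x act_closed by metis
  have x': "x' \<in> carrier M" using t' Prim_closed by blast
  have "t \<odot>\<^bsub>M\<^esub> x = s \<odot>\<^bsub>M\<^esub> (c \<odot>\<^bsub>M\<^esub> (t \<odot>\<^bsub>M\<^esub> x))"
    using assms(5) unfolding t(3) .
  also have "\<dots> = s \<odot>\<^bsub>M\<^esub> (t \<odot>\<^bsub>M\<^esub> (c \<odot>\<^bsub>M\<^esub> x))"
    using assms(1,2) t(1) x by (simp add: act_left_commute)
  finally have "t \<odot>\<^bsub>M\<^esub> x = (t \<otimes> (s \<otimes> t')) \<odot>\<^bsub>M\<^esub> x'"
    unfolding t'(3) using t'(1) t(1) x' assms(1) by (simp add: act_mult act_left_commute)
  \<comment> \<open>Here \<open>t\<close> is associated to a multiple of itself; cancelling it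
    leaves an inverse of \<open>s\<close>.\<close>
  then obtain u where u: "u \<in> Units R" "t = u \<otimes> (t \<otimes> (s \<otimes> t'))"
    using Prim_unique[of t "t \<otimes> (s \<otimes> t')" x x'] t t' assms(1) by (metis S_mult)
  then have "t \<otimes> \<one> = t \<otimes> ((u \<otimes> t') \<otimes> s)"
    using t(1) t'(1) u(1) assms(1) by (simp add: m_ac Units_closed)
  then have "(u \<otimes> t') \<otimes> s = \<one>"
    using cancel_R[of t \<one> "(u \<otimes> t') \<otimes> s"] t(1) t'(1) u(1) assms(1) by (simp add: Units_closed)
  then show ?thesis
    using Unit_of_mult_one[of s "u \<otimes> t'"] u(1) t'(1) assms(1) by (simp add: Units_closed)
qed

text \<open>Primitivity only says that \<open>y\<close> is a multiple of \<open>x\<close>;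
  \<open>Unit_of_act_eq\<close> sharpens this to a unit.\<close>

lemma Prim_Unit:
  assumes "x \<in> Prim" "s \<in> S" "y \<in> carrier M" "x = s \<odot>\<^bsub>M\<^esub> y"
  shows "s \<in> Units R"
proof -
  have x: "x \<in> carrier M" "x \<noteq> \<zero>\<^bsub>M\<^esub>"
    using assms(1) Prim_closed by auto
  then have "msim R M S y x"
    using assms unfolding mprimitive_def by blast
  then obtain c where c: "c \<in> S" "y = c \<odot>\<^bsub>M\<^esub> x"
    unfolding msim_def by blast
  show ?thesis
    by (rule Unit_of_act_eq[OF assms(2) S_carrier[OF c(1)] x assms(4)[unfolded c(2)]])
qed

lemma PrimI:
  assumes "x \<in> carrier M" "x \<noteq> \<zero>\<^bsub>M\<^esub>"
    and "\<And>s y. s \<in> S \<Longrightarrow> y \<in> carrier M \<Longrightarrow> x = s \<odot>\<^bsub>M\<^esub> y \<Longrightarrow> s \<in> Units R"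
  shows "x \<in> Prim"
proof -
  have "msim R M S y x" if "s \<in> S" "y \<in> carrier M" "x = s \<odot>\<^bsub>M\<^esub> y" for s y
    using msim_unit[OF assms(3)[OF that] that(2)] msim_sym that(3) by blast
  then show ?thesis
    using assms(1,2) unfolding mprimitive_def by blast
qed

lemma Prim_unit:
  assumes "u \<in> Units R" "x \<in> Prim"
  shows "u \<odot>\<^bsub>M\<^esub> x \<in> Prim"
  using assms mprimitive_unit S_act_nonzero[of u x] Prim_closed[of x] by auto

text \<open>An element of \<open>S\<close> dividing \<open>m\<close> also divides
  \<open>a m\<close>.\<close>

lemma Prim_factor:
  assumes "a \<odot>\<^bsub>M\<^esub> m \<in> Prim" "a \<in> carrier R" "m \<in> carrier M"
  shows "m \<in> Prim"
proof (rule PrimI)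
  show "m \<noteq> \<zero>\<^bsub>M\<^esub>"
    using assms by auto
  fix s y assume s: "s \<in> S" "y \<in> carrier M" "m = s \<odot>\<^bsub>M\<^esub> y"
  then have "a \<odot>\<^bsub>M\<^esub> m = s \<odot>\<^bsub>M\<^esub> (a \<odot>\<^bsub>M\<^esub> y)"
    using assms(2) by (metis act_left_commute S_carrier)
  then show "s \<in> Units R"
    using Prim_Unit[OF assms(1) s(1)] assms(2) s(2) by blast
qed (use assms in simp)

lemma S_free_closed: "S_free r \<Longrightarrow> r \<in> carrier R"
  unfolding S_free_def by blast

lemma Unit_of_mult_eq:
  assumes "s \<in> S" "c \<in> carrier R" "r \<in> carrier R" "acts r" "r = s \<otimes> (c \<otimes> r)"
  shows "s \<in> Units R"
proof -
  obtain m where m: "m \<in> carrier M" "r \<odot>\<^bsub>M\<^esub> m \<noteq> \<zero>\<^bsub>M\<^esub>"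
    using assms(4) unfolding acts_def by blast
  have "r \<odot>\<^bsub>M\<^esub> m = (s \<otimes> (c \<otimes> r)) \<odot>\<^bsub>M\<^esub> m"
    using assms(5) by (rule arg_cong)
  also have "\<dots> = s \<odot>\<^bsub>M\<^esub> (c \<odot>\<^bsub>M\<^esub> (r \<odot>\<^bsub>M\<^esub> m))"
    using assms(1-3) m(1) by (simp add: act_mult)
  finally show ?thesis
    by (rule Unit_of_act_eq[OF assms(1,2) act_closed[OF assms(3) m(1)] m(2)])
qed

lemma S_free_mprimitive:
  assumes "S_free r"
  shows "mprimitive R (regular_module R) S r"
  unfolding mprimitive_def
proof (intro conjI ballI impI)
  show "r \<in> carrier (regular_module R)"
    using assms S_free_closed by simp
  fix s q assume s: "s \<in> S" "q \<in> carrier (regular_module R)" "r = s \<odot>\<^bsub>regular_module R\<^esub> q"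
  interpret reg: localization R "regular_module R" S
    by (rule regular_localization)
  have "s \<in> Units R"
    using assms s unfolding S_free_def by auto
  then show "msim R (regular_module R) S q r"
    using reg.msim_unit[of s q] reg.msim_sym s by simp
qed

lemma S_free_of_mprimitive:
  assumes "mprimitive R (regular_module R) S r" "acts r"
  shows "S_free r"
  unfolding S_free_def
proof (intro conjI ballI impI)
  show r: "r \<in> carrier R"
    using assms(1) unfolding mprimitive_def by simp
  fix s q assume s: "s \<in> S" "q \<in> carrier R" "r = s \<otimes> q"
  then have "msim R (regular_module R) S q r"
    using assms(1) unfolding mprimitive_def by simp
  then obtain c where c: "c \<in> S" "q = c \<otimes> r"
    unfolding msim_def by auto
  show "s \<in> Units R"
    by (rule Unit_of_mult_eq[OF s(1) S_carrier[OF c(1)] r assms(2) s(3)[unfolded c(2)]])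
qed

lemma S_free_act:
  assumes "S_free r" "x \<in> Prim" "r \<odot>\<^bsub>M\<^esub> x \<noteq> \<zero>\<^bsub>M\<^esub>"
  shows "r \<odot>\<^bsub>M\<^esub> x \<in> Prim"
  using splits S_free_mprimitive[OF assms(1)] assms S_free_closed Prim_closed[OF assms(2)]
  unfolding splits_def by auto

lemma S_free_factor:
  assumes "S_free (b \<otimes> c)" "b \<in> carrier R" "c \<in> carrier R"
  shows "S_free b"
  unfolding S_free_def
proof (intro conjI ballI impI)
  fix s q assume s: "s \<in> S" "q \<in> carrier R" "b = s \<otimes> q"
  then have "b \<otimes> c = s \<otimes> (q \<otimes> c)"
    using assms by (simp add: m_assoc)
  then show "s \<in> Units R"
    using assms(1,3) s unfolding S_free_def by blast
qed (use assms in simp)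

text \<open>If \<open>a = s b\<close>, then \<open>a ~ s\<close> would put \<open>a\<close> into
  \<open>S\<close> by saturation. Hence \<open>a ~ b\<close>, so \<open>b\<close> is a multiple of
  \<open>a\<close> and \<open>s\<close> can be undone.\<close>

lemma S_free_irreducible:
  assumes "rirreducible R a" "a \<notin> S" "acts a"
  shows "S_free a"
  unfolding S_free_def
proof (intro conjI ballI impI)
  show a: "a \<in> carrier R"
    using assms(1) unfolding rirreducible_def by blast
  fix s b assume s: "s \<in> S" "b \<in> carrier R" "a = s \<otimes> b"
  then have "rsim R a s \<or> rsim R a b"
    using assms(1) unfolding rirreducible_def by blast
  moreover have "\<not> rsim R a s"
  proof
    assume "rsim R a s"
    then obtain c where "c \<in> carrier R" "s = c \<otimes> a"
      unfolding rsim_def msim_def by auto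
    then show False
      using saturated'[of c a] a s(1) assms(2) by simp
  qed
  ultimately obtain c where c: "c \<in> carrier R" "b = c \<otimes> a"
    unfolding rsim_def msim_def by auto
  show "s \<in> Units R"
    by (rule Unit_of_mult_eq[OF s(1) c(1) a assms(3) s(3)[unfolded c(2)]])
qed

lemma acts_mult:
  assumes "acts (a \<otimes> b)" "a \<in> carrier R" "b \<in> carrier R"
  shows "acts a" "acts b"
proof -
  obtain m where m: "m \<in> carrier M" "a \<odot>\<^bsub>M\<^esub> (b \<odot>\<^bsub>M\<^esub> m) \<noteq> \<zero>\<^bsub>M\<^esub>"
    using assms act_mult unfolding acts_def by auto
  then show "acts a"
    unfolding acts_def using assms by blast
  have "b \<odot>\<^bsub>M\<^esub> m \<noteq> \<zero>\<^bsub>M\<^esub>"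
    using m assms by auto
  then show "acts b"
    unfolding acts_def using m by blast
qed

lemma acts_Prim:
  assumes "acts a" "a \<in> carrier R"
  obtains x where "x \<in> Prim" "a \<odot>\<^bsub>M\<^esub> x \<noteq> \<zero>\<^bsub>M\<^esub>"
proof -
  obtain m where m: "m \<in> carrier M" "a \<odot>\<^bsub>M\<^esub> m \<noteq> \<zero>\<^bsub>M\<^esub>"
    using assms unfolding acts_def by blast
  then have "m \<noteq> \<zero>\<^bsub>M\<^esub>"
    using assms by auto
  then obtain s x where s: "s \<in> S" "x \<in> Prim" "m = s \<odot>\<^bsub>M\<^esub> x"
    using Prim_decomposition m by blast
  have "a \<odot>\<^bsub>M\<^esub> x \<noteq> \<zero>\<^bsub>M\<^esub>"
  proof
    assume "a \<odot>\<^bsub>M\<^esub> x = \<zero>\<^bsub>M\<^esub>"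
    then have "a \<odot>\<^bsub>M\<^esub> m = \<zero>\<^bsub>M\<^esub>"
      using s assms(2) Prim_closed by (metis act_left_commute act_zero S_carrier)
    then show False using m by simp
  qed
  then show ?thesis
    using that s by blast
qed

lemma S_acts: "s \<in> S \<Longrightarrow> acts s"
  unfolding acts_def using Prim_nonempty S_act_nonzero Prim_closed by blast

lemma list_prod_acts:
  assumes "set ss \<subseteq> carrier R" "m \<in> carrier M" "list_prod R ss \<odot>\<^bsub>M\<^esub> m \<noteq> \<zero>\<^bsub>M\<^esub>" "s \<in> set ss"
  shows "acts s"
proof -
  have "acts (list_prod R ss)"
    unfolding acts_def using assms by blast
  moreover obtain q where "q \<in> carrier R" "list_prod R ss = s \<otimes> q"
    using list_prod_mem_factor assms(1,4) by blast
  ultimately show ?thesis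
    using acts_mult(1)[of s q] assms(1,4) by auto
qed

text \<open>If the whole product does not vanish on \<open>x\<close>, neither does any partial
  product, so the second splitting condition applies to one factor at a time.\<close>

lemma list_prod_Prim:
  assumes "\<And>p. p \<in> set ps \<Longrightarrow> S_free p" "x \<in> Prim" "list_prod R ps \<odot>\<^bsub>M\<^esub> x \<noteq> \<zero>\<^bsub>M\<^esub>"
  shows "list_prod R ps \<odot>\<^bsub>M\<^esub> x \<in> Prim"
  using assms
proof (induction ps)
  case Nil
  then show ?case using Prim_closed[of x] by simp
next
  case (Cons p ps)
  have c: "p \<in> carrier R" "set ps \<subseteq> carrier R" "x \<in> carrier M"
    using Cons.prems S_free_closed Prim_closed by auto
  have eq: "list_prod R (p # ps) \<odot>\<^bsub>M\<^esub> x = p \<odot>\<^bsub>M\<^esub> (list_prod R ps \<odot>\<^bsub>M\<^esub> x)"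
    using c by (simp add: act_mult)
  then have "list_prod R ps \<odot>\<^bsub>M\<^esub> x \<noteq> \<zero>\<^bsub>M\<^esub>"
    using Cons.prems(3) c by auto
  then have "list_prod R ps \<odot>\<^bsub>M\<^esub> x \<in> Prim"
    using Cons by simp
  then show ?case
    unfolding eq using S_free_act[of p] Cons.prems eq by auto
qed

text \<open>Both sides are compared after acting on a primitive element of \<open>M\<close>.\<close>

lemma S_free_unique:
  assumes st: "s \<in> S" "t \<in> S" and a: "S_free a" "acts a" and q: "q \<in> carrier R"
    and q_act: "\<And>x. x \<in> Prim \<Longrightarrow> q \<odot>\<^bsub>M\<^esub> x \<noteq> \<zero>\<^bsub>M\<^esub> \<Longrightarrow> q \<odot>\<^bsub>M\<^esub> x \<in> Prim"
    and eq: "s \<otimes> a = t \<otimes> q"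
  obtains u where "u \<in> Units R" "s = u \<otimes> t" "q = u \<otimes> a"
proof -
  have ac: "a \<in> carrier R"
    using a S_free_closed by blast
  obtain x where x: "x \<in> Prim" "a \<odot>\<^bsub>M\<^esub> x \<noteq> \<zero>\<^bsub>M\<^esub>"
    using acts_Prim a ac by blast
  have xc: "x \<in> carrier M"
    using x Prim_closed by blast
  have eq': "s \<odot>\<^bsub>M\<^esub> (a \<odot>\<^bsub>M\<^esub> x) = t \<odot>\<^bsub>M\<^esub> (q \<odot>\<^bsub>M\<^esub> x)"
    using eq st ac q xc by (metis act_mult S_carrier)
  moreover have ne: "s \<odot>\<^bsub>M\<^esub> (a \<odot>\<^bsub>M\<^esub> x) \<noteq> \<zero>\<^bsub>M\<^esub>"
    using S_act_nonzero st x ac xc by auto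
  ultimately have "q \<odot>\<^bsub>M\<^esub> x \<noteq> \<zero>\<^bsub>M\<^esub>"
    using st by auto
  then obtain u where u: "u \<in> Units R" "s = u \<otimes> t"
    using Prim_unique[OF st S_free_act[OF a(1) x] q_act[OF x(1)] eq'] by blast
  have "t \<otimes> (u \<otimes> a) = t \<otimes> q"
    using eq u st ac by (simp add: m_ac Units_closed)
  then have "q = u \<otimes> a"
    using cancel_R[of t "u \<otimes> a" q] st ac q u by (simp add: Units_closed)
  then show ?thesis
    using that u by blast
qed

end

section \<open>Separating the part in \<open>S\<close>\<close>

text \<open>Units are the last entries of the atomic factorizations of elements of \<open>S\<close>
  in the ring; \<open>ring_atomic_factorizationD\<close> gives the converse.\<close>

lemma (in monoid_action) Units_ring_mprimitive:
  assumes "u \<in> Units R"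
  shows "mprimitive R (regular_module R) (carrier R) u"
proof -
  interpret ring: factor_action R "regular_module R" "carrier R"
    by (rule regular_factor_action)
  have "mprimitive R (regular_module R) (carrier R) \<one>"
    unfolding mprimitive_def
  proof (intro conjI ballI impI)
    fix s n
    assume c: "s \<in> carrier R" "n \<in> carrier (regular_module R)"
      and eq: "\<one> = s \<odot>\<^bsub>regular_module R\<^esub> n"
    have "n = n \<otimes> \<one>"
      using c by simp
    then show "msim R (regular_module R) (carrier R) n \<one>"
      unfolding msim_def using c eq by auto
  qed simp
  then have "mprimitive R (regular_module R) (carrier R) (u \<otimes> \<one>)"
    using ring.mprimitive_unit[OF assms] by fastforce
  then show ?thesis
    using assms by (simp add: Units_closed)
qed

locale splitting_pair = splitting R M S
  for R :: "('a, 'c) ring_scheme" (structure) and M :: "('a, 'b, 'd) module_scheme" and S +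
  fixes S' :: "'a set"
  assumes submonoid_S': "submonoid S' R"
    and S_subset: "S \<subseteq> S'"
    and saturated_S': "a \<in> carrier R \<Longrightarrow> b \<in> carrier R \<Longrightarrow> a \<otimes> b \<in> S' \<Longrightarrow> a \<in> S'"
begin

sublocale big: factor_action R M S'
  using submonoid_S' Units_subset S_subset
  by (intro factor_action.intro monoid_action_axioms factor_action_axioms.intro) auto

lemma saturated_S'2: "a \<in> carrier R \<Longrightarrow> b \<in> carrier R \<Longrightarrow> a \<otimes> b \<in> S' \<Longrightarrow> b \<in> S'"
  using saturated_S' m_comm by metis

text \<open>\<open>S'\<close>-primitivity makes \<open>y\<close> a multiple of \<open>n\<close> with
  a factor from \<open>S'\<close>, which is enough for \<open>Unit_of_act_eq\<close>.\<close>

lemma big_mprimitive_Prim: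
  assumes "mprimitive R M S' n" "n \<noteq> \<zero>\<^bsub>M\<^esub>"
  shows "n \<in> Prim"
proof (rule PrimI)
  show n: "n \<in> carrier M"
    using assms(1) big.mprimitive_closed by blast
  fix s y assume s: "s \<in> S" "y \<in> carrier M" "n = s \<odot>\<^bsub>M\<^esub> y"
  then have "msim R M S' y n"
    using assms(1) S_subset unfolding mprimitive_def by blast
  then obtain c where c: "c \<in> S'" "y = c \<odot>\<^bsub>M\<^esub> n"
    unfolding msim_def by blast
  show "s \<in> Units R"
    by (rule Unit_of_act_eq[OF s(1) big.S_carrier[OF c(1)] n assms(2) s(3)[unfolded c(2)]])
qed (rule assms(2))

lemma Prim_list_prod_not_S:
  assumes "x \<in> Prim" "(ss, n) \<in> factorizations R M S' x" "s \<in> set ss"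
  shows "s \<notin> S"
proof
  assume s: "s \<in> S"
  note f = big.factorizationsD[OF assms(2)]
  obtain q where q: "q \<in> carrier R" "list_prod R ss = s \<otimes> q"
    using list_prod_mem_factor[OF f(2) assms(3)] by blast
  have "x = s \<odot>\<^bsub>M\<^esub> (q \<odot>\<^bsub>M\<^esub> n)"
    using f(4,5) q s by (simp add: act_mult)
  then have "s \<in> Units R"
    using Prim_Unit[OF assms(1) s] q(1) f(4) by blast
  then show False
    using f(3) assms(3) by blast
qed

text \<open>The product of the factors in \<open>S\<close> agrees with \<open>s\<close> only up to
  the unit \<open>u\<close>. Placing \<open>u\<close> in the last entry for \<open>s\<close> and
  \<open>inv u\<close> in the last entry for \<open>x\<close> makes both equations exact.\<close>

lemma atomic_factorization_split:
  assumes s: "s \<in> S" and x: "x \<in> Prim"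
    and f: "(ss, n) \<in> atomic_factorizations R M S' (s \<odot>\<^bsub>M\<^esub> x)"
  obtains u where "u \<in> Units R"
    "(filter (\<lambda>a. a \<in> S) ss, u) \<in> atomic_factorizations R (regular_module R) (carrier R) s"
    "(filter (\<lambda>a. a \<notin> S) ss, inv u \<odot>\<^bsub>M\<^esub> n) \<in> atomic_factorizations R M S' x"
proof -
  define as bs where "as = filter (\<lambda>a. a \<in> S) ss" and "bs = filter (\<lambda>a. a \<notin> S) ss"
  note f1 = big.atomic_factorizationsD[OF f]
  note f2 = big.factorizationsD[OF f1(1)]
  have xc: "x \<in> carrier M"
    using x Prim_closed by blast
  have sub: "set as \<subseteq> S" "set as \<subseteq> carrier R" "set bs \<subseteq> carrier R"
    unfolding as_def bs_def using f2(2) by auto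
  have ne: "s \<odot>\<^bsub>M\<^esub> x \<noteq> \<zero>\<^bsub>M\<^esub>"
    using S_act_nonzero[OF s xc] x by blast
  have prod: "list_prod R ss = list_prod R as \<otimes> list_prod R bs"
    unfolding as_def bs_def using f2(2) by (rule list_prod_filter)
  have eq: "s \<odot>\<^bsub>M\<^esub> x = list_prod R as \<odot>\<^bsub>M\<^esub> (list_prod R bs \<odot>\<^bsub>M\<^esub> n)"
    unfolding f2(5) prod using sub f2(4) by (intro act_mult list_prod_closed)
  have "n \<noteq> \<zero>\<^bsub>M\<^esub>" "list_prod R bs \<odot>\<^bsub>M\<^esub> n \<noteq> \<zero>\<^bsub>M\<^esub>"
    using ne unfolding eq using sub by auto
  then have n: "n \<in> Prim"
    using big_mprimitive_Prim f1(3) by blast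
  have "S_free b" if b: "b \<in> set bs" for b
  proof (rule S_free_irreducible)
    show "rirreducible R b" "b \<notin> S"
      using f1(2) b unfolding bs_def by auto
    show "acts b"
      by (rule list_prod_acts[of bs n]) (use sub f2(4) b \<open>list_prod R bs \<odot>\<^bsub>M\<^esub> n \<noteq> _\<close> in auto)
  qed
  then have z: "list_prod R bs \<odot>\<^bsub>M\<^esub> n \<in> Prim"
    using list_prod_Prim n \<open>list_prod R bs \<odot>\<^bsub>M\<^esub> n \<noteq> _\<close> by blast
  have as: "list_prod R as \<in> S"
    using sub(1) by (rule list_prod_S)
  \<comment> \<open>Two compact decompositions of the same element: one is given, the other comes
    from sorting the factors.\<close>
  obtain u where u: "u \<in> Units R" "s = u \<otimes> list_prod R as"
    "list_prod R bs \<odot>\<^bsub>M\<^esub> n = u \<odot>\<^bsub>M\<^esub> x"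
    using Prim_unique[OF s as x z eq] by blast
  have uc: "u \<in> carrier R" "inv u \<in> carrier R"
    using u(1) by auto
  note prim_u = Units_ring_mprimitive[OF u(1)]
  have fa: "(as, u) \<in> atomic_factorizations R (regular_module R) (carrier R) s"
    using prim_u u(2) uc sub f1(2) f2(3) m_comm[OF uc(1), of "list_prod R as"]
    unfolding atomic_factorizations_def factorizations_def by (auto simp: as_def)
  have "x = inv u \<odot>\<^bsub>M\<^esub> (list_prod R bs \<odot>\<^bsub>M\<^esub> n)"
    unfolding u(3) using u(1) xc by simp
  also have "\<dots> = list_prod R bs \<odot>\<^bsub>M\<^esub> (inv u \<odot>\<^bsub>M\<^esub> n)"
    using uc sub f2(4) by (simp add: act_left_commute)
  finally have "x = list_prod R bs \<odot>\<^bsub>M\<^esub> (inv u \<odot>\<^bsub>M\<^esub> n)" .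
  then have fb: "(bs, inv u \<odot>\<^bsub>M\<^esub> n) \<in> atomic_factorizations R M S' x"
    using big.mprimitive_unit[OF _ f1(3), of "inv u"] u(1) uc f1(2) f2
    unfolding atomic_factorizations_def factorizations_def by (auto simp: bs_def)
  show ?thesis
    using that u(1) fa fb unfolding as_def bs_def by blast
qed

text \<open>As \<open>c = c 1\<close>, an element that is primitive with respect to all of
  \<open>R\<close> is associated to \<open>1\<close>. Saturation then puts every factor into
  \<open>S\<close>.\<close>

lemma ring_atomic_factorizationD:
  assumes "s \<in> S" "(ss, c) \<in> atomic_factorizations R (regular_module R) (carrier R) s"
  shows "c \<in> Units R" "set ss \<subseteq> S"
proof -
  note f1 = ring.atomic_factorizationsD[OF assms(2)]
  note f2 = ring.factorizationsD[OF f1(1)]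
  have c: "c \<in> carrier R"
    using f2(4) by simp
  then have "msim R (regular_module R) (carrier R) \<one> c"
    using f1(3) unfolding mprimitive_def by auto
  then obtain k where k: "k \<in> carrier R" "\<one> = k \<otimes> c"
    unfolding msim_def by auto
  show "c \<in> Units R"
    by (rule Unit_of_mult_one[OF c k(1) k(2)[symmetric]])
  have "list_prod R ss \<in> S"
    using saturated[OF list_prod_closed[OF f2(2)] c] f2(5)[symmetric] assms(1) by simp
  show "set ss \<subseteq> S"
  proof
    fix a assume a: "a \<in> set ss"
    obtain q where q: "q \<in> carrier R" "list_prod R ss = a \<otimes> q"
      using list_prod_mem_factor[OF f2(2) a] by blast
    have "a \<otimes> q \<in> S"
      using \<open>list_prod R ss \<in> S\<close> unfolding q(2) .
    moreover have "a \<in> carrier R"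
      using a f2(2) by blast
    ultimately show "a \<in> S"
      using saturated q(1) by blast
  qed
qed

lemma atomic_factorization_join:
  assumes s: "s \<in> S" and x: "x \<in> Prim"
    and as: "(as, c) \<in> atomic_factorizations R (regular_module R) (carrier R) s"
    and bs: "(bs, n) \<in> atomic_factorizations R M S' x"
  shows "(as @ bs, c \<odot>\<^bsub>M\<^esub> n) \<in> atomic_factorizations R M S' (s \<odot>\<^bsub>M\<^esub> x)"
proof -
  note a1 = ring.atomic_factorizationsD[OF as]
  note a2 = ring.factorizationsD[OF a1(1)]
  note b1 = big.atomic_factorizationsD[OF bs]
  note b2 = big.factorizationsD[OF b1(1)]
  note c = ring_atomic_factorizationD[OF s as]
  have cc: "c \<in> carrier R"
    using c by blast
  have "s \<odot>\<^bsub>M\<^esub> x = (list_prod R as \<otimes> c) \<odot>\<^bsub>M\<^esub> (list_prod R bs \<odot>\<^bsub>M\<^esub> n)"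
    using a2(5) b2(5) by simp
  also have "\<dots> = (list_prod R as \<otimes> list_prod R bs) \<odot>\<^bsub>M\<^esub> (c \<odot>\<^bsub>M\<^esub> n)"
    using a2(2) b2(2,4) cc by (simp add: act_mult act_left_commute)
  also have "list_prod R as \<otimes> list_prod R bs = list_prod R (as @ bs)"
    using a2(2) b2(2) by (simp only: list_prod_append)
  finally have eq: "s \<odot>\<^bsub>M\<^esub> x = list_prod R (as @ bs) \<odot>\<^bsub>M\<^esub> (c \<odot>\<^bsub>M\<^esub> n)" .
  have "mprimitive R M S' (c \<odot>\<^bsub>M\<^esub> n)"
    using big.mprimitive_unit[OF c(1) b1(3)] .
  moreover have "set (as @ bs) \<subseteq> S' - Units R"
    using c(2) S_subset b2(1,3) a2(3) by auto
  moreover have "\<forall>a \<in> set (as @ bs). rirreducible R a"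
    using a1(2) b1(2) by auto
  moreover have "c \<odot>\<^bsub>M\<^esub> n \<in> carrier M"
    using cc b2(4) by blast
  ultimately show ?thesis
    unfolding atomic_factorizations_def factorizations_def using eq by blast
qed

lemma fact_keys_join:
  assumes s: "s \<in> S" and x: "x \<in> Prim"
  shows "fact_keys R M S' (s \<odot>\<^bsub>M\<^esub> x) = {(A + B, d) | A B c d.
     (A, c) \<in> fact_keys R (regular_module R) (carrier R) s \<and> (B, d) \<in> fact_keys R M S' x}"
    (is "?K = ?J")
proof (intro equalityI subsetI)
  fix k assume "k \<in> ?K"
  then obtain ss n where f: "(ss, n) \<in> atomic_factorizations R M S' (s \<odot>\<^bsub>M\<^esub> x)"
    and k: "k = fact_key R M S' (ss, n)"
    unfolding fact_keys_def by (metis imageE prod.collapse)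
  define as bs where "as = filter (\<lambda>a. a \<in> S) ss" and "bs = filter (\<lambda>a. a \<notin> S) ss"
  obtain u where u: "u \<in> Units R"
    "(as, u) \<in> atomic_factorizations R (regular_module R) (carrier R) s"
    "(bs, inv u \<odot>\<^bsub>M\<^esub> n) \<in> atomic_factorizations R M S' x"
    unfolding as_def bs_def using atomic_factorization_split[OF s x f] by blast
  have "n \<in> carrier M"
    using big.mprimitive_closed big.atomic_factorizationsD(3)[OF f] by blast
  then have "mclass R M S' n = mclass R M S' (inv u \<odot>\<^bsub>M\<^esub> n)"
    using big.mclass_unit[of "inv u" n] u(1) by simp
  moreover have "mset (map (rclass R) ss) = mset (map (rclass R) as) + mset (map (rclass R) bs)"
  proof -
    have "mset ss = mset as + mset bs"
      unfolding as_def bs_def by simp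
    then show ?thesis
      by simp
  qed
  ultimately have "k = (mset (map (rclass R) as) + mset (map (rclass R) bs),
      mclass R M S' (inv u \<odot>\<^bsub>M\<^esub> n))"
    unfolding k fact_key_def by simp
  moreover have "(mset (map (rclass R) as), mclass R (regular_module R) (carrier R) u)
      \<in> fact_keys R (regular_module R) (carrier R) s"
    using u(2) unfolding fact_keys_def fact_key_def by force
  moreover have "(mset (map (rclass R) bs), mclass R M S' (inv u \<odot>\<^bsub>M\<^esub> n)) \<in> fact_keys R M S' x"
    using u(3) unfolding fact_keys_def fact_key_def by force
  ultimately show "k \<in> ?J"
    by blast
next
  fix k assume "k \<in> ?J"
  then obtain A B c' d where k: "k = (A + B, d)"
    and A: "(A, c') \<in> fact_keys R (regular_module R) (carrier R) s"
    and B: "(B, d) \<in> fact_keys R M S' x"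
    by blast
  obtain as c where as: "(as, c) \<in> atomic_factorizations R (regular_module R) (carrier R) s"
    "A = mset (map (rclass R) as)"
    using A unfolding fact_keys_def fact_key_def by auto
  obtain bs n where bs: "(bs, n) \<in> atomic_factorizations R M S' x"
    "B = mset (map (rclass R) bs)" "d = mclass R M S' n"
    using B unfolding fact_keys_def fact_key_def by auto
  have "n \<in> carrier M"
    using big.mprimitive_closed big.atomic_factorizationsD(3)[OF bs(1)] by blast
  then have "d = mclass R M S' (c \<odot>\<^bsub>M\<^esub> n)"
    using big.mclass_unit[of c n] ring_atomic_factorizationD(1)[OF s as(1)] bs(3) by simp
  then have "k = fact_key R M S' (as @ bs, c \<odot>\<^bsub>M\<^esub> n)"
    unfolding k fact_key_def as(2) bs(2) by simp
  then show "k \<in> ?K"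
    using atomic_factorization_join[OF s x as(1) bs(1)] unfolding fact_keys_def by blast
qed

text \<open>By saturation, lying in \<open>S\<close> is a property of the associate class; it
  provides the test \<open>Q\<close> of \<open>keys_property_join\<close>.\<close>

lemma rclass_subset_S_iff:
  assumes "a \<in> carrier R"
  shows "rclass R a \<subseteq> S \<longleftrightarrow> a \<in> S"
proof
  assume "rclass R a \<subseteq> S"
  then show "a \<in> S"
    using assms rsim_refl unfolding rclass_def by blast
next
  assume a: "a \<in> S"
  show "rclass R a \<subseteq> S"
  proof
    fix b assume "b \<in> rclass R a"
    then obtain c where "b \<in> carrier R" "c \<in> carrier R" "a = c \<otimes> b"
      unfolding rclass_def rsim_def msim_def regular_module_simps by blast
    then show "b \<in> S"
      using saturated' a by blast
  qed
qed

lemma keys_property_product: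
  assumes s: "s \<in> S" and x: "x \<in> Prim" and P: "P \<in> keyed_properties"
  shows "keys_property P (fact_keys R M S' (s \<odot>\<^bsub>M\<^esub> x)) \<longleftrightarrow>
    keys_property P (fact_keys R (regular_module R) (carrier R) s) \<and>
    keys_property P (fact_keys R M S' x)"
proof (rule keys_property_join[where Q = "\<lambda>D. D \<subseteq> S"
      and ?c0.0 = "mclass R (regular_module R) (carrier R) \<one>"])
  \<comment> \<open>The last entry in the ring is a unit, so its class carries no information and
    can serve as the constant \<open>c0\<close>.\<close>
  show "c = mclass R (regular_module R) (carrier R) \<one> \<and> (\<forall>D \<in># A. D \<subseteq> S)"
    if k: "(A, c) \<in> fact_keys R (regular_module R) (carrier R) s" for A c
  proof -
    obtain as u where as: "(as, u) \<in> atomic_factorizations R (regular_module R) (carrier R) s"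
      and A: "A = mset (map (rclass R) as)" and c: "c = mclass R (regular_module R) (carrier R) u"
      using k unfolding fact_keys_def fact_key_def by auto
    note u = ring_atomic_factorizationD[OF s as]
    have "c = mclass R (regular_module R) (carrier R) \<one>"
      unfolding c using ring.mclass_unit[OF u(1), of \<one>] u(1) by (simp add: Units_closed)
    then show ?thesis
      using u(2) rclass_subset_S_iff unfolding A by auto
  qed
  show "\<forall>D \<in># B. \<not> D \<subseteq> S" if k: "(B, d) \<in> fact_keys R M S' x" for B d
  proof -
    obtain bs n where bs: "(bs, n) \<in> atomic_factorizations R M S' x"
      and B: "B = mset (map (rclass R) bs)"
      using k unfolding fact_keys_def fact_key_def by auto
    note f = big.atomic_factorizationsD(1)[OF bs]
    show ?thesis
      using Prim_list_prod_not_S[OF x f] big.factorizationsD(2)[OF f] rclass_subset_S_iff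
      unfolding B by auto
  qed
qed (use fact_keys_join[OF s x] P in auto)

lemma nonzero_iff_product:
  "m \<in> carrier M - {\<zero>\<^bsub>M\<^esub>} \<longleftrightarrow> (\<exists>s \<in> S. \<exists>x \<in> Prim. m = s \<odot>\<^bsub>M\<^esub> x)"
proof
  assume "m \<in> carrier M - {\<zero>\<^bsub>M\<^esub>}"
  then show "\<exists>s \<in> S. \<exists>x \<in> Prim. m = s \<odot>\<^bsub>M\<^esub> x"
    using Prim_decomposition[of m] by blast
next
  assume "\<exists>s \<in> S. \<exists>x \<in> Prim. m = s \<odot>\<^bsub>M\<^esub> x"
  then obtain s x where *: "s \<in> S" "x \<in> Prim" "m = s \<odot>\<^bsub>M\<^esub> x" by blast
  have x: "x \<in> carrier M" "x \<noteq> \<zero>\<^bsub>M\<^esub>"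
    using Prim_closed[OF *(2)] *(2) by simp_all
  show "m \<in> carrier M - {\<zero>\<^bsub>M\<^esub>}"
    unfolding *(3) using S_act_nonzero[OF *(1) x] act_closed[OF S_carrier[OF *(1)] x(1)] by simp
qed

lemma keyed_property_product:
  assumes P: "P \<in> keyed_properties"
  shows "property_on P R M S' (carrier M - {\<zero>\<^bsub>M\<^esub>}) \<longleftrightarrow>
    property_on P R (regular_module R) (carrier R) S \<and> property_on P R M S' Prim"
proof -
  let ?r = "\<lambda>s. keys_property P (fact_keys R (regular_module R) (carrier R) s)"
  let ?m = "\<lambda>m. keys_property P (fact_keys R M S' m)"
  have "(\<forall>m \<in> carrier M - {\<zero>\<^bsub>M\<^esub>}. ?m m) \<longleftrightarrow> (\<forall>s \<in> S. \<forall>x \<in> Prim. ?m (s \<odot>\<^bsub>M\<^esub> x))"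
    (is "?A \<longleftrightarrow> ?B")
  proof
    assume ?A
    then show ?B
      using nonzero_iff_product[THEN iffD2] by blast
  next
    assume B: ?B
    show ?A
    proof
      fix m assume "m \<in> carrier M - {\<zero>\<^bsub>M\<^esub>}"
      then obtain s x where "s \<in> S" "x \<in> Prim" "m = s \<odot>\<^bsub>M\<^esub> x"
        unfolding nonzero_iff_product by blast
      then show "?m m"
        using B by blast
    qed
  qed
  also have "\<dots> \<longleftrightarrow> (\<forall>s \<in> S. \<forall>x \<in> Prim. ?r s \<and> ?m x)"
    by (intro ball_cong refl keys_property_product[OF _ _ P])
  \<comment> \<open>Neither \<open>S\<close> nor \<open>Prim\<close> is empty, so the two conjuncts
    separate.\<close>
  also have "\<dots> \<longleftrightarrow> (\<forall>s \<in> S. ?r s) \<and> (\<forall>x \<in> Prim. ?m x)"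
    using Prim_nonempty S_one by blast
  finally show ?thesis
    unfolding big.property_on_iff_keys[OF P] ring.property_on_iff_keys[OF P] .
qed

end

section \<open>Bounded factorization in the ring\<close>

context splitting
begin

lemma ring_factorization_subset:
  assumes "s \<in> S" "(ss, c) \<in> factorizations R (regular_module R) (carrier R) s"
  shows "set ss \<subseteq> S" "c \<in> S"
proof -
  note f = ring.factorizationsD[OF assms(2)]
  have c: "c \<in> carrier R"
    using f(4) by simp
  have eq: "list_prod R ss \<otimes> c \<in> S"
    using assms(1) f(5) by simp
  show "c \<in> S"
    using saturated'[OF list_prod_closed[OF f(2)] c eq] .
  have prod: "list_prod R ss \<in> S"
    using saturated[OF list_prod_closed[OF f(2)] c eq] .
  show "set ss \<subseteq> S"
  proof
    fix a assume a: "a \<in> set ss"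
    obtain q where q: "q \<in> carrier R" "list_prod R ss = a \<otimes> q"
      using list_prod_mem_factor[OF f(2) a] by blast
    show "a \<in> S"
      using saturated[of a q] a f(2) q(1) prod unfolding q(2) by blast
  qed
qed

text \<open>Refining each nonunit factor shows that every factorization is at most as long as an atomic one.\<close>

lemma atomic_refinement:
  assumes "atomic_on R (regular_module R) (carrier R) S" "set ss \<subseteq> S - Units R" "c \<in> S"
  shows "\<exists>ts d. (ts, d) \<in> atomic_factorizations R (regular_module R) (carrier R) (list_prod R ss \<otimes> c) \<and>
    length ss \<le> length ts"
  using assms(2)
proof (induction ss)
  case Nil
  then show ?case
    using assms(1,3) unfolding atomic_on_def by fastforce
next
  case (Cons a ss)
  let ?AF = "atomic_factorizations R (regular_module R) (carrier R)"
  have a: "a \<in> S" "a \<notin> Units R" and ss: "set ss \<subseteq> S"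
    using Cons.prems by auto
  obtain ts d where ts: "(ts, d) \<in> ?AF (list_prod R ss \<otimes> c)" "length ss \<le> length ts"
    using Cons by auto
  obtain as e where as: "(as, e) \<in> ?AF a"
    using assms(1) a(1) unfolding atomic_on_def by fastforce
  note t1 = ring.atomic_factorizationsD[OF ts(1)]
  note t2 = ring.factorizationsD[OF t1(1)]
  note a1 = ring.atomic_factorizationsD[OF as]
  note a2 = ring.factorizationsD[OF a1(1)]
  have "msim R (regular_module R) (carrier R) \<one> e"
    using a1(3) a2(4) unfolding mprimitive_def by auto
  then obtain k where k: "k \<in> carrier R" "\<one> = k \<otimes> e"
    unfolding msim_def by auto
  have ec: "e \<in> carrier R" "d \<in> carrier R"
    using a2(4) t2(4) by auto
  have e: "e \<in> Units R"
    by (rule Unit_of_mult_one[OF ec(1) k(1) k(2)[symmetric]])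
  \<comment> \<open>Since \<open>a\<close> is a nonunit and \<open>e\<close> a unit, refining
    \<open>a\<close> contributes at least one factor; this is what keeps the length from
    dropping.\<close>
  have "as \<noteq> []"
  proof
    assume "as = []"
    then have "a = e"
      using a2(5) ec by simp
    then show False
      using e a(2) by simp
  qed
  have prods: "list_prod R as \<in> carrier R" "list_prod R ts \<in> carrier R" "list_prod R ss \<in> carrier R"
    using a2(2) t2(2) ss S_carrier by (auto intro!: list_prod_closed)
  have "list_prod R (a # ss) \<otimes> c = a \<otimes> (list_prod R ss \<otimes> c)"
    using a(1) assms(3) prods(3) by (simp add: m_assoc)
  also have "\<dots> = (list_prod R as \<otimes> e) \<otimes> (list_prod R ts \<otimes> d)"
    using a2(5) t2(5) by simp
  also have "\<dots> = (list_prod R as \<otimes> list_prod R ts) \<otimes> (e \<otimes> d)"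
    using prods ec by (simp add: m_ac)
  also have "list_prod R as \<otimes> list_prod R ts = list_prod R (as @ ts)"
    using a2(2) t2(2) by (simp only: list_prod_append)
  finally have eq: "list_prod R (a # ss) \<otimes> c = list_prod R (as @ ts) \<otimes> (e \<otimes> d)" .
  have "mprimitive R (regular_module R) (carrier R) (e \<otimes> d)"
    using ring.mprimitive_unit[OF e t1(3)] by simp
  then have "(as @ ts, e \<otimes> d) \<in> ?AF (list_prod R (a # ss) \<otimes> c)"
    unfolding eq atomic_factorizations_def factorizations_def
    using a1(2) t1(2) a2(2,3) t2(2,3) ec by auto
  moreover have "length (a # ss) \<le> length (as @ ts)"
    using ts(2) \<open>as \<noteq> []\<close> by (cases as) auto
  ultimately show ?case
    by blast
qed

text \<open>Each of the three properties bounds the lengths of the atomic factorizations of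
  \<open>s\<close>, and by refinement the lengths of all factorizations of \<open>s\<close>.\<close>

lemma bounded_of_keyed_property:
  assumes P: "P \<in> {Unique_Fact, Finite_Fact, Half_Factorial}"
    and has: "property_on P R (regular_module R) (carrier R) S"
  shows "bounded_fact_on R (regular_module R) (carrier R) S"
  unfolding bounded_fact_on_def
proof
  fix s assume s: "s \<in> S"
  let ?AF = "atomic_factorizations R (regular_module R) (carrier R) s"
  have atomic: "atomic_on R (regular_module R) (carrier R) S"
    using P has unfolding unique_fact_on_def finite_fact_on_def half_factorial_on_def
    by (auto simp: unique_fact_on_def finite_fact_on_def half_factorial_on_def)
  define K where "K = fact_keys R (regular_module R) (carrier R) s"
  have "P \<in> keyed_properties"
    using P by auto
  then have K: "keys_property P K"
    using has s unfolding ring.property_on_iff_keys[OF \<open>P \<in> keyed_properties\<close>] K_def by blast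
  have "\<exists>N. \<forall>k \<in> K. size (fst k) \<le> N"
  proof -
    \<comment> \<open>Unique factorization is included in the finite case.\<close>
    consider (f) "finite K" | (h) "K \<noteq> {}" "\<forall>k \<in> K. \<forall>l \<in> K. size (fst k) = size (fst l)"
      using P K by fastforce
    then show ?thesis
    proof cases
      case f
      then have "finite ((\<lambda>k. size (fst k)) ` K)"
        by simp
      then show ?thesis
        unfolding finite_nat_set_iff_bounded_le by blast
    next
      case h
      then show ?thesis
        by (metis order_refl)
    qed
  qed
  then obtain N where N: "\<And>k. k \<in> K \<Longrightarrow> size (fst k) \<le> N"
    by blast
  have "length ss \<le> N" if f: "(ss, c) \<in> factorizations R (regular_module R) (carrier R) s" for ss c
  proof -
    note f' = ring.factorizationsD[OF f]
    have "set ss \<subseteq> S - Units R" "c \<in> S"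
      using ring_factorization_subset[OF s f] f'(3) by auto
    then obtain ts d where "(ts, d) \<in> ?AF" "length ss \<le> length ts"
      using atomic_refinement[OF atomic, of ss c] f'(5) by auto
    moreover from this have "size (fst (fact_key R (regular_module R) (carrier R) (ts, d))) \<le> N"
      using N unfolding K_def fact_keys_def by blast
    ultimately show ?thesis
      unfolding fact_key_def by simp
  qed
  then show "\<exists>N. \<forall>(ss, c) \<in> factorizations R (regular_module R) (carrier R) s. length ss \<le> N"
    by blast
qed

lemma presimplifiable_ring: "presimplifiable_on R (regular_module R) (carrier R) S"
  unfolding presimplifiable_on_def
proof (intro ballI impI disjI1)
  fix r s assume r: "r \<in> carrier R" and s: "s \<in> S" and "r \<odot>\<^bsub>regular_module R\<^esub> s = s"
  then have "s \<otimes> r = s \<otimes> \<one>"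
    using m_comm[of r s] by simp
  then have "r = \<one>"
    using cancel_R r s by blast
  then show "r \<in> Units R"
    by simp
qed

end

section \<open>Compact decompositions in \<open>S'\<close> and boundedness of products\<close>

context splitting_pair
begin

lemma compact_decomposition:
  assumes "compactly_atomic R (regular_module R) S (S' - annihilator R M)" "r \<in> S'" "acts r"
  obtains t p where "t \<in> S" "p \<in> S'" "S_free p" "acts p" "r = t \<otimes> p"
proof -
  have r: "r \<in> carrier R"
    using assms(2) by blast
  have "r \<notin> annihilator R M"
    using assms(3) unfolding acts_def annihilator_def by blast
  moreover have "r \<noteq> \<zero>"
    using assms(3) zero_act unfolding acts_def by blast
  ultimately have "compact_factorizations R (regular_module R) S r \<noteq> {}"
    using assms(1,2) unfolding compactly_atomic_def by simp
  then obtain t p where t: "t \<in> S" "mprimitive R (regular_module R) S p" "r = t \<otimes> p"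
    unfolding compact_factorizations_def by auto
  have p: "p \<in> carrier R"
    using t(2) unfolding mprimitive_def by simp
  have acts: "acts p"
    using acts_mult(2)[of t p] assms(3) p t(1) unfolding t(3) by blast
  show ?thesis
  proof (rule that)
    show "p \<in> S'"
      using saturated_S'2[of t p] assms(2) p t(1) unfolding t(3) by blast
    show "S_free p"
      using S_free_of_mprimitive t(2) acts by blast
  qed (use t acts in auto)
qed

text \<open>Pick a primitive \<open>x\<close> with \<open>r x\<close> nonzero and let
  \<open>s\<close> be the \<open>S\<close>-part of \<open>r x\<close>. Any nonunits of
  \<open>S\<close> whose product divides \<open>r\<close> also form a factorization of
  \<open>s\<close>, so their number is bounded. When it is maximal, the cofactor is
  \<open>S\<close>-free.\<close>

lemma compactly_atomic_of_bounded:
  assumes bounded: "bounded_fact_on R (regular_module R) (carrier R) S"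
  shows "compactly_atomic R (regular_module R) S (S' - annihilator R M)"
  unfolding compactly_atomic_def
proof
  fix r assume "r \<in> S' - annihilator R M - {\<zero>\<^bsub>regular_module R\<^esub>}"
  then have r: "r \<in> carrier R" "acts r"
    unfolding annihilator_def acts_def by auto
  obtain x where x: "x \<in> Prim" "r \<odot>\<^bsub>M\<^esub> x \<noteq> \<zero>\<^bsub>M\<^esub>"
    using acts_Prim r by blast
  have xc: "x \<in> carrier M"
    using x Prim_closed by blast
  obtain s y where s: "s \<in> S" "y \<in> Prim" "r \<odot>\<^bsub>M\<^esub> x = s \<odot>\<^bsub>M\<^esub> y"
    using Prim_decomposition[of "r \<odot>\<^bsub>M\<^esub> x"] r x xc by blast
  obtain N where N: "\<And>ss c. (ss, c) \<in> factorizations R (regular_module R) (carrier R) s \<Longrightarrow> length ss \<le> N"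
    using bounded s(1) unfolding bounded_fact_on_def by blast
  \<comment> \<open>The lists of nonunits of \<open>S\<close> that can be split off from
    \<open>r\<close>.\<close>
  define Q where "Q ss \<longleftrightarrow> set ss \<subseteq> S - Units R \<and> (\<exists>q \<in> carrier R. r = list_prod R ss \<otimes> q)" for ss
  have bound: "length ss \<le> N" if Q: "Q ss" for ss
  proof -
    obtain q where ss: "set ss \<subseteq> S - Units R" and q: "q \<in> carrier R" "r = list_prod R ss \<otimes> q"
      using Q unfolding Q_def by blast
    have p: "list_prod R ss \<in> S"
      using ss by (intro list_prod_S) blast
    have rx: "r \<odot>\<^bsub>M\<^esub> x = list_prod R ss \<odot>\<^bsub>M\<^esub> (q \<odot>\<^bsub>M\<^esub> x)"
      unfolding q(2) using p q(1) xc by (simp add: act_mult)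
    have "q \<odot>\<^bsub>M\<^esub> x \<noteq> \<zero>\<^bsub>M\<^esub>"
      using x(2) p unfolding rx by auto
    then obtain t z where t: "t \<in> S" "z \<in> Prim" "q \<odot>\<^bsub>M\<^esub> x = t \<odot>\<^bsub>M\<^esub> z"
      using Prim_decomposition[of "q \<odot>\<^bsub>M\<^esub> x"] q(1) xc by blast
    have zc: "z \<in> carrier M"
      using t(2) Prim_closed by blast
    have "s \<odot>\<^bsub>M\<^esub> y = (list_prod R ss \<otimes> t) \<odot>\<^bsub>M\<^esub> z"
      unfolding s(3)[symmetric] rx t(3) using p t(1) zc by (simp add: act_mult)
    then obtain u where u: "u \<in> Units R" "s = u \<otimes> (list_prod R ss \<otimes> t)"
      using Prim_unique[OF s(1) S_mult[OF p t(1)] s(2) t(2)] by blast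
    have "u \<otimes> (list_prod R ss \<otimes> t) = list_prod R ss \<otimes> (u \<otimes> t)"
      using u(1) p t(1) by (simp add: m_lcomm)
    with u(2) have "s = list_prod R ss \<otimes> (u \<otimes> t)"
      by simp
    moreover have "u \<otimes> t \<in> carrier R"
      using u(1) t(1) by auto
    ultimately have "(ss, u \<otimes> t) \<in> factorizations R (regular_module R) (carrier R) s"
      unfolding factorizations_def using ss by auto
    then show ?thesis
      by (rule N)
  qed
  have "Q []"
    unfolding Q_def using r(1) by auto
  \<comment> \<open>\<open>Suc N\<close> turns the bound into a strict one.\<close>
  then obtain ss where Q: "Q ss" and max: "\<And>ts. Q ts \<Longrightarrow> length ts \<le> length ss"
    using ex_has_greatest_nat[of Q "[]" length "Suc N"] bound le_imp_less_Suc by blast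
  obtain q where ss: "set ss \<subseteq> S - Units R" and q: "q \<in> carrier R" "r = list_prod R ss \<otimes> q"
    using Q unfolding Q_def by blast
  have ssc: "set ss \<subseteq> carrier R"
    using ss by blast
  have "S_free q"
    unfolding S_free_def
  proof (intro conjI ballI impI)
    fix t q' assume t: "t \<in> S" "q' \<in> carrier R" "q = t \<otimes> q'"
    show "t \<in> Units R"
    proof (rule ccontr)
      assume "t \<notin> Units R"
      moreover have "r = list_prod R (ss @ [t]) \<otimes> q'"
      proof -
        have "list_prod R (ss @ [t]) = list_prod R ss \<otimes> t"
          using list_prod_append[of ss "[t]"] ssc t(1) by simp
        then show ?thesis
          unfolding q(2) t(3) using ssc t(1,2) by (simp add: m_assoc)
      qed
      ultimately have "Q (ss @ [t])"
        unfolding Q_def using ss t(1,2) by auto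
      then show False
        using max by fastforce
    qed
  qed (rule q(1))
  then have "(list_prod R ss, q) \<in> compact_factorizations R (regular_module R) S r"
    unfolding compact_factorizations_def using S_free_mprimitive list_prod_S[of ss] ss q(2) by auto
  then show "compact_factorizations R (regular_module R) S r \<noteq> {}"
    by blast
qed

text \<open>A factor \<open>a = t p\<close> need be neither in \<open>S\<close> nor
  \<open>S\<close>-free, so filtering the list as in the atomic case is impossible. As
  \<open>a\<close> is a nonunit, one of \<open>t\<close> and \<open>p\<close> is a nonunit and is
  kept as a factor, while a unit is moved into \<open>u\<close>; hence the length does not
  decrease.\<close>

lemma list_split:
  assumes compact: "compactly_atomic R (regular_module R) S (S' - annihilator R M)"
    and "set ss \<subseteq> S' - Units R" "acts (list_prod R ss)"
  shows "\<exists>ts ps u. set ts \<subseteq> S - Units R \<and> set ps \<subseteq> S' - Units R \<and> (\<forall>p \<in> set ps. S_free p) \<and>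
    u \<in> Units R \<and> list_prod R ss = u \<otimes> (list_prod R ts \<otimes> list_prod R ps) \<and>
    length ss \<le> length ts + length ps"
  using assms(2,3)
proof (induction ss)
  case Nil
  show ?case
    by (rule exI[of _ "[]"], rule exI[of _ "[]"], rule exI[of _ \<one>]) simp
next
  case (Cons a ss)
  have a: "a \<in> S'" "a \<notin> Units R" "a \<in> carrier R" and ss: "set ss \<subseteq> S' - Units R" "set ss \<subseteq> carrier R"
    using Cons.prems(1) by auto
  have acts: "acts a" "acts (list_prod R ss)"
    using acts_mult[of a "list_prod R ss"] Cons.prems(2) a(3) ss(2) by auto
  obtain ts ps u where IH: "set ts \<subseteq> S - Units R" "set ps \<subseteq> S' - Units R" "\<forall>p \<in> set ps. S_free p"
    "u \<in> Units R" "list_prod R ss = u \<otimes> (list_prod R ts \<otimes> list_prod R ps)"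
    "length ss \<le> length ts + length ps"
    using Cons.IH[OF ss(1) acts(2)] by blast
  obtain t p where tp: "t \<in> S" "p \<in> S'" "S_free p" "a = t \<otimes> p"
    using compact_decomposition[OF compact a(1) acts(1)] by blast
  have c: "list_prod R ts \<in> carrier R" "list_prod R ps \<in> carrier R" "u \<in> carrier R"
    "t \<in> carrier R" "p \<in> carrier R"
    using IH(1,2,4) tp(1,2) by auto
  have eq: "list_prod R (a # ss) = (t \<otimes> p) \<otimes> (u \<otimes> (list_prod R ts \<otimes> list_prod R ps))"
    using IH(5) tp(4) by simp
  consider (t) "t \<in> Units R" "p \<notin> Units R" | (p) "p \<in> Units R" "t \<notin> Units R"
    | (none) "t \<notin> Units R" "p \<notin> Units R"
    using a(2) tp(4) Units_m_closed by blast
  then show ?case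
  proof cases
    case t
    have "list_prod R (a # ss) = (t \<otimes> u) \<otimes> (list_prod R ts \<otimes> list_prod R (p # ps))"
      unfolding eq using c by (simp add: m_ac)
    moreover have "t \<otimes> u \<in> Units R"
      using t IH(4) by blast
    moreover have "length (a # ss) \<le> length ts + length (p # ps)"
      using IH(6) by simp
    moreover have "set (p # ps) \<subseteq> S' - Units R" "\<forall>q \<in> set (p # ps). S_free q"
      using t tp(2,3) IH(2,3) by auto
    ultimately show ?thesis
      using IH(1) by blast
  next
    case p
    have "list_prod R (a # ss) = (p \<otimes> u) \<otimes> (list_prod R (t # ts) \<otimes> list_prod R ps)"
      unfolding eq using c by (simp add: m_ac)
    moreover have "p \<otimes> u \<in> Units R"
      using p IH(4) by blast
    moreover have "length (a # ss) \<le> length (t # ts) + length ps"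
      using IH(6) by simp
    moreover have "set (t # ts) \<subseteq> S - Units R"
      using p tp(1) IH(1) by auto
    ultimately show ?thesis
      using IH(2,3) by blast
  next
    case none
    have "list_prod R (a # ss) = u \<otimes> (list_prod R (t # ts) \<otimes> list_prod R (p # ps))"
      unfolding eq using c by (simp add: m_ac)
    moreover have "length (a # ss) \<le> length (t # ts) + length (p # ps)"
      using IH(6) by simp
    moreover have "set (t # ts) \<subseteq> S - Units R"
      using none tp(1) IH(1) by auto
    moreover have "set (p # ps) \<subseteq> S' - Units R" "\<forall>q \<in> set (p # ps). S_free q"
      using none tp(2,3) IH(2,3) by auto
    ultimately show ?thesis
      using IH(4) by blast
  qed
qed

text \<open>Letting a factorization of \<open>s\<close> act on a fixed primitive \<open>x\<close>
  turns it into a factorization of \<open>s x\<close> of the same length.\<close>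

lemma bounded_ring_of_bounded:
  assumes "bounded_fact_on R M S' (carrier M - {\<zero>\<^bsub>M\<^esub>})"
  shows "bounded_fact_on R (regular_module R) (carrier R) S"
  unfolding bounded_fact_on_def
proof
  fix s assume s: "s \<in> S"
  obtain x where x: "x \<in> Prim"
    using Prim_nonempty by blast
  have xc: "x \<in> carrier M"
    using x Prim_closed by blast
  have "s \<odot>\<^bsub>M\<^esub> x \<in> carrier M - {\<zero>\<^bsub>M\<^esub>}"
    using s x unfolding nonzero_iff_product by blast
  then obtain N where N: "\<And>ss n. (ss, n) \<in> factorizations R M S' (s \<odot>\<^bsub>M\<^esub> x) \<Longrightarrow> length ss \<le> N"
    using assms unfolding bounded_fact_on_def by blast
  have "length ss \<le> N" if f: "(ss, c) \<in> factorizations R (regular_module R) (carrier R) s" for ss c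
  proof -
    note f' = ring.factorizationsD[OF f]
    note sub = ring_factorization_subset[OF s f]
    have "s \<odot>\<^bsub>M\<^esub> x = (list_prod R ss \<otimes> c) \<odot>\<^bsub>M\<^esub> x"
      using f'(5) by simp
    also have "\<dots> = list_prod R ss \<odot>\<^bsub>M\<^esub> (c \<odot>\<^bsub>M\<^esub> x)"
      using f'(2) sub(2) xc by (simp add: act_mult)
    finally have "(ss, c \<odot>\<^bsub>M\<^esub> x) \<in> factorizations R M S' (s \<odot>\<^bsub>M\<^esub> x)"
      using sub f'(3) S_subset xc unfolding factorizations_def by auto
    then show ?thesis
      by (rule N)
  qed
  then show "\<exists>N. \<forall>(ss, c) \<in> factorizations R (regular_module R) (carrier R) s. length ss \<le> N"
    by blast
qed

text \<open>By \<open>list_split\<close>, a factorization of \<open>s x\<close> is at most as long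
  as a list of nonunits of \<open>S\<close> together with a list of \<open>S\<close>-free nonunits.
  Uniqueness of the \<open>S\<close>-part makes the former a factorization of \<open>s\<close> and
  the latter one of \<open>x\<close>, up to units, which yields the bound
  \<open>N1 + N2\<close>.\<close>

lemma bounded_product:
  assumes compact: "compactly_atomic R (regular_module R) S (S' - annihilator R M)"
    and ring_bounded: "bounded_fact_on R (regular_module R) (carrier R) S"
    and Prim_bounded: "bounded_fact_on R M S' Prim"
  shows "bounded_fact_on R M S' (carrier M - {\<zero>\<^bsub>M\<^esub>})"
  unfolding bounded_fact_on_def
proof
  fix m assume m: "m \<in> carrier M - {\<zero>\<^bsub>M\<^esub>}"
  then obtain s x where s: "s \<in> S" and x: "x \<in> Prim" and msx: "m = s \<odot>\<^bsub>M\<^esub> x"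
    unfolding nonzero_iff_product by blast
  have xc: "x \<in> carrier M"
    using x Prim_closed by blast
  obtain N1 where N1:
    "\<And>ss c. (ss, c) \<in> factorizations R (regular_module R) (carrier R) s \<Longrightarrow> length ss \<le> N1"
    using ring_bounded s unfolding bounded_fact_on_def by blast
  obtain N2 where N2: "\<And>ss n. (ss, n) \<in> factorizations R M S' x \<Longrightarrow> length ss \<le> N2"
    using Prim_bounded x unfolding bounded_fact_on_def by blast
  have "length ss \<le> N1 + N2" if f: "(ss, n) \<in> factorizations R M S' m" for ss n
  proof -
    note f' = big.factorizationsD[OF f]
    have ne: "list_prod R ss \<odot>\<^bsub>M\<^esub> n \<noteq> \<zero>\<^bsub>M\<^esub>"
      using m f'(5) by simp
    then have "acts (list_prod R ss)"
      unfolding acts_def using f'(4) by blast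
    moreover have "set ss \<subseteq> S' - Units R"
      using f'(1,3) by blast
    ultimately obtain ts ps u where split: "set ts \<subseteq> S - Units R" "set ps \<subseteq> S' - Units R"
      "\<forall>p \<in> set ps. S_free p" "u \<in> Units R" "list_prod R ss = u \<otimes> (list_prod R ts \<otimes> list_prod R ps)"
      "length ss \<le> length ts + length ps"
      using list_split[OF compact] by blast
    have "n \<noteq> \<zero>\<^bsub>M\<^esub>"
      using ne f'(2) by auto
    then obtain t y where t: "t \<in> S" "y \<in> Prim" "n = t \<odot>\<^bsub>M\<^esub> y"
      using Prim_decomposition[of n] f'(4) by blast
    have yc: "y \<in> carrier M"
      using t(2) Prim_closed by blast
    have tsS: "list_prod R ts \<in> S"
      using split(1) by (intro list_prod_S) blast
    have c: "u \<in> carrier R" "list_prod R ps \<in> carrier R"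
      using split(2,4) by auto
    have "m = (u \<otimes> (list_prod R ts \<otimes> list_prod R ps)) \<odot>\<^bsub>M\<^esub> (t \<odot>\<^bsub>M\<^esub> y)"
      using f'(5) split(5) t(3) by simp
    also have "\<dots> = (u \<otimes> (list_prod R ts \<otimes> t)) \<odot>\<^bsub>M\<^esub> (list_prod R ps \<odot>\<^bsub>M\<^esub> y)"
      using c tsS t(1) yc by (simp add: act_mult act_left_commute)
    \<comment> \<open>Everything from \<open>S\<close>, including the \<open>S\<close>-part
      \<open>t\<close> of the last entry, is now collected in front of a primitive element.\<close>
    finally have eq: "s \<odot>\<^bsub>M\<^esub> x = (u \<otimes> (list_prod R ts \<otimes> t)) \<odot>\<^bsub>M\<^esub> (list_prod R ps \<odot>\<^bsub>M\<^esub> y)"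
      unfolding msx .
    have ne': "list_prod R ps \<odot>\<^bsub>M\<^esub> y \<noteq> \<zero>\<^bsub>M\<^esub>"
    proof
      assume "list_prod R ps \<odot>\<^bsub>M\<^esub> y = \<zero>\<^bsub>M\<^esub>"
      then have "m = \<zero>\<^bsub>M\<^esub>"
        using eq c tsS t(1) unfolding msx by simp
      then show False
        using m by simp
    qed
    have z: "list_prod R ps \<odot>\<^bsub>M\<^esub> y \<in> Prim"
      using list_prod_Prim[OF _ t(2) ne'] split(3) by blast
    have utS: "u \<otimes> (list_prod R ts \<otimes> t) \<in> S"
      using split(4) tsS t(1) by simp
    obtain v where v: "v \<in> Units R" "s = v \<otimes> (u \<otimes> (list_prod R ts \<otimes> t))"
      "list_prod R ps \<odot>\<^bsub>M\<^esub> y = v \<odot>\<^bsub>M\<^esub> x"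
      using Prim_unique[OF s utS x z eq] by blast
    have vc: "v \<in> carrier R" "inv v \<in> carrier R"
      using v(1) by auto
    have "v \<otimes> (u \<otimes> (list_prod R ts \<otimes> t)) = list_prod R ts \<otimes> (v \<otimes> (u \<otimes> t))"
      using vc(1) c tsS t(1) by (simp add: m_ac)
    then have "(ts, v \<otimes> (u \<otimes> t)) \<in> factorizations R (regular_module R) (carrier R) s"
      using split(1) vc(1) c(1) t(1) v(2) unfolding factorizations_def by auto
    then have "length ts \<le> N1"
      by (rule N1)
    moreover have "x = list_prod R ps \<odot>\<^bsub>M\<^esub> (inv v \<odot>\<^bsub>M\<^esub> y)"
    proof -
      have "x = inv v \<odot>\<^bsub>M\<^esub> (list_prod R ps \<odot>\<^bsub>M\<^esub> y)"
        unfolding v(3) using v(1) xc by simp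
      then show ?thesis
        using vc c yc by (simp add: act_left_commute)
    qed
    then have "(ps, inv v \<odot>\<^bsub>M\<^esub> y) \<in> factorizations R M S' x"
      using split(2) vc yc unfolding factorizations_def by blast
    then have "length ps \<le> N2"
      by (rule N2)
    ultimately show ?thesis
      using split(6) by simp
  qed
  then show "\<exists>N. \<forall>(ss, n) \<in> factorizations R M S' m. length ss \<le> N"
    by blast
qed

text \<open>The \<open>S\<close>-part of \<open>m\<close> commutes with \<open>r\<close> and
  cancels, so \<open>r\<close> fixes \<open>m\<close> only if it fixes the primitive part.\<close>

lemma presimplifiable_product:
  "presimplifiable_on R M S' (carrier M - {\<zero>\<^bsub>M\<^esub>}) \<longleftrightarrow> presimplifiable_on R M S' Prim"
proof
  assume "presimplifiable_on R M S' (carrier M - {\<zero>\<^bsub>M\<^esub>})"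
  then show "presimplifiable_on R M S' Prim"
    unfolding presimplifiable_on_def using Prim_closed by blast
next
  assume Prim: "presimplifiable_on R M S' Prim"
  show "presimplifiable_on R M S' (carrier M - {\<zero>\<^bsub>M\<^esub>})"
    unfolding presimplifiable_on_def
  proof (intro ballI impI disjI1)
    fix r m assume r: "r \<in> S'" and m: "m \<in> carrier M - {\<zero>\<^bsub>M\<^esub>}" and eq: "r \<odot>\<^bsub>M\<^esub> m = m"
    obtain s x where s: "s \<in> S" and x: "x \<in> Prim" and msx: "m = s \<odot>\<^bsub>M\<^esub> x"
      using m unfolding nonzero_iff_product by blast
    have xc: "x \<in> carrier M"
      using x Prim_closed by blast
    have "s \<odot>\<^bsub>M\<^esub> (r \<odot>\<^bsub>M\<^esub> x) = s \<odot>\<^bsub>M\<^esub> x"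
      using eq act_left_commute[of s r x] s r xc unfolding msx by auto
    then have "r \<odot>\<^bsub>M\<^esub> x = x"
      using cancel_M[OF s _ xc] r xc by blast
    then show "r \<in> Units R"
      using Prim r x unfolding presimplifiable_on_def by blast
  qed
qed

end

section \<open>The case \<open>S' = S\<close>\<close>

context splitting
begin

lemma splitting_pair_self: "splitting_pair R M S S"
  by (intro splitting_pair.intro splitting_axioms splitting_pair_axioms.intro)
    (auto simp: submonoid_S intro: saturated)

text \<open>Primitive elements have only trivial \<open>S\<close>-factorizations.\<close>

lemma property_on_Prim: "property_on P R M S Prim"
proof -
  interpret self: splitting_pair R M S S
    by (rule splitting_pair_self)
  have fact: "factorizations R M S x = {([], x)}" if x: "x \<in> Prim" for x
  proof (intro equalityI subsetI)
    fix f assume f: "f \<in> factorizations R M S x"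
    obtain ss n where f_eq: "f = (ss, n)"
      by fastforce
    have f'': "(ss, n) \<in> factorizations R M S x"
      using f unfolding f_eq .
    note f' = factorizationsD[OF f'']
    have "a \<notin> set ss" for a
      using self.Prim_list_prod_not_S[OF x f'', of a] f'(1) by blast
    then have "ss = []"
      by (cases ss) auto
    then show "f \<in> {([], x)}"
      using f'(4,5) unfolding f_eq by simp
  next
    fix f :: "'a list \<times> 'b" assume "f \<in> {([], x)}"
    then show "f \<in> factorizations R M S x"
      unfolding factorizations_def using x Prim_closed[OF x] by simp
  qed
  have atomic: "atomic_factorizations R M S x = {([], x)}" if x: "x \<in> Prim" for x
    unfolding atomic_factorizations_def fact[OF x] using x by auto
  have keys: "keys_property P (fact_keys R M S x)" if x: "x \<in> Prim" for x
    unfolding fact_keys_def atomic[OF x] by (cases P) auto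
  consider "P \<in> keyed_properties" | "P = Bounded_Fact" | "P = Presimplifiable"
    by (cases P) auto
  then show ?thesis
  proof cases
    case 1
    then show ?thesis
      using keys property_on_iff_keys by blast
  next
    case 2
    then show ?thesis
      unfolding 2 property_on.simps bounded_fact_on_def using fact by auto
  next
    case 3
    have "s \<in> Units R" if "s \<in> S" "x \<in> Prim" "s \<odot>\<^bsub>M\<^esub> x = x" for s x
      using Prim_Unit[OF that(2,1) Prim_closed[OF that(2)] that(3)[symmetric]] .
    then show ?thesis
      unfolding 3 property_on.simps presimplifiable_on_def by blast
  qed
qed

end

section \<open>Factorizations in the localization\<close>

lemma list_all2_memD: "list_all2 P xs ys \<Longrightarrow> y \<in> set ys \<Longrightarrow> \<exists>x \<in> set xs. P x y"
  by (induction rule: list_all2_induct) auto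

context splitting_pair
begin

abbreviation "T \<equiv> loc_set R S S'"
abbreviation "i a \<equiv> rfrac a \<one>"
abbreviation "j m \<equiv> mfrac m \<one>"

sublocale loc: factor_action RS MS T
  by (rule RS_factor_action[OF submonoid_S' S_subset])

lemma T_cases:
  assumes "f \<in> T"
  obtains a s where "a \<in> S'" "s \<in> S" "f = rfrac a s"
  using assms unfolding loc_set_def by blast

lemma i_closed [intro]: "a \<in> carrier R \<Longrightarrow> i a \<in> carrier RS"
  and j_closed [intro]: "m \<in> carrier M \<Longrightarrow> j m \<in> carrier MS"
  by simp_all

lemma i_T: "r \<in> S' \<Longrightarrow> i r \<in> T"
  unfolding loc_set_def using S_one by blast

lemma i_act_j: "r \<in> carrier R \<Longrightarrow> m \<in> carrier M \<Longrightarrow> i r \<odot>\<^bsub>MS\<^esub> j m = j (r \<odot>\<^bsub>M\<^esub> m)"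
  by simp

lemma rfrac_act_j:
  "r \<in> carrier R \<Longrightarrow> s \<in> S \<Longrightarrow> m \<in> carrier M \<Longrightarrow> rfrac r s \<odot>\<^bsub>MS\<^esub> j m = mfrac (r \<odot>\<^bsub>M\<^esub> m) s"
  by simp

lemma MS_zero: "\<zero>\<^bsub>MS\<^esub> = j \<zero>\<^bsub>M\<^esub>"
  by (simp add: loc_module_def)

lemma mfrac_eq_zero_iff:
  assumes "m \<in> carrier M" "s \<in> S"
  shows "mfrac m s = \<zero>\<^bsub>MS\<^esub> \<longleftrightarrow> m = \<zero>\<^bsub>M\<^esub>"
  unfolding MS_zero using assms by (simp add: mfrac_eq_iff)

text \<open>The \<open>S\<close>-part of the numerator and the denominator together form a unit of
  \<open>RS\<close>.\<close>

lemma MS_Prim_decomposition: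
  assumes "y \<in> carrier MS" "y \<noteq> \<zero>\<^bsub>MS\<^esub>"
  obtains w x where "w \<in> Units RS" "x \<in> Prim" "y = w \<odot>\<^bsub>MS\<^esub> j x"
proof -
  obtain m t where m: "m \<in> carrier M" "t \<in> S" "y = mfrac m t"
    using assms(1) by (rule MS_cases)
  then have "m \<noteq> \<zero>\<^bsub>M\<^esub>"
    using assms(2) mfrac_eq_zero_iff by blast
  then obtain s x where s: "s \<in> S" "x \<in> Prim" "m = s \<odot>\<^bsub>M\<^esub> x"
    using Prim_decomposition m(1) by blast
  have "y = rfrac s t \<odot>\<^bsub>MS\<^esub> j x"
    using rfrac_act_j[of s t x] s m(2,3) Prim_closed[OF s(2)] by simp
  moreover have "rfrac s t \<in> Units RS"
    using rfrac_Units_iff s(1) m(2) by blast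
  ultimately show ?thesis
    using that s(2) by blast
qed

text \<open>A unit of \<open>RS\<close> is a quotient of elements of \<open>S\<close>; cross
  multiplication gives two compact decompositions of one element, and uniqueness turns the quotient
  into a unit of \<open>R\<close>.\<close>

lemma Unit_act_j_eq:
  assumes "w \<in> Units RS" "x \<in> Prim" "x' \<in> Prim" "j x' = w \<odot>\<^bsub>MS\<^esub> j x"
  obtains u where "u \<in> Units R" "x' = u \<odot>\<^bsub>M\<^esub> x"
proof -
  obtain a s where a: "a \<in> carrier R" "s \<in> S" "w = rfrac a s"
    using RS_cases[of w] loc.Units_closed[OF assms(1)] by blast
  have aS: "a \<in> S"
    using assms(1) rfrac_Units_iff a by blast
  have c: "x \<in> carrier M" "x' \<in> carrier M"
    using assms(2,3) Prim_closed by auto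
  have "j x' = mfrac (a \<odot>\<^bsub>M\<^esub> x) s"
    using assms(4) a c by simp
  then have "a \<odot>\<^bsub>M\<^esub> x = s \<odot>\<^bsub>M\<^esub> x'"
    using a c by (simp add: mfrac_eq_iff)
  then show ?thesis
    using that Prim_unique[OF aS a(2) assms(2,3)] by blast
qed

lemma rsim_i:
  assumes "rsim R a b" "a \<in> carrier R" "b \<in> carrier R"
  shows "rsim RS (i a) (i b)"
proof -
  obtain c d where cd: "c \<in> carrier R" "d \<in> carrier R" "a = c \<otimes> b" "b = d \<otimes> a"
    using assms(1) unfolding rsim_def msim_def regular_module_simps by blast
  have "i c \<otimes>\<^bsub>RS\<^esub> i b = i (c \<otimes> b)" "i d \<otimes>\<^bsub>RS\<^esub> i a = i (d \<otimes> a)"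
    using cd(1,2) assms(2,3) by simp_all
  then have "i a = i c \<otimes>\<^bsub>RS\<^esub> i b" "i b = i d \<otimes>\<^bsub>RS\<^esub> i a"
    unfolding cd(3)[symmetric] cd(4)[symmetric] by simp_all
  then show ?thesis
    unfolding rsim_def msim_def regular_module_simps using cd(1,2) rfrac_closed S_one by blast
qed

lemma S_mult_acts:
  assumes "acts a" "s \<in> S" "a \<in> carrier R"
  shows "acts (s \<otimes> a)"
proof -
  obtain m where m: "m \<in> carrier M" "a \<odot>\<^bsub>M\<^esub> m \<noteq> \<zero>\<^bsub>M\<^esub>"
    using assms(1) unfolding acts_def by blast
  then have "(s \<otimes> a) \<odot>\<^bsub>M\<^esub> m \<noteq> \<zero>\<^bsub>M\<^esub>"
    using S_act_nonzero[of s "a \<odot>\<^bsub>M\<^esub> m"] assms by (simp add: act_mult)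
  then show ?thesis
    unfolding acts_def using m by blast
qed

text \<open>In this form the product \<open>p q\<close> satisfies the premise on \<open>q\<close> in
  \<open>S_free_unique\<close>.\<close>

lemma S_free_mult_act:
  assumes "S_free p" "S_free q" "x \<in> Prim" "(p \<otimes> q) \<odot>\<^bsub>M\<^esub> x \<noteq> \<zero>\<^bsub>M\<^esub>"
  shows "(p \<otimes> q) \<odot>\<^bsub>M\<^esub> x \<in> Prim"
proof -
  have c: "p \<in> carrier R" "q \<in> carrier R" "x \<in> carrier M"
    using assms S_free_closed Prim_closed by auto
  have eq: "(p \<otimes> q) \<odot>\<^bsub>M\<^esub> x = p \<odot>\<^bsub>M\<^esub> (q \<odot>\<^bsub>M\<^esub> x)"
    using c by (rule act_mult)
  have "q \<odot>\<^bsub>M\<^esub> x \<noteq> \<zero>\<^bsub>M\<^esub>"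
    using assms(4) c unfolding eq by auto
  then show ?thesis
    using assms(4) S_free_act[OF assms(1) S_free_act[OF assms(2,3)]] unfolding eq by blast
qed

lemma list_prod_i:
  "set ss \<subseteq> carrier R \<Longrightarrow> list_prod RS (map (\<lambda>a. i a) ss) = i (list_prod R ss)"
  by (induction ss) (simp_all add: RS_one)

end

text \<open>Clearing denominators requires the numerators in \<open>S'\<close> to split into an
  \<open>S\<close>-part and an \<open>S\<close>-free part; the splitting of \<open>M\<close>
  provides this for elements of \<open>M\<close>, and \<open>compact\<close> for scalars.\<close>

locale compact_splitting_pair = splitting_pair R M S S'
  for R :: "('a, 'c) ring_scheme" (structure) and M :: "('a, 'b, 'd) module_scheme" and S S' +
  assumes compact: "compactly_atomic R (regular_module R) S (S' - annihilator R M)"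
begin

text \<open>Clearing denominators in \<open>x / 1 = f z\<close> leaves an equation in \<open>M\<close> up to units.\<close>

lemma frac_step:
  assumes x: "x \<in> Prim" and f: "f \<in> T" and z: "z \<in> carrier MS" and eq: "j x = f \<odot>\<^bsub>MS\<^esub> z"
  obtains p x' u v w where "p \<in> S'" "S_free p" "x' \<in> Prim" "u \<in> Units R" "v \<in> Units RS"
    "w \<in> Units RS" "f = v \<otimes>\<^bsub>RS\<^esub> i p" "z = w \<odot>\<^bsub>MS\<^esub> j x'" "x = u \<odot>\<^bsub>M\<^esub> (p \<odot>\<^bsub>M\<^esub> x')"
proof -
  obtain a s where a: "a \<in> S'" "s \<in> S" "f = rfrac a s"
    using f by (rule T_cases)
  obtain m r where m: "m \<in> carrier M" "r \<in> S" "z = mfrac m r"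
    using z by (rule MS_cases)
  have c: "x \<in> carrier M" "a \<in> carrier R" "s \<in> carrier R" "r \<in> carrier R"
    using Prim_closed[OF x] a m by auto
  have "j x = mfrac (a \<odot>\<^bsub>M\<^esub> m) (s \<otimes> r)"
    using eq a m c by simp
  then have eq1: "(s \<otimes> r) \<odot>\<^bsub>M\<^esub> x = a \<odot>\<^bsub>M\<^esub> m"
    using a m c by (simp add: mfrac_eq_iff)
  have ne: "a \<odot>\<^bsub>M\<^esub> m \<noteq> \<zero>\<^bsub>M\<^esub>"
    unfolding eq1[symmetric] using S_act_nonzero[of "s \<otimes> r" x] a(2) m(2) c x by auto
  then have "acts a"
    unfolding acts_def using m(1) by blast
  then obtain t p where p: "t \<in> S" "p \<in> S'" "S_free p" "a = t \<otimes> p"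
    using compact_decomposition[OF compact a(1)] by blast
  have "m \<noteq> \<zero>\<^bsub>M\<^esub>"
    using ne c by auto
  then obtain t' x' where x': "t' \<in> S" "x' \<in> Prim" "m = t' \<odot>\<^bsub>M\<^esub> x'"
    using Prim_decomposition m(1) by blast
  have c': "t \<in> carrier R" "p \<in> carrier R" "t' \<in> carrier R" "x' \<in> carrier M"
    using p x' Prim_closed[OF x'(2)] by auto
  \<comment> \<open>Each side is an element of \<open>S\<close> acting on an element without
    \<open>S\<close>-part; uniqueness will identify \<open>p x'\<close> with \<open>x\<close> up to
    a unit.\<close>
  have eq2: "(s \<otimes> r) \<odot>\<^bsub>M\<^esub> x = (t \<otimes> t') \<odot>\<^bsub>M\<^esub> (p \<odot>\<^bsub>M\<^esub> x')"
    unfolding eq1 p(4) x'(3) using c' by (simp add: act_mult act_left_commute)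
  have "p \<odot>\<^bsub>M\<^esub> x' \<noteq> \<zero>\<^bsub>M\<^esub>"
  proof
    assume "p \<odot>\<^bsub>M\<^esub> x' = \<zero>\<^bsub>M\<^esub>"
    then show False
      using ne eq1 eq2 c' by simp
  qed
  then have "p \<odot>\<^bsub>M\<^esub> x' \<in> Prim"
    using S_free_act[OF p(3) x'(2)] by blast
  then obtain u where u: "u \<in> Units R" "p \<odot>\<^bsub>M\<^esub> x' = u \<odot>\<^bsub>M\<^esub> x"
    using Prim_unique[OF _ _ x _ eq2] a(2) m(2) p(1) x'(1) by auto
  have "x = inv u \<odot>\<^bsub>M\<^esub> (p \<odot>\<^bsub>M\<^esub> x')"
    unfolding u(2) using u(1) c by simp
  moreover have "f = rfrac t s \<otimes>\<^bsub>RS\<^esub> i p"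
    using a(2,3) p c' by simp
  moreover have "z = rfrac t' r \<odot>\<^bsub>MS\<^esub> j x'"
    using m(2,3) x' c' by simp
  moreover have "rfrac t s \<in> Units RS" "rfrac t' r \<in> Units RS" "inv u \<in> Units R"
    using rfrac_Units_iff a(2) m(2) p(1) x'(1) u(1) by auto
  ultimately show ?thesis
    using that p(2,3) x'(2) by blast
qed

lemma act_of_j_act:
  assumes "x \<in> Prim" "y \<in> Prim" "f \<in> T" "j x = f \<odot>\<^bsub>MS\<^esub> j y"
  shows "\<exists>r \<in> S'. x = r \<odot>\<^bsub>M\<^esub> y"
proof -
  have yc: "y \<in> carrier M"
    using Prim_closed assms(2) by blast
  obtain p x' u v w where p: "p \<in> S'" "S_free p" "x' \<in> Prim" "u \<in> Units R" "v \<in> Units RS"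
    "w \<in> Units RS" "f = v \<otimes>\<^bsub>RS\<^esub> i p" "j y = w \<odot>\<^bsub>MS\<^esub> j x'" "x = u \<odot>\<^bsub>M\<^esub> (p \<odot>\<^bsub>M\<^esub> x')"
    by (rule frac_step[OF assms(1,3) j_closed[OF yc] assms(4)])
  have x'c: "x' \<in> carrier M"
    using Prim_closed p(3) by blast
  obtain u' where u': "u' \<in> Units R" "y = u' \<odot>\<^bsub>M\<^esub> x'"
    using Unit_act_j_eq[OF p(6,3) assms(2) p(8)] by blast
  have x'y: "x' = inv u' \<odot>\<^bsub>M\<^esub> y"
    unfolding u'(2) using u'(1) x'c by simp
  have "x = (u \<otimes> (p \<otimes> inv u')) \<odot>\<^bsub>M\<^esub> y"
    using p(9) p(1,4) u'(1) yc unfolding x'y by (simp add: act_mult Units_closed)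
  moreover have "u \<otimes> (p \<otimes> inv u') \<in> S'"
    using p(1,4) u'(1) by simp
  ultimately show ?thesis
    by blast
qed

text \<open>Primitivity matters for the return direction: \<open>j\<close> makes \<open>m\<close>
  and \<open>s m\<close> associated for every \<open>s \<in> S\<close>, whereas between primitive
  elements a scalar from \<open>T\<close> can be replaced by one from \<open>S'\<close>.\<close>

lemma msim_j_iff:
  assumes "x \<in> Prim" "y \<in> Prim"
  shows "msim RS MS T (j x) (j y) \<longleftrightarrow> msim R M S' x y"
proof
  assume "msim RS MS T (j x) (j y)"
  then show "msim R M S' x y"
    unfolding msim_def using act_of_j_act[OF assms] act_of_j_act[OF assms(2,1)] by blast
next
  assume "msim R M S' x y"
  then obtain r q where rq: "r \<in> S'" "q \<in> S'" "x = r \<odot>\<^bsub>M\<^esub> y" "y = q \<odot>\<^bsub>M\<^esub> x"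
    unfolding msim_def by blast
  have "i r \<odot>\<^bsub>MS\<^esub> j y = j (r \<odot>\<^bsub>M\<^esub> y)" "i q \<odot>\<^bsub>MS\<^esub> j x = j (q \<odot>\<^bsub>M\<^esub> x)"
    using rq(1,2) assms Prim_closed by (auto intro!: i_act_j)
  then have "j x = i r \<odot>\<^bsub>MS\<^esub> j y" "j y = i q \<odot>\<^bsub>MS\<^esub> j x"
    unfolding rq(3)[symmetric] rq(4)[symmetric] by simp_all
  then show "msim RS MS T (j x) (j y)"
    unfolding msim_def using i_T rq(1,2) by blast
qed

text \<open>Clearing denominators gives \<open>s a = c b\<close>. Splitting \<open>c = t p\<close>,
  the \<open>S\<close>-parts \<open>s\<close> and \<open>t\<close> agree up to a unit, so
  \<open>a\<close> is a unit times \<open>p b\<close>.\<close>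

lemma mult_of_i_mult:
  assumes a: "a \<in> S'" "S_free a" "acts a" and b: "b \<in> S'" "S_free b"
    and f: "f \<in> carrier RS" and eq: "i a = f \<otimes>\<^bsub>RS\<^esub> i b"
  shows "\<exists>d \<in> carrier R. a = d \<otimes> b"
proof -
  obtain c s where c: "c \<in> carrier R" "s \<in> S" "f = rfrac c s"
    using f by (rule RS_cases)
  have abc: "a \<in> carrier R" "b \<in> carrier R"
    using a b by auto
  have "i a = rfrac (c \<otimes> b) s"
    using eq c abc by simp
  then have eq1: "s \<otimes> a = c \<otimes> b"
    using c abc by (simp add: rfrac_eq_iff)
  have "s \<otimes> a \<in> S'"
    using c(2) a(1) S_subset by auto
  then have cS': "c \<in> S'"
    using saturated_S'[of c b] c(1) abc unfolding eq1 by blast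
  have "acts (s \<otimes> a)"
    using S_mult_acts a(3) c(2) abc by blast
  then have "acts c"
    using acts_mult(1)[of c b] c(1) abc unfolding eq1 by blast
  then obtain t p where p: "t \<in> S" "p \<in> S'" "S_free p" "c = t \<otimes> p"
    using compact_decomposition[OF compact cS'] by blast
  have pc: "p \<in> carrier R" "t \<in> carrier R"
    using p by auto
  have eq2: "s \<otimes> a = t \<otimes> (p \<otimes> b)"
    unfolding eq1 p(4) using pc abc by (simp add: m_assoc)
  obtain u where u: "u \<in> Units R" "s = u \<otimes> t" "p \<otimes> b = u \<otimes> a"
    by (rule S_free_unique[OF c(2) p(1) a(2,3) m_closed[OF pc(1) abc(2)]
        S_free_mult_act[OF p(3) b(2)] eq2])
  have "a = inv u \<otimes> (u \<otimes> a)"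
    using u(1) abc by (simp add: m_assoc[symmetric])
  also have "\<dots> = (inv u \<otimes> p) \<otimes> b"
    unfolding u(3)[symmetric] using u(1) pc abc by (simp add: m_assoc)
  finally show ?thesis
    using u(1) pc by blast
qed

lemma rsim_i_iff:
  assumes a: "a \<in> S'" "S_free a" "acts a" and b: "b \<in> S'" "S_free b" "acts b"
  shows "rsim RS (i a) (i b) \<longleftrightarrow> rsim R a b"
proof
  assume "rsim RS (i a) (i b)"
  then obtain f g where "f \<in> carrier RS" "g \<in> carrier RS"
    "i a = f \<otimes>\<^bsub>RS\<^esub> i b" "i b = g \<otimes>\<^bsub>RS\<^esub> i a"
    unfolding rsim_def msim_def regular_module_simps by blast
  then show "rsim R a b"
    unfolding rsim_def msim_def regular_module_simps
    using mult_of_i_mult[OF a b(1,2)] mult_of_i_mult[OF b a(1,2)] by blast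
next
  assume "rsim R a b"
  then show "rsim RS (i a) (i b)"
    using rsim_i a(1) b(1) by blast
qed

text \<open>Factors of \<open>a\<close> in \<open>R\<close> are again \<open>S\<close>-free and act
  nontrivially, so \<open>rsim_i_iff\<close> applies to them. Conversely, factors of
  \<open>i a\<close> are units of \<open>RS\<close> times \<open>i p\<close> and \<open>i q\<close>,
  where \<open>p q\<close> is \<open>a\<close> up to a unit of \<open>R\<close>. The condition
  \<open>a \<notin> S\<close> keeps \<open>i a\<close> from becoming a unit.\<close>

lemma rirreducible_i_iff:
  assumes a: "a \<in> S'" "S_free a" "acts a" "a \<notin> S"
  shows "rirreducible RS (i a) \<longleftrightarrow> rirreducible R a"
proof
  have ac: "a \<in> carrier R"
    using a(1) by blast
  assume irr: "rirreducible RS (i a)"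
  show "rirreducible R a"
    unfolding rirreducible_def
  proof (intro conjI ballI impI)
    show "a \<in> carrier R - Units R"
      using ac a(4) by auto
    fix b c assume bc: "b \<in> carrier R" "c \<in> carrier R" and eq: "a = b \<otimes> c"
    have "b \<in> S'" "c \<in> S'" "S_free b" "S_free c" "acts b" "acts c"
      using a saturated_S' saturated_S'2 S_free_factor[of b c] S_free_factor[of c b]
        acts_mult[of b c] bc m_comm[OF bc] unfolding eq by metis+
    moreover have "i a = i b \<otimes>\<^bsub>RS\<^esub> i c"
      unfolding eq using bc by simp
    then have "rsim RS (i a) (i b) \<or> rsim RS (i a) (i c)"
      using irr bc rfrac_closed S_one unfolding rirreducible_def by blast
    ultimately show "rsim R a b \<or> rsim R a c"
      using rsim_i_iff[OF a(1-3)] by blast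
  qed
next
  have ac: "a \<in> carrier R"
    using a(1) by blast
  assume irr: "rirreducible R a"
  show "rirreducible RS (i a)"
    unfolding rirreducible_def
  proof (intro conjI ballI impI)
    show "i a \<in> carrier RS - Units RS"
      using ac a(4) rfrac_Units_iff by auto
    fix f g assume f: "f \<in> carrier RS" and g: "g \<in> carrier RS" and eq: "i a = f \<otimes>\<^bsub>RS\<^esub> g"
    obtain b s where b: "b \<in> carrier R" "s \<in> S" "f = rfrac b s"
      using f by (rule RS_cases)
    obtain c t where c: "c \<in> carrier R" "t \<in> S" "g = rfrac c t"
      using g by (rule RS_cases)
    have "i a = rfrac (b \<otimes> c) (s \<otimes> t)"
      using eq b c by simp
    then have eq1: "(s \<otimes> t) \<otimes> a = b \<otimes> c"
      using b c ac by (simp add: rfrac_eq_iff)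
    have "b \<otimes> c \<in> S'"
      unfolding eq1[symmetric]
      by (rule big.S_mult[OF subsetD[OF S_subset S_mult[OF b(2) c(2)]] a(1)])
    then have bcS': "b \<in> S'" "c \<in> S'"
      using saturated_S' saturated_S'2 b(1) c(1) by blast+
    have "acts (b \<otimes> c)"
      unfolding eq1[symmetric] using S_mult_acts a(3) b(2) c(2) ac by simp
    then have "acts b" "acts c"
      using acts_mult[of b c] b(1) c(1) by blast+
    obtain s1 p where p: "s1 \<in> S" "p \<in> S'" "S_free p" "b = s1 \<otimes> p"
      using compact_decomposition[OF compact bcS'(1) \<open>acts b\<close>] by blast
    obtain s2 q where q: "s2 \<in> S" "q \<in> S'" "S_free q" "c = s2 \<otimes> q"
      using compact_decomposition[OF compact bcS'(2) \<open>acts c\<close>] by blast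
    have pqc: "p \<in> carrier R" "q \<in> carrier R" "s1 \<in> carrier R" "s2 \<in> carrier R"
      using p q by auto
    have eq2: "(s \<otimes> t) \<otimes> a = (s1 \<otimes> s2) \<otimes> (p \<otimes> q)"
      unfolding eq1 p(4) q(4) using pqc by (simp add: m_ac)
    \<comment> \<open>Comparing the \<open>S\<close>-parts of the two sides removes all denominators
      at once.\<close>
    obtain u where u: "u \<in> Units R" "s \<otimes> t = u \<otimes> (s1 \<otimes> s2)" "p \<otimes> q = u \<otimes> a"
      by (rule S_free_unique[OF S_mult[OF b(2) c(2)] S_mult[OF p(1) q(1)] a(2,3)
          m_closed[OF pqc(1,2)] S_free_mult_act[OF p(3) q(3)] eq2])
    have uc: "inv u \<in> carrier R"
      using u(1) by blast
    have "a = inv u \<otimes> (u \<otimes> a)"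
      using u(1) ac by (simp add: m_assoc[symmetric])
    also have "\<dots> = (inv u \<otimes> p) \<otimes> q"
      unfolding u(3)[symmetric] using uc pqc by (simp add: m_assoc)
    finally have "a = (inv u \<otimes> p) \<otimes> q" .
    then have "rsim R a (inv u \<otimes> p) \<or> rsim R a q"
      using irr uc pqc unfolding rirreducible_def by blast
    moreover have "rsim R (inv u \<otimes> p) p"
      using rsim_unit[of "inv u" p] rsim_sym u(1) pqc by simp
    ultimately have "rsim R a p \<or> rsim R a q"
      using rsim_trans ac pqc by blast
    then have "rsim RS (i a) (i p) \<or> rsim RS (i a) (i q)"
      using rsim_i ac pqc by blast
    moreover have "rsim RS (i p) f"
    proof -
      have "f = rfrac s1 s \<otimes>\<^bsub>RS\<^esub> i p"
        using b(2,3) p(4) pqc by simp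
      then show ?thesis
        using loc.rsim_unit[of "rfrac s1 s" "i p"] rfrac_Units_iff[of s1 s] p(1) b(2) pqc by simp
    qed
    moreover have "rsim RS (i q) g"
    proof -
      have "g = rfrac s2 t \<otimes>\<^bsub>RS\<^esub> i q"
        using c(2,3) q(4) pqc by simp
      then show ?thesis
        using loc.rsim_unit[of "rfrac s2 t" "i q"] rfrac_Units_iff[of s2 t] q(1) c(2) pqc by simp
    qed
    ultimately show "rsim RS (i a) f \<or> rsim RS (i a) g"
      using loc.rsim_trans f g ac rfrac_closed S_one by blast
  qed
qed

text \<open>A cofactor of a primitive element is primitive by \<open>Prim_factor\<close>, and over
  \<open>RS\<close> it is associated to the image of a primitive element by
  \<open>frac_step\<close>. So both conditions reduce to associates covered by
  \<open>msim_j_iff\<close>.\<close>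

lemma mprimitive_j_iff:
  assumes x: "x \<in> Prim"
  shows "mprimitive RS MS T (j x) \<longleftrightarrow> mprimitive R M S' x"
proof
  assume prim: "mprimitive RS MS T (j x)"
  show "mprimitive R M S' x"
    unfolding mprimitive_def
  proof (intro conjI ballI impI)
    show "x \<in> carrier M"
      using x Prim_closed by blast
    fix r m assume r: "r \<in> S'" and m: "m \<in> carrier M" and eq: "x = r \<odot>\<^bsub>M\<^esub> m"
    have rc: "r \<in> carrier R"
      using r by blast
    have mP: "m \<in> Prim"
      using Prim_factor[OF x[unfolded eq] rc m] .
    have "j x = i r \<odot>\<^bsub>MS\<^esub> j m"
      unfolding eq using i_act_j[OF rc m] by simp
    then have "msim RS MS T (j m) (j x)"
      using prim i_T[OF r] m unfolding mprimitive_def by blast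
    then show "msim R M S' m x"
      using msim_j_iff[OF mP x] by blast
  qed
next
  assume prim: "mprimitive R M S' x"
  have xc: "x \<in> carrier M"
    using x Prim_closed by blast
  show "mprimitive RS MS T (j x)"
    unfolding mprimitive_def
  proof (intro conjI ballI impI)
    show "j x \<in> carrier MS"
      using xc by blast
    fix f z assume f: "f \<in> T" and z: "z \<in> carrier MS" and eq: "j x = f \<odot>\<^bsub>MS\<^esub> z"
    obtain p x' u v w where p: "p \<in> S'" "S_free p" "x' \<in> Prim" "u \<in> Units R" "v \<in> Units RS"
    "w \<in> Units RS" "f = v \<otimes>\<^bsub>RS\<^esub> i p" "z = w \<odot>\<^bsub>MS\<^esub> j x'" "x = u \<odot>\<^bsub>M\<^esub> (p \<odot>\<^bsub>M\<^esub> x')"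
      by (rule frac_step[OF x f z eq])
    have x'c: "x' \<in> carrier M"
      using Prim_closed p(3) by blast
    have "x = (u \<otimes> p) \<odot>\<^bsub>M\<^esub> x'"
      using p(9) act_mult[of u p x'] p(1,4) x'c by auto
    moreover have "u \<otimes> p \<in> S'"
      using p(1,4) by simp
    ultimately have "msim R M S' x' x"
      using prim x'c unfolding mprimitive_def by blast
    then have "msim RS MS T (j x') (j x)"
      using msim_j_iff[OF p(3) x] by blast
    moreover have "msim RS MS T z (j x')"
      unfolding p(8) using loc.msim_unit[OF p(6)] x'c by blast
    ultimately show "msim RS MS T z (j x)"
      using loc.msim_trans z xc by blast
  qed
qed

text \<open>Supplies the side conditions of \<open>rirreducible_i_iff\<close>,
  \<open>rsim_i_iff\<close> and \<open>mprimitive_j_iff\<close> for all entries at once.\<close>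

lemma atomic_factorization_parts:
  assumes x: "x \<in> Prim" and f: "(ss, n) \<in> atomic_factorizations R M S' x"
  shows "n \<in> Prim" "\<And>s. s \<in> set ss \<Longrightarrow> s \<in> S' \<and> s \<notin> S \<and> acts s \<and> S_free s"
proof -
  note f1 = big.atomic_factorizationsD[OF f]
  note f2 = big.factorizationsD[OF f1(1)]
  have ne: "list_prod R ss \<odot>\<^bsub>M\<^esub> n \<noteq> \<zero>\<^bsub>M\<^esub>"
    using x f2(5) by simp
  then have "n \<noteq> \<zero>\<^bsub>M\<^esub>"
    using f2(2) by auto
  then show "n \<in> Prim"
    using big_mprimitive_Prim f1(3) by blast
  show "s \<in> S' \<and> s \<notin> S \<and> acts s \<and> S_free s" if s: "s \<in> set ss" for s
    using S_free_irreducible[OF f1(2)[OF s]] Prim_list_prod_not_S[OF x f1(1) s]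
      list_prod_acts[OF f2(2,4) ne s] f2(1) s by blast
qed

text \<open>Factors of a primitive element lie outside \<open>S\<close>, so none of them becomes a
  unit of \<open>RS\<close>.\<close>

lemma factorizations_j:
  assumes x: "x \<in> Prim" and f: "(ss, n) \<in> factorizations R M S' x"
  shows "(map (\<lambda>a. i a) ss, j n) \<in> factorizations RS MS T (j x)"
proof -
  note f' = big.factorizationsD[OF f]
  have "j x = list_prod RS (map (\<lambda>a. i a) ss) \<odot>\<^bsub>MS\<^esub> j n"
    unfolding list_prod_i[OF f'(2)] using i_act_j[OF list_prod_closed[OF f'(2)] f'(4)] f'(5) by simp
  moreover have "i a \<in> T - Units RS" if a: "a \<in> set ss" for a
  proof -
    have "a \<in> S'" "a \<in> carrier R" "a \<notin> S"
      using f'(1,2) a Prim_list_prod_not_S[OF x f a] by auto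
    then show ?thesis
      using i_T rfrac_Units_iff by auto
  qed
  then have "set (map (\<lambda>a. i a) ss) \<subseteq> T - Units RS"
    by auto
  moreover have "j n \<in> carrier MS"
    using f'(4) by blast
  ultimately show ?thesis
    unfolding factorizations_def by blast
qed

lemma atomic_factorizations_j:
  assumes x: "x \<in> Prim" and f: "(ss, n) \<in> atomic_factorizations R M S' x"
  shows "(map (\<lambda>a. i a) ss, j n) \<in> atomic_factorizations RS MS T (j x)"
proof -
  note f1 = big.atomic_factorizationsD[OF f]
  note parts = atomic_factorization_parts[OF x f]
  have "rirreducible RS (i a)" if a: "a \<in> set ss" for a
    using rirreducible_i_iff[of a] parts(2)[OF a] f1(2)[OF a] by blast
  moreover have "mprimitive RS MS T (j n)"
    using mprimitive_j_iff[OF parts(1)] f1(3) by blast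
  ultimately show ?thesis
    using factorizations_j[OF x f1(1)] unfolding atomic_factorizations_def by auto
qed

text \<open>A relation rather than a function, because a numerator \<open>p\<close> is obtained only
  up to units; \<open>list_all2\<close> extends it to lists of equal length.\<close>

definition lifts :: "('a \<times> 'a) set \<Rightarrow> 'a \<Rightarrow> bool" where
  "lifts f p \<longleftrightarrow> p \<in> S' \<and> S_free p \<and> (\<exists>v \<in> Units RS. f = v \<otimes>\<^bsub>RS\<^esub> i p)"

text \<open>\<open>frac_step\<close> clears one factor and leaves a unit of \<open>RS\<close> on the
  rest of the product. That unit is passed on to the last entry, hence the arbitrary
  \<open>y\<close> in the induction and the unit \<open>w\<close> in the conclusion.\<close>

lemma factorization_lift:
  assumes "x \<in> Prim" "set fs \<subseteq> T" "y \<in> carrier MS" "j x = list_prod RS fs \<odot>\<^bsub>MS\<^esub> y"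
  shows "\<exists>ps n w. x = list_prod R ps \<odot>\<^bsub>M\<^esub> n \<and> n \<in> Prim \<and> w \<in> Units RS \<and> y = w \<odot>\<^bsub>MS\<^esub> j n \<and>
    list_all2 lifts fs ps"
  using assms
proof (induction fs arbitrary: x y)
  case Nil
  have xc: "x \<in> carrier M"
    using Nil.prems Prim_closed by blast
  have "x = list_prod R [] \<odot>\<^bsub>M\<^esub> x" "y = \<one>\<^bsub>RS\<^esub> \<odot>\<^bsub>MS\<^esub> j x"
    using Nil.prems xc by simp_all
  then show ?case
    using Nil.prems(1) loc.Units_one_closed list.rel_intros(1) by blast
next
  case (Cons f fs)
  define z where "z = list_prod RS fs \<odot>\<^bsub>MS\<^esub> y"
  have f: "f \<in> T" "f \<in> carrier RS" and fs: "set fs \<subseteq> T" "set fs \<subseteq> carrier RS"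
    using Cons.prems(2) by auto
  have z: "z \<in> carrier MS"
    unfolding z_def using fs Cons.prems(3) by blast
  have "j x = f \<odot>\<^bsub>MS\<^esub> z"
    unfolding z_def using Cons.prems(3,4) f fs by (simp add: loc.act_mult)
  then obtain p x' u v w where p: "p \<in> S'" "S_free p" "x' \<in> Prim" "u \<in> Units R" "v \<in> Units RS"
    "w \<in> Units RS" "f = v \<otimes>\<^bsub>RS\<^esub> i p" "z = w \<odot>\<^bsub>MS\<^esub> j x'" "x = u \<odot>\<^bsub>M\<^esub> (p \<odot>\<^bsub>M\<^esub> x')"
    by (rule frac_step[OF Cons.prems(1) f(1) z])
  have x'c: "x' \<in> carrier M"
    using Prim_closed p(3) by blast
  have wc: "inv\<^bsub>RS\<^esub> w \<in> carrier RS" "w \<in> carrier RS"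
    using p(6) by auto
  have "j x' = inv\<^bsub>RS\<^esub> w \<odot>\<^bsub>MS\<^esub> z"
    unfolding p(8) using p(6) x'c by simp
  also have "\<dots> = list_prod RS fs \<odot>\<^bsub>MS\<^esub> (inv\<^bsub>RS\<^esub> w \<odot>\<^bsub>MS\<^esub> y)"
    unfolding z_def using wc fs Cons.prems(3) by (simp add: loc.act_left_commute)
  \<comment> \<open>Moving the unit \<open>w\<close> to the last entry puts \<open>j x'\<close> on
    the left, as the induction hypothesis requires.\<close>
  finally have eq: "j x' = list_prod RS fs \<odot>\<^bsub>MS\<^esub> (inv\<^bsub>RS\<^esub> w \<odot>\<^bsub>MS\<^esub> y)" .
  obtain ps n w' where IH: "x' = list_prod R ps \<odot>\<^bsub>M\<^esub> n" "n \<in> Prim" "w' \<in> Units RS"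
    "inv\<^bsub>RS\<^esub> w \<odot>\<^bsub>MS\<^esub> y = w' \<odot>\<^bsub>MS\<^esub> j n" "list_all2 lifts fs ps"
    using Cons.IH[OF p(3) fs(1) _ eq] wc(1) Cons.prems(3) by blast
  have nc: "n \<in> carrier M"
    using Prim_closed IH(2) by blast
  have psc: "set ps \<subseteq> carrier R"
    using IH(5) unfolding lifts_def by (auto simp: list_all2_conv_all_nth in_set_conv_nth)
  have c: "u \<in> carrier R" "inv u \<in> carrier R" "p \<in> carrier R"
    using p(1,4) by auto
  have "x = list_prod R (p # ps) \<odot>\<^bsub>M\<^esub> (u \<odot>\<^bsub>M\<^esub> n)"
    unfolding p(9) IH(1) using c psc nc by (simp add: act_mult act_left_commute)
  moreover have "u \<odot>\<^bsub>M\<^esub> n \<in> Prim"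
    using Prim_unit p(4) IH(2) by blast
  \<comment> \<open>The unit \<open>u\<close> of \<open>R\<close> was moved into the last entry
    \<open>u n\<close>, so its inverse has to be compensated by \<open>i (inv u)\<close>.\<close>
  moreover have "y = (w \<otimes>\<^bsub>RS\<^esub> (w' \<otimes>\<^bsub>RS\<^esub> i (inv u))) \<odot>\<^bsub>MS\<^esub> j (u \<odot>\<^bsub>M\<^esub> n)"
  proof -
    have "y = w \<odot>\<^bsub>MS\<^esub> (inv\<^bsub>RS\<^esub> w \<odot>\<^bsub>MS\<^esub> y)"
      using p(6) Cons.prems(3) by simp
    also have "\<dots> = w \<odot>\<^bsub>MS\<^esub> (w' \<odot>\<^bsub>MS\<^esub> j n)"
      unfolding IH(4) ..
    also have "j n = i (inv u) \<odot>\<^bsub>MS\<^esub> j (u \<odot>\<^bsub>M\<^esub> n)"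
      using p(4) nc c by simp
    finally show ?thesis
      using wc(2) loc.Units_closed[OF IH(3)] c nc by (simp add: loc.act_mult del: MS_act_frac RS_mult_frac)
  qed
  moreover have "w \<otimes>\<^bsub>RS\<^esub> (w' \<otimes>\<^bsub>RS\<^esub> i (inv u)) \<in> Units RS"
    using p(4,6) IH(3) rfrac_Units_iff[of "inv u" \<one>] by simp
  moreover have "list_all2 lifts (f # fs) (p # ps)"
    using IH(5) p(1,2,5,7) unfolding lifts_def by auto
  ultimately show ?case
    by blast
qed

lemma lifts_nonunit:
  assumes "lifts f p" "f \<notin> Units RS"
  shows "p \<notin> S"
proof
  assume "p \<in> S"
  then have "i p \<in> Units RS"
    using rfrac_Units_iff[of p \<one>] by simp
  then show False
    using assms unfolding lifts_def by auto
qed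

lemma factorizations_lift:
  assumes x: "x \<in> Prim" and f: "(fs, y) \<in> factorizations RS MS T (j x)"
  obtains ps n w where "(ps, n) \<in> factorizations R M S' x" "n \<in> Prim" "w \<in> Units RS"
    "y = w \<odot>\<^bsub>MS\<^esub> j n" "list_all2 lifts fs ps"
proof -
  note f' = loc.factorizationsD[OF f]
  obtain ps n w where ps: "x = list_prod R ps \<odot>\<^bsub>M\<^esub> n" "n \<in> Prim" "w \<in> Units RS"
    "y = w \<odot>\<^bsub>MS\<^esub> j n" "list_all2 lifts fs ps"
    using factorization_lift[OF x f'(1,4,5)] by blast
  have "p \<in> S' - Units R" if p: "p \<in> set ps" for p
  proof -
    obtain g where g: "g \<in> set fs" "lifts g p"
      using list_all2_memD[OF ps(5) p] by blast
    then have "p \<notin> S"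
      using lifts_nonunit f'(3) by blast
    then show ?thesis
      using g(2) unfolding lifts_def by auto
  qed
  then have "(ps, n) \<in> factorizations R M S' x"
    unfolding factorizations_def using ps(1) Prim_closed[OF ps(2)] by blast
  then show ?thesis
    using that ps by blast
qed

text \<open>A factorization of \<open>j x\<close> is recovered from one of \<open>x\<close> only up
  to units of \<open>RS\<close> in every entry; this leaves the key unchanged, and the key is all
  that is needed.\<close>

lemma atomic_factorizations_lift:
  assumes x: "x \<in> Prim" and f: "(fs, y) \<in> atomic_factorizations RS MS T (j x)"
  obtains ps n where "(ps, n) \<in> atomic_factorizations R M S' x"
    "fact_key RS MS T (fs, y) = fact_key RS MS T (map (\<lambda>a. i a) ps, j n)"
proof -
  note f1 = loc.atomic_factorizationsD[OF f]
  note f2 = loc.factorizationsD[OF f1(1)]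
  obtain ps n w where ps: "(ps, n) \<in> factorizations R M S' x" "n \<in> Prim" "w \<in> Units RS"
    "y = w \<odot>\<^bsub>MS\<^esub> j n" "list_all2 lifts fs ps"
    using factorizations_lift[OF x f1(1)] by blast
  note ps' = big.factorizationsD[OF ps(1)]
  have ne: "list_prod R ps \<odot>\<^bsub>M\<^esub> n \<noteq> \<zero>\<^bsub>M\<^esub>"
    using x ps'(5) by simp
  have jn: "j n \<in> carrier MS"
    using ps'(4) by blast
  have "rirreducible R p" if p: "p \<in> set ps" for p
  proof -
    obtain g where g: "g \<in> set fs" "lifts g p"
      using list_all2_memD[OF ps(5) p] by blast
    then obtain v where v: "v \<in> Units RS" "g = v \<otimes>\<^bsub>RS\<^esub> i p"
      unfolding lifts_def by blast
    have pc: "p \<in> carrier R"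
      using p ps'(2) by blast
    have "i p = inv\<^bsub>RS\<^esub> v \<otimes>\<^bsub>RS\<^esub> g"
      unfolding v(2) using v(1) pc loc.m_assoc[of "inv\<^bsub>RS\<^esub> v" v "i p"] loc.Units_closed[OF v(1)]
        loc.Units_l_inv[OF v(1)] by (simp del: RS_mult_frac)
    then have "rirreducible RS (i p)"
      using loc.rirreducible_unit[OF _ f1(2)[OF g(1)], of "inv\<^bsub>RS\<^esub> v"] v(1) by simp
    moreover have "p \<notin> S"
      using lifts_nonunit[OF g(2)] g(1) f2(3) by blast
    moreover have "p \<in> S'" "S_free p" "acts p"
      using g(2) list_prod_acts[OF ps'(2,4) ne p] unfolding lifts_def by auto
    ultimately show ?thesis
      using rirreducible_i_iff[of p] by blast
  qed
  moreover have "mprimitive R M S' n"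
  proof -
    have "j n = inv\<^bsub>RS\<^esub> w \<odot>\<^bsub>MS\<^esub> y"
      unfolding ps(4) using ps(3) jn by simp
    then have "mprimitive RS MS T (j n)"
      using loc.mprimitive_unit[OF _ f1(3), of "inv\<^bsub>RS\<^esub> w"] ps(3) by simp
    then show ?thesis
      using mprimitive_j_iff[OF ps(2)] by blast
  qed
  ultimately have atomic: "(ps, n) \<in> atomic_factorizations R M S' x"
    using ps(1) unfolding atomic_factorizations_def by blast
  have "rclass RS g = rclass RS (i p)" if g: "lifts g p" for g p
  proof -
    obtain v where v: "v \<in> Units RS" "g = v \<otimes>\<^bsub>RS\<^esub> i p" and p: "p \<in> S'"
      using g unfolding lifts_def by blast
    have pc: "i p \<in> carrier RS"
      using p by blast
    have "rsim RS (i p) g"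
      unfolding v(2) using loc.rsim_unit[OF v(1) pc] .
    moreover have "g \<in> carrier RS"
      unfolding v(2) using loc.Units_closed[OF v(1)] pc by blast
    ultimately show ?thesis
      using loc.rclass_eq_iff pc loc.rsim_sym by blast
  qed
  then have "map (rclass RS) fs = map (rclass RS) (map (\<lambda>a. i a) ps)"
    using ps(5) by (auto simp: list_all2_conv_all_nth intro!: nth_equalityI)
  moreover have "mclass RS MS T y = mclass RS MS T (j n)"
    unfolding ps(4) using loc.mclass_unit[OF ps(3) jn] .
  ultimately have "fact_key RS MS T (fs, y) = fact_key RS MS T (map (\<lambda>a. i a) ps, j n)"
    unfolding fact_key_def fst_conv snd_conv by simp
  then show ?thesis
    using that atomic by blast
qed

text \<open>The two key sets consist of classes in different structures. Both are images of the
  atomic factorizations of \<open>x\<close>, under maps that identify the same pairs and preserve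
  lengths.\<close>

lemma keys_property_j:
  assumes x: "x \<in> Prim"
  shows "keys_property P (fact_keys RS MS T (j x)) \<longleftrightarrow> keys_property P (fact_keys R M S' x)"
proof -
  let ?AF = "atomic_factorizations R M S' x"
  \<comment> \<open>\<open>l\<close> sends a factorization of \<open>x\<close> to the key of its
    image over \<open>RS\<close>; by lifting, every key of \<open>j x\<close> arises in this
    way.\<close>
  define l where "l = (\<lambda>(ss, n). fact_key RS MS T (map (\<lambda>a. i a) ss, j n))"
  have "fact_keys RS MS T (j x) = l ` ?AF"
  proof (intro equalityI subsetI)
    fix k assume "k \<in> fact_keys RS MS T (j x)"
    then obtain F where F: "F \<in> atomic_factorizations RS MS T (j x)" "k = fact_key RS MS T F"
      unfolding fact_keys_def by blast
    obtain fs y where F_eq: "F = (fs, y)"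
      by (cases F)
    have f: "(fs, y) \<in> atomic_factorizations RS MS T (j x)" and k: "k = fact_key RS MS T (fs, y)"
      using F unfolding F_eq .
    obtain ps n where ps: "(ps, n) \<in> ?AF"
      and key: "fact_key RS MS T (fs, y) = fact_key RS MS T (map (\<lambda>a. i a) ps, j n)"
      by (rule atomic_factorizations_lift[OF x f])
    have "k = l (ps, n)"
      unfolding k key l_def by simp
    then show "k \<in> l ` ?AF"
      using ps by (rule image_eqI)
  next
    fix k assume "k \<in> l ` ?AF"
    then obtain F where F: "F \<in> ?AF" "k = l F"
      by blast
    obtain ss n where F_eq: "F = (ss, n)"
      by (cases F)
    have "(ss, n) \<in> ?AF" "k = fact_key RS MS T (map (\<lambda>a. i a) ss, j n)"
      using F unfolding F_eq l_def by simp_all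
    then show "k \<in> fact_keys RS MS T (j x)"
      unfolding fact_keys_def using atomic_factorizations_j[OF x] by blast
  qed
  moreover have "keys_property P (fact_key R M S' ` ?AF) \<longleftrightarrow> keys_property P (l ` ?AF)"
  proof (rule keys_property_image_cong)
    show "size (fst (fact_key R M S' f)) = size (fst (l f))" for f
      by (simp add: l_def fact_key_def split_beta)
    fix f g assume fg: "f \<in> ?AF" "g \<in> ?AF"
    obtain ss n where f: "f = (ss, n)"
      by (cases f)
    obtain ts n' where g: "g = (ts, n')"
      by (cases g)
    note pf = atomic_factorization_parts[OF x fg(1)[unfolded f]]
    note pg = atomic_factorization_parts[OF x fg(2)[unfolded g]]
    \<comment> \<open>All factors lie in the set of acting \<open>S\<close>-free elements of
      \<open>S'\<close>, where association in \<open>R\<close> and in \<open>RS\<close>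
      coincide.\<close>
    have "image_mset (rclass R) (mset ss) = image_mset (rclass R) (mset ts) \<longleftrightarrow>
      image_mset (\<lambda>a. rclass RS (i a)) (mset ss) = image_mset (\<lambda>a. rclass RS (i a)) (mset ts)"
    proof (rule image_mset_eq_iff_of_kernel_eq)
      fix a b assume a: "a \<in> {a \<in> S'. S_free a \<and> acts a}" and b: "b \<in> {a \<in> S'. S_free a \<and> acts a}"
      have "rclass R a = rclass R b \<longleftrightarrow> rsim R a b"
        using a b by (intro rclass_eq_iff) auto
      also have "\<dots> \<longleftrightarrow> rsim RS (i a) (i b)"
        using rsim_i_iff[of a b] a b by blast
      also have "\<dots> \<longleftrightarrow> rclass RS (i a) = rclass RS (i b)"
        using a b by (intro loc.rclass_eq_iff[symmetric]) auto
      finally show "rclass R a = rclass R b \<longleftrightarrow> rclass RS (i a) = rclass RS (i b)" .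
    qed (use pf(2) pg(2) in auto)
    moreover have "mclass R M S' n = mclass R M S' n' \<longleftrightarrow> mclass RS MS T (j n) = mclass RS MS T (j n')"
    proof -
      have c: "n \<in> carrier M" "n' \<in> carrier M"
        using Prim_closed pf(1) pg(1) by blast+
      then show ?thesis
        using big.mclass_eq_iff[OF c] loc.mclass_eq_iff[of "j n" "j n'"] msim_j_iff[OF pf(1) pg(1)]
        by auto
    qed
    ultimately show "fact_key R M S' f = fact_key R M S' g \<longleftrightarrow> l f = l g"
      unfolding f g l_def fact_key_def by (simp add: multiset.map_comp comp_def)
  qed
  ultimately show ?thesis
    unfolding fact_keys_def[of R M S'] by simp
qed

lemma MS_nonzero_iff:
  "y \<in> carrier MS - {\<zero>\<^bsub>MS\<^esub>} \<longleftrightarrow> (\<exists>w \<in> Units RS. \<exists>x \<in> Prim. y = w \<odot>\<^bsub>MS\<^esub> j x)"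
proof
  assume "y \<in> carrier MS - {\<zero>\<^bsub>MS\<^esub>}"
  then show "\<exists>w \<in> Units RS. \<exists>x \<in> Prim. y = w \<odot>\<^bsub>MS\<^esub> j x"
    using MS_Prim_decomposition[of y] by blast
next
  assume "\<exists>w \<in> Units RS. \<exists>x \<in> Prim. y = w \<odot>\<^bsub>MS\<^esub> j x"
  then obtain w x where w: "w \<in> Units RS" and x: "x \<in> Prim" and y: "y = w \<odot>\<^bsub>MS\<^esub> j x"
    by blast
  obtain a s where a: "a \<in> carrier R" "s \<in> S" "w = rfrac a s"
    using RS_cases[of w] loc.Units_closed[OF w] by blast
  have aS: "a \<in> S"
    using w rfrac_Units_iff a by blast
  have xc: "x \<in> carrier M" "x \<noteq> \<zero>\<^bsub>M\<^esub>"
    using x Prim_closed[OF x] by simp_all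
  have "y = mfrac (a \<odot>\<^bsub>M\<^esub> x) s"
    unfolding y a(3) using rfrac_act_j a(1,2) xc(1) by simp
  then show "y \<in> carrier MS - {\<zero>\<^bsub>MS\<^esub>}"
    using mfrac_eq_zero_iff[of "a \<odot>\<^bsub>M\<^esub> x" s] S_act_nonzero[OF aS xc] a(1,2) xc(1) by simp
qed

lemma keyed_property_localization:
  assumes P: "P \<in> keyed_properties"
  shows "property_on P RS MS T (carrier MS - {\<zero>\<^bsub>MS\<^esub>}) \<longleftrightarrow> property_on P R M S' Prim"
proof -
  have unit: "fact_keys RS MS T (w \<odot>\<^bsub>MS\<^esub> j x) = fact_keys RS MS T (j x)"
    if "w \<in> Units RS" "x \<in> Prim" for w x
    using loc.fact_keys_unit[OF that(1)] Prim_closed[OF that(2)] by blast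
  show ?thesis
    unfolding big.property_on_iff_keys[OF P] loc.property_on_iff_keys[OF P]
  proof
    assume all: "\<forall>y \<in> carrier MS - {\<zero>\<^bsub>MS\<^esub>}. keys_property P (fact_keys RS MS T y)"
    show "\<forall>x \<in> Prim. keys_property P (fact_keys R M S' x)"
    proof
      fix x assume x: "x \<in> Prim"
      have "\<one>\<^bsub>RS\<^esub> \<odot>\<^bsub>MS\<^esub> j x \<in> carrier MS - {\<zero>\<^bsub>MS\<^esub>}"
        unfolding MS_nonzero_iff using x loc.Units_one_closed by blast
      then have "keys_property P (fact_keys RS MS T (\<one>\<^bsub>RS\<^esub> \<odot>\<^bsub>MS\<^esub> j x))"
        using all by blast
      then show "keys_property P (fact_keys R M S' x)"
        using unit[OF loc.Units_one_closed x] keys_property_j[OF x] by simp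
    qed
  next
    assume all: "\<forall>x \<in> Prim. keys_property P (fact_keys R M S' x)"
    show "\<forall>y \<in> carrier MS - {\<zero>\<^bsub>MS\<^esub>}. keys_property P (fact_keys RS MS T y)"
    proof
      fix y assume "y \<in> carrier MS - {\<zero>\<^bsub>MS\<^esub>}"
      then obtain w x where w: "w \<in> Units RS" and x: "x \<in> Prim" and y: "y = w \<odot>\<^bsub>MS\<^esub> j x"
        unfolding MS_nonzero_iff by blast
      show "keys_property P (fact_keys RS MS T y)"
        unfolding y unit[OF w x] keys_property_j[OF x] using all x by blast
    qed
  qed
qed

text \<open>Mapping factorizations to \<open>RS\<close> and lifting them back both preserve the
  length, and every nonzero element of \<open>MS\<close> is a unit times some
  \<open>j x\<close>.\<close>

lemma bounded_localization:
  "bounded_fact_on RS MS T (carrier MS - {\<zero>\<^bsub>MS\<^esub>}) \<longleftrightarrow> bounded_fact_on R M S' Prim"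
proof
  assume bounded: "bounded_fact_on RS MS T (carrier MS - {\<zero>\<^bsub>MS\<^esub>})"
  show "bounded_fact_on R M S' Prim"
    unfolding bounded_fact_on_def
  proof
    fix x assume x: "x \<in> Prim"
    have "j x \<in> carrier MS - {\<zero>\<^bsub>MS\<^esub>}"
      using mfrac_eq_zero_iff[of x \<one>] x Prim_closed[OF x] by simp
    then obtain N where N: "\<And>fs y. (fs, y) \<in> factorizations RS MS T (j x) \<Longrightarrow> length fs \<le> N"
      using bounded unfolding bounded_fact_on_def by blast
    have "length ss \<le> N" if "(ss, n) \<in> factorizations R M S' x" for ss n
      using N[OF factorizations_j[OF x that]] by simp
    then show "\<exists>N. \<forall>(ss, n) \<in> factorizations R M S' x. length ss \<le> N"
      by blast
  qed
next
  assume bounded: "bounded_fact_on R M S' Prim"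
  show "bounded_fact_on RS MS T (carrier MS - {\<zero>\<^bsub>MS\<^esub>})"
    unfolding bounded_fact_on_def
  proof
    fix y assume "y \<in> carrier MS - {\<zero>\<^bsub>MS\<^esub>}"
    then obtain w x where w: "w \<in> Units RS" and x: "x \<in> Prim" and y: "y = w \<odot>\<^bsub>MS\<^esub> j x"
      unfolding MS_nonzero_iff by blast
    obtain N where N: "\<And>ss n. (ss, n) \<in> factorizations R M S' x \<Longrightarrow> length ss \<le> N"
      using bounded x unfolding bounded_fact_on_def by blast
    have "length fs \<le> N" if f: "(fs, z) \<in> factorizations RS MS T y" for fs z
    proof -
      have "inv\<^bsub>RS\<^esub> w \<odot>\<^bsub>MS\<^esub> y = j x"
        unfolding y using w Prim_closed[OF x] by simp
      then have "(fs, inv\<^bsub>RS\<^esub> w \<odot>\<^bsub>MS\<^esub> z) \<in> factorizations RS MS T (j x)"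
        using loc.factorizations_unit[OF _ f, of "inv\<^bsub>RS\<^esub> w"] w by simp
      then obtain ps n where "(ps, n) \<in> factorizations R M S' x" "list_all2 lifts fs ps"
        using factorizations_lift[OF x] by blast
      then show ?thesis
        using N list_all2_lengthD by fastforce
    qed
    then show "\<exists>N. \<forall>(fs, z) \<in> factorizations RS MS T y. length fs \<le> N"
      by blast
  qed
qed

text \<open>If \<open>r\<close> fixes \<open>x\<close>, then \<open>i r\<close> is a unit, so
  \<open>r \<in> S\<close>, and an element of \<open>S\<close> dividing a primitive element is a
  unit. Conversely, if \<open>f\<close> fixes an element, then \<open>f\<close> is a unit of
  \<open>RS\<close> times \<open>i p\<close>, and \<open>p\<close> fixes a primitive
  \<open>x'\<close> up to a unit of \<open>R\<close>; hence \<open>p\<close> is a unit.\<close>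

lemma presimplifiable_localization:
  "presimplifiable_on RS MS T (carrier MS - {\<zero>\<^bsub>MS\<^esub>}) \<longleftrightarrow> presimplifiable_on R M S' Prim"
proof
  assume pre: "presimplifiable_on RS MS T (carrier MS - {\<zero>\<^bsub>MS\<^esub>})"
  show "presimplifiable_on R M S' Prim"
    unfolding presimplifiable_on_def
  proof (intro ballI impI disjI1)
    fix r x assume r: "r \<in> S'" and x: "x \<in> Prim" and eq: "r \<odot>\<^bsub>M\<^esub> x = x"
    have xc: "x \<in> carrier M" and rc: "r \<in> carrier R"
      using x Prim_closed r by auto
    have j: "j x \<in> carrier MS - {\<zero>\<^bsub>MS\<^esub>}"
      using mfrac_eq_zero_iff[of x \<one>] x xc by simp
    moreover have "i r \<odot>\<^bsub>MS\<^esub> j x = j x"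
      using i_act_j[OF rc xc] unfolding eq .
    ultimately have "i r \<in> Units RS"
      using pre i_T[OF r] unfolding presimplifiable_on_def by blast
    then have "r \<in> S"
      using rfrac_Units_iff[OF rc] by simp
    then show "r \<in> Units R"
      using Prim_Unit[OF x _ xc eq[symmetric]] by blast
  qed
next
  assume pre: "presimplifiable_on R M S' Prim"
  show "presimplifiable_on RS MS T (carrier MS - {\<zero>\<^bsub>MS\<^esub>})"
    unfolding presimplifiable_on_def
  proof (intro ballI impI disjI1)
    fix f y assume f: "f \<in> T" and "y \<in> carrier MS - {\<zero>\<^bsub>MS\<^esub>}" and eq: "f \<odot>\<^bsub>MS\<^esub> y = y"
    then obtain w x where w: "w \<in> Units RS" and x: "x \<in> Prim" and y: "y = w \<odot>\<^bsub>MS\<^esub> j x"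
      unfolding MS_nonzero_iff by blast
    have xc: "x \<in> carrier M"
      using x Prim_closed by blast
    have jx: "j x \<in> carrier MS" and fc: "f \<in> carrier RS" and wc: "inv\<^bsub>RS\<^esub> w \<in> carrier RS"
      and yc: "y \<in> carrier MS"
      using xc f w unfolding y by auto
    have jy: "j x = inv\<^bsub>RS\<^esub> w \<odot>\<^bsub>MS\<^esub> y"
      unfolding y using w jx by simp
    have "f \<odot>\<^bsub>MS\<^esub> j x = inv\<^bsub>RS\<^esub> w \<odot>\<^bsub>MS\<^esub> (f \<odot>\<^bsub>MS\<^esub> y)"
      unfolding jy using fc wc yc by (rule loc.act_left_commute)
    then have "j x = f \<odot>\<^bsub>MS\<^esub> j x"
      unfolding eq jy[symmetric] by (rule sym)
    then obtain p x' u v w' where p: "p \<in> S'" "S_free p" "x' \<in> Prim" "u \<in> Units R" "v \<in> Units RS"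
    "w' \<in> Units RS" "f = v \<otimes>\<^bsub>RS\<^esub> i p" "j x = w' \<odot>\<^bsub>MS\<^esub> j x'" "x = u \<odot>\<^bsub>M\<^esub> (p \<odot>\<^bsub>M\<^esub> x')"
      by (rule frac_step[OF x f jx])
    have x'c: "x' \<in> carrier M" and pc: "p \<in> carrier R"
      using p(1) Prim_closed[OF p(3)] by auto
    obtain u' where u': "u' \<in> Units R" "x = u' \<odot>\<^bsub>M\<^esub> x'"
      using Unit_act_j_eq[OF p(6,3) x p(8)] by blast
    have c: "u \<in> carrier R" "inv u' \<in> carrier R"
      using p(4) u'(1) by auto
    have "x' = inv u' \<odot>\<^bsub>M\<^esub> x"
      unfolding u'(2) using u'(1) x'c by simp
    also have "\<dots> = (inv u' \<otimes> (u \<otimes> p)) \<odot>\<^bsub>M\<^esub> x'"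
      unfolding p(9) using c pc x'c by (simp add: act_mult)
    finally have "(inv u' \<otimes> (u \<otimes> p)) \<odot>\<^bsub>M\<^esub> x' = x'" ..
    moreover have "inv u' \<otimes> (u \<otimes> p) \<in> S'"
      using u'(1) p(1,4) by simp
    ultimately have "inv u' \<otimes> (u \<otimes> p) \<in> Units R"
      using pre p(3) unfolding presimplifiable_on_def by blast
    moreover have "inv u' \<otimes> (u \<otimes> p) = (inv u' \<otimes> u) \<otimes> p"
      using c pc by (simp add: m_assoc)
    ultimately have "(inv u' \<otimes> u) \<otimes> p \<in> S"
      by simp
    then have "p \<in> S"
      using saturated'[of "inv u' \<otimes> u" p] c pc by simp
    then have "i p \<in> Units RS"
      using rfrac_Units_iff[of p \<one>] by simp
    then show "f \<in> Units RS"
      unfolding p(7) using p(5) by blast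
  qed
qed

end

section \<open>Assembling the equivalences\<close>

context splitting
begin

text \<open>The units, left out of \<open>ring_has_property_in\<close>, satisfy every property trivially.\<close>

lemma Units_ring_factorizations:
  assumes u: "u \<in> Units R"
  shows "factorizations R (regular_module R) (carrier R) u = {([], u)}"
proof (intro equalityI subsetI)
  fix f assume f: "f \<in> factorizations R (regular_module R) (carrier R) u"
  obtain ss c where f_eq: "f = (ss, c)"
    by (cases f)
  note f' = ring.factorizationsD[OF f[unfolded f_eq]]
  have c: "c \<in> carrier R"
    using f'(4) by simp
  have "a \<notin> set ss" for a
  proof
    assume a: "a \<in> set ss"
    have ac: "a \<in> carrier R"
      using a f'(2) by blast
    obtain q where q: "q \<in> carrier R" "list_prod R ss = a \<otimes> q"
      using list_prod_mem_factor[OF f'(2) a] by blast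
    have "u = a \<otimes> (q \<otimes> c)"
      using f'(5) q ac c by (simp add: m_assoc)
    then have "a \<in> Units R"
      using unit_factor[of a "q \<otimes> c"] u ac q(1) c by blast
    then show False
      using f'(3) a by blast
  qed
  then have "ss = []"
    by (cases ss) auto
  then show "f \<in> {([], u)}"
    using f'(5) c unfolding f_eq by simp
next
  fix f :: "'a list \<times> 'a" assume "f \<in> {([], u)}"
  then show "f \<in> factorizations R (regular_module R) (carrier R) u"
    using u unfolding factorizations_def by (simp add: Units_closed)
qed

text \<open>Elements of \<open>S\<close> act injectively on the nonzero module \<open>M\<close>, so
  \<open>S\<close> contains neither zero nor an annihilating element. A unit has only the
  factorization of length zero.\<close>

lemma ring_has_property_in_iff:
  "ring_has_property_in P R (S - annihilator R M) \<longleftrightarrow>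
     property_on P R (regular_module R) (carrier R) S"
proof -
  have "S - annihilator R M = S"
    using S_acts unfolding acts_def annihilator_def by blast
  moreover have "\<zero> \<notin> S"
    using S_acts zero_act unfolding acts_def by blast
  ultimately have E: "S - annihilator R M = S" "S - {\<zero>} = S"
    by auto
  have fact: "factorizations R (regular_module R) (carrier R) u = {([], u)}"
    and atomic: "atomic_factorizations R (regular_module R) (carrier R) u = {([], u)}"
    if u: "u \<in> Units R" for u
    using Units_ring_factorizations[OF u] Units_ring_mprimitive[OF u]
    unfolding atomic_factorizations_def by auto
  have keys: "keys_property P (fact_keys R (regular_module R) (carrier R) u)"
    if u: "u \<in> Units R" for u
    unfolding fact_keys_def atomic[OF u] by (cases P) auto
  consider (k) "P \<in> keyed_properties" "P \<noteq> Presimplifiable" | (b) "P = Bounded_Fact"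
    | (p) "P = Presimplifiable"
    by (cases P) auto
  then show ?thesis
  proof cases
    case k
    have "(\<forall>s \<in> S - Units R. keys_property P (fact_keys R (regular_module R) (carrier R) s)) \<longleftrightarrow>
        (\<forall>s \<in> S. keys_property P (fact_keys R (regular_module R) (carrier R) s))"
      using keys by blast
    then show ?thesis
      using k(2) unfolding ring_has_property_in_def E ring.property_on_iff_keys[OF k(1)] by simp
  next
    case b
    have "\<exists>N. \<forall>(ss, n) \<in> factorizations R (regular_module R) (carrier R) u. length ss \<le> N"
      if "u \<in> Units R" for u
      unfolding fact[OF that] by simp
    then have "bounded_fact_on R (regular_module R) (carrier R) (S - Units R) \<longleftrightarrow>
        bounded_fact_on R (regular_module R) (carrier R) S"
      unfolding bounded_fact_on_def by blast
    then show ?thesis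
      unfolding ring_has_property_in_def E b property_on.simps by simp
  next
    case p
    then show ?thesis
      unfolding ring_has_property_in_def E by simp
  qed
qed

text \<open>With \<open>S' = S\<close> the factor \<open>Prim\<close> is trivial by
  \<open>property_on_Prim\<close>. In the bounded case, the compactness required by
  \<open>bounded_product\<close> comes from the assumed boundedness in the ring.\<close>

lemma property_ring_iff:
  "property_on P R M S (carrier M - {\<zero>\<^bsub>M\<^esub>}) \<longleftrightarrow> property_on P R (regular_module R) (carrier R) S"
proof -
  interpret self: splitting_pair R M S S
    by (rule splitting_pair_self)
  consider "P \<in> keyed_properties" | "P = Bounded_Fact" | "P = Presimplifiable"
    by (cases P) auto
  then show ?thesis
  proof cases
    case 1
    then show ?thesis
      using self.keyed_property_product[OF 1] property_on_Prim[of P] by blast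
  next
    case 2
    show ?thesis
      unfolding 2 property_on.simps
      using self.bounded_ring_of_bounded self.bounded_product self.compactly_atomic_of_bounded
        property_on_Prim[of Bounded_Fact, unfolded property_on.simps] by blast
  next
    case 3
    show ?thesis
      unfolding 3 property_on.simps self.presimplifiable_product
      using presimplifiable_ring property_on_Prim[of Presimplifiable, unfolded property_on.simps]
      by blast
  qed
qed

end

lemma (in compact_splitting_pair) property_product:
  "property_on P R M S' (carrier M - {\<zero>\<^bsub>M\<^esub>}) \<longleftrightarrow>
     property_on P R (regular_module R) (carrier R) S \<and>
     property_on P RS MS T (carrier MS - {\<zero>\<^bsub>MS\<^esub>})"
proof -
  consider "P \<in> keyed_properties" | "P = Bounded_Fact" | "P = Presimplifiable"
    by (cases P) auto
  then show ?thesis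
  proof cases
    case 1
    then show ?thesis
      using keyed_property_product[OF 1] keyed_property_localization[OF 1] by blast
  next
    case 2
    have "bounded_fact_on R M S' Prim" if "bounded_fact_on R M S' (carrier M - {\<zero>\<^bsub>M\<^esub>})"
      using that Prim_closed unfolding bounded_fact_on_def by blast
    then show ?thesis
      unfolding 2 property_on.simps bounded_localization
      using bounded_ring_of_bounded bounded_product[OF compact] by blast
  next
    case 3
    show ?thesis
      unfolding 3 property_on.simps presimplifiable_product presimplifiable_localization
      using presimplifiable_ring by blast
  qed
qed

text \<open>Compactness is obtained from either side of the equivalence to be proved. There is no
  circularity: \<open>keyed_property_product\<close> and \<open>bounded_ring_of_bounded\<close> hold
  before any denominators are cleared.\<close>

lemma (in splitting_pair) compactly_atomic_of_property:
  assumes P: "P \<in> {Unique_Fact, Finite_Fact, Half_Factorial, Bounded_Fact}"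
    and "property_on P R M S' (carrier M - {\<zero>\<^bsub>M\<^esub>}) \<or>
      property_on P R (regular_module R) (carrier R) S"
  shows "compactly_atomic R (regular_module R) S (S' - annihilator R M)"
proof (rule compactly_atomic_of_bounded)
  consider (k) "P \<in> {Unique_Fact, Finite_Fact, Half_Factorial}" | (b) "P = Bounded_Fact"
    using P by blast
  then show "bounded_fact_on R (regular_module R) (carrier R) S"
  proof cases
    case k
    then have "P \<in> keyed_properties"
      by blast
    then have "property_on P R (regular_module R) (carrier R) S"
      using assms(2) keyed_property_product by blast
    then show ?thesis
      using bounded_of_keyed_property k by blast
  next
    case b
    then show ?thesis
      using assms(2) bounded_ring_of_bounded by auto
  qed
qed

section \<open>From modules to cancellative actions\<close>

lemma module_cancel:
  assumes "module R M" "s \<in> carrier R" "s \<notin> zero_divisors_on R M"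
    "m \<in> carrier M" "n \<in> carrier M" "s \<odot>\<^bsub>M\<^esub> m = s \<odot>\<^bsub>M\<^esub> n"
  shows "m = n"
proof -
  interpret module R M by (rule assms(1))
  \<comment> \<open>The difference of \<open>m\<close> and \<open>n\<close> is killed by
    \<open>s\<close>, which is not a zero divisor on \<open>M\<close>.\<close>
  have "s \<odot>\<^bsub>M\<^esub> (m \<oplus>\<^bsub>M\<^esub> \<ominus>\<^bsub>M\<^esub> n) = s \<odot>\<^bsub>M\<^esub> n \<oplus>\<^bsub>M\<^esub> \<ominus>\<^bsub>M\<^esub> (s \<odot>\<^bsub>M\<^esub> n)"
    using assms(2,4-6) by (simp add: smult_r_distr smult_r_minus)
  also have "\<dots> = \<zero>\<^bsub>M\<^esub>"
    using assms(2,5) by (simp add: M.r_neg)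
  finally have "s \<odot>\<^bsub>M\<^esub> (m \<oplus>\<^bsub>M\<^esub> \<ominus>\<^bsub>M\<^esub> n) = \<zero>\<^bsub>M\<^esub>" .
  moreover have "m \<oplus>\<^bsub>M\<^esub> \<ominus>\<^bsub>M\<^esub> n \<in> carrier M"
    using assms(4,5) by simp
  ultimately have "m \<oplus>\<^bsub>M\<^esub> \<ominus>\<^bsub>M\<^esub> n = \<zero>\<^bsub>M\<^esub>"
    using assms(2,3) unfolding zero_divisors_on_def by blast
  then have "\<ominus>\<^bsub>M\<^esub> (\<ominus>\<^bsub>M\<^esub> n) = m"
    using assms(4,5) by (intro M.minus_equality) simp_all
  then show ?thesis
    using assms(5) by simp
qed

text \<open>Lets \<open>module_cancel\<close> yield cancellation in \<open>R\<close> as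
  well.\<close>

lemma regular_module_module:
  assumes "cring R"
  shows "module R (regular_module R)"
proof -
  interpret cring R by (rule assms)
  have "abelian_group (regular_module R)"
  proof (rule abelian_groupI)
    show "\<exists>y \<in> carrier (regular_module R). y \<oplus>\<^bsub>regular_module R\<^esub> x = \<zero>\<^bsub>regular_module R\<^esub>"
      if "x \<in> carrier (regular_module R)" for x
      using that by (auto simp: regular_module_def intro: bexI[of _ "\<ominus>\<^bsub>R\<^esub> x"] l_neg)
  qed (auto simp: regular_module_def a_ac)
  then show ?thesis
    by (intro moduleI assms)
      (auto simp: regular_module_def l_distr r_distr m_assoc)
qed

lemma splitting_pair_of_module:
  assumes "module R M" "carrier M \<noteq> {\<zero>\<^bsub>M\<^esub>}" "saturated_submonoid R S" "saturated_submonoid R S'"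
    "S \<subseteq> S'" "splits R M S (carrier M)" "S \<inter> zero_divisors_on R M = {}"
    "S \<inter> zero_divisors_on R (regular_module R) = {}"
  shows "splitting_pair R M S S'"
proof -
  interpret module R M by (rule assms(1))
  have sub: "submonoid S R" "submonoid S' R"
    using assms(3,4) unfolding saturated_submonoid_def by blast+
  have Sc: "s \<in> carrier R" if "s \<in> S" for s
    using that submonoid.subset[OF sub(1)] by blast
  have one: "\<one>\<^bsub>R\<^esub> \<in> S"
    by (rule submonoid.one_closed[OF sub(1)])
  \<comment> \<open>A saturated submonoid contains every divisor of \<open>1\<close>.\<close>
  have "Units R \<subseteq> S"
  proof
    fix u assume "u \<in> Units R"
    then obtain v where "u \<in> carrier R" "v \<in> carrier R" "u \<otimes>\<^bsub>R\<^esub> v = \<one>\<^bsub>R\<^esub>"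
      unfolding Units_def by blast
    then show "u \<in> S"
      using assms(3) one unfolding saturated_submonoid_def by metis
  qed
  show ?thesis
  proof (intro splitting_pair.intro splitting.intro localization.intro factor_action.intro
      monoid_action.intro splitting_pair_axioms.intro splitting_axioms.intro
      localization_axioms.intro factor_action_axioms.intro monoid_action_axioms.intro)
    show "comm_monoid R"
      by (rule R.comm_monoid_axioms)
    show "m = n" if "s \<in> S" "m \<in> carrier M" "n \<in> carrier M" "s \<odot>\<^bsub>M\<^esub> m = s \<odot>\<^bsub>M\<^esub> n" for s m n
      using module_cancel[OF assms(1) Sc[OF that(1)] _ that(2-4)] that(1) assms(7) by blast
    show "a = b" if "s \<in> S" "a \<in> carrier R" "b \<in> carrier R" "s \<otimes>\<^bsub>R\<^esub> a = s \<otimes>\<^bsub>R\<^esub> b" for s a b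
      using module_cancel[OF regular_module_module[OF R.cring_axioms] Sc[OF that(1)], of a b]
        that assms(8) by auto
    show "a \<in> S" if "a \<in> carrier R" "b \<in> carrier R" "a \<otimes>\<^bsub>R\<^esub> b \<in> S" for a b
      using assms(3) that unfolding saturated_submonoid_def by blast
    show "a \<in> S'" if "a \<in> carrier R" "b \<in> carrier R" "a \<otimes>\<^bsub>R\<^esub> b \<in> S'" for a b
      using assms(4) that unfolding saturated_submonoid_def by blast
  qed (use assms sub \<open>Units R \<subseteq> S\<close> in \<open>auto simp: smult_assoc1 smult_l_null smult_r_null\<close>)
qed

theorem corollary4p9:
  fixes R :: "('a, 'c) ring_scheme" and M :: "('a, 'b, 'd) module_scheme"
    and S S' :: "'a set" and T :: "('a \<times> 'a) set set"
  assumes "module R M"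
    and "carrier M \<noteq> {\<zero>\<^bsub>M\<^esub>}"
    and "saturated_submonoid R S"
    and "saturated_submonoid R S'"
    and "S \<subseteq> S'"
    and "T = loc_set R S S'"
    and "splits R M S (carrier M)"
    and "S \<inter> zero_divisors_on R M = {}"
    and "S \<inter> zero_divisors_on R (regular_module R) = {}"
  shows "(\<forall>P \<in> {Unique_Fact, Finite_Fact, Half_Factorial, Bounded_Fact}.
            (has_property P R M S' \<longleftrightarrow>
               has_property P R M S \<and> has_property P (loc_ring R S) (loc_module R M S) T) \<and>
            (has_property P R M S' \<longleftrightarrow>
               ring_has_property_in P R (S - annihilator R M) \<and>
               has_property P (loc_ring R S) (loc_module R M S) T)) \<and>
         (compactly_atomic R (regular_module R) S (S' - annihilator R M) \<longrightarrow>
            (\<forall>P \<in> {Presimplifiable, Atomic}.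
               (has_property P R M S' \<longleftrightarrow>
                  has_property P R M S \<and> has_property P (loc_ring R S) (loc_module R M S) T) \<and>
               (has_property P R M S' \<longleftrightarrow>
                  ring_has_property_in P R (S - annihilator R M) \<and>
                  has_property P (loc_ring R S) (loc_module R M S) T)))"
proof -
  interpret splitting_pair R M S S'
    using assms by (intro splitting_pair_of_module)
  let ?c = "compactly_atomic R (regular_module R) S (S' - annihilator R M)"
  let ?r = "\<lambda>P. property_on P R (regular_module R) (carrier R) S"
  let ?L = "\<lambda>P. has_property P (loc_ring R S) (loc_module R M S) T"
  have ring: "ring_has_property_in P R (S - annihilator R M) \<longleftrightarrow> ?r P" for P
    by (rule ring_has_property_in_iff)
  have small: "has_property P R M S \<longleftrightarrow> ?r P" for P
    unfolding has_property_def by (rule property_ring_iff)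
  \<comment> \<open>Statements (1) and (3), for every property, once numerators in \<open>S'\<close>
    can be split.\<close>
  have product: "has_property P R M S' \<longleftrightarrow> ?r P \<and> ?L P" if ?c for P
  proof -
    interpret compact_splitting_pair R M S S'
      by unfold_locales (rule that)
    show ?thesis
      unfolding has_property_def assms(6) by (rule property_product)
  qed
  \<comment> \<open>If neither (1) nor the ring condition holds, all three statements fail;
    otherwise compactness is available.\<close>
  have compact: ?c if "P \<in> {Unique_Fact, Finite_Fact, Half_Factorial, Bounded_Fact}"
    "has_property P R M S' \<or> ?r P" for P
    using compactly_atomic_of_property that unfolding has_property_def by blast
  show ?thesis
    unfolding ring small using product compact by blast
qed

end
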